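(* Let $n\ge 4$ and $\varepsilon>0$. If $(u_0,u_1)\in (L^{1,1}(\mathbf{R}^n)\cap Y^{\frac n2+\varepsilon})\times (L^{1,1}(\mathbf{R}^n)\cap Y^{\frac{n-2}{2}+\varepsilon})$ and $P_0+P_1\neq 0$, then there exist constants $C_1,C_2>0$ independent of $t$ such that the solution $u$ of $u_{tt}+Lu+(I+L)^{-1}u_t=0$, $u(0,\cdot)=u_0$, $u_t(0,\cdot)=u_1$, satisfies $$C_1|P_0+P_1|\,t^{-\frac n4}\le \|u(t,\cdot)\|_{L^2(\mathbf{R}^n)}\le C_2 I_{0,\frac n2+\varepsilon-1}\,t^{-\frac n4}$$ for all sufficiently large $t$.
   Context: The Fourier transform is $\hat f(\xi)=\int_{\mathbf{R}^n}e^{-ix\cdot\xi}f(x)\,dx$ (extended to $L^2(\mathbf{R}^n)$). The operator $L$ on $L^2(\mathbf{R}^n)$ is the Fourier multiplier $\widehat{Lf}(\xi)=\log(1+|\xi|^2)\hat f(\xi)$ with its maximal domain. For $\delta\ge 0$, $Y^\delta=\{f\in L^2(\mathbf{R}^n):\int_{\mathbf{R}^n}(1+\log(1+|\xi|^2))^\delta|\hat f(\xi)|^2d\xi<\infty\}$, with norm $\|f\|_{Y^\delta}=\big(\int_{\mathbf{R}^n}(1+\log(1+|\xi|^2))^\delta|\hat f(\xi)|^2d\xi\big)^{1/2}$. $L^{1,1}(\mathbf{R}^n)=\{f\in L^1(\mathbf{R}^n):\|f\|_{1,1}:=\int_{\mathbf{R}^n}(1+|x|)|f(x)|dx<\infty\}$.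 Cauchy problem: $u_{tt}+Lu+(I+L)^{-1}u_t=0$ on $(0,\infty)\times\mathbf{R}^n$, $u(0,\cdot)=u_0$, $u_t(0,\cdot)=u_1$. For $(u_0,u_1)\in Y^2\times Y^1$ the solution is the unique weak solution $u\in C([0,\infty),Y^2)\cap C^1([0,\infty),Y^1)\cap C^2([0,\infty),L^2(\mathbf{R}^n))$; for a.e. $\xi$, $\hat u(t,\xi)$ solves $\hat u_{tt}+\log(1+|\xi|^2)\hat u+(1+\log(1+|\xi|^2))^{-1}\hat u_t=0$ with $\hat u(0,\xi)=\hat u_0(\xi)$, $\hat u_t(0,\xi)=\hat u_1(\xi)$. Notation: $I_{0,l}:=\sqrt{\|u_0\|_{1,1}^2+\|u_1\|_{1,1}^2+\|u_0\|_{Y^{l+1}}^2+\|u_1\|_{Y^l}^2}$ and $P_j:=\int_{\mathbf{R}^n}u_j(x)\,dx$ ($j=0,1$). *)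

theory Defs
  imports "HOL-Analysis.Analysis"
begin

text \<open>Functions on \<open>\<real>\<^sup>n\<close> are complex-valued functions on \<^typ>\<open>real ^ 'n\<close>, with
  \<open>n = CARD('n)\<close>. Elements of \<open>L\<^sup>2\<close> are Borel representatives, and identities between them
  are stated almost everywhere.\<close>

type_synonym 'n fn = "real ^ 'n \<Rightarrow> complex"

definition L2 :: "('n::finite) fn set" where
  "L2 = {f. f \<in> borel_measurable lborel \<and> integrable lborel (\<lambda>x. (cmod (f x))\<^sup>2)}"

definition L2_norm :: "('n::finite) fn \<Rightarrow> real" where
  "L2_norm f = sqrt (\<integral>x. (cmod (f x))\<^sup>2 \<partial>lborel)"

definition L11 :: "('n::finite) fn set" where
  "L11 = {f. integrable lborel f \<and> integrable lborel (\<lambda>x. (1 + norm x) * cmod (f x))}"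

definition L11_norm :: "('n::finite) fn \<Rightarrow> real" where
  "L11_norm f = (\<integral>x. (1 + norm x) * cmod (f x) \<partial>lborel)"

definition fourier_L1 :: "('n::finite) fn \<Rightarrow> 'n fn" where
  "fourier_L1 f \<xi> = (\<integral>x. exp (- \<i> * complex_of_real (x \<bullet> \<xi>)) * f x \<partial>lborel)"

text \<open>The extension of the Fourier transform to \<open>L\<^sup>2\<close> by continuity from the dense subspace
  \<open>L\<^sup>1 \<inter> L\<^sup>2\<close>. By the Plancherel theorem every \<open>f\<close> in \<open>L\<^sup>2\<close> is related to some \<open>g\<close>, which is
  unique up to null sets. The condition that the transforms of the approximants lie in \<open>L\<^sup>2\<close>
  always holds; it is stated so that \<^const>\<open>L2_norm\<close> is only applied to members of \<open>L\<^sup>2\<close>.\<close>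

definition has_fourier :: "('n::finite) fn \<Rightarrow> 'n fn \<Rightarrow> bool" where
  "has_fourier f g \<longleftrightarrow> f \<in> L2 \<and> g \<in> L2 \<and>
     (\<exists>\<phi>::nat \<Rightarrow> 'n fn.
        (\<forall>k. integrable lborel (\<phi> k) \<and> \<phi> k \<in> L2 \<and> fourier_L1 (\<phi> k) \<in> L2) \<and>
        (\<lambda>k. L2_norm (\<lambda>x. \<phi> k x - f x)) \<longlonglongrightarrow> 0 \<and>
        (\<lambda>k. L2_norm (\<lambda>\<xi>. fourier_L1 (\<phi> k) \<xi> - g \<xi>)) \<longlonglongrightarrow> 0)"

definition fourier :: "('n::finite) fn \<Rightarrow> 'n fn" where
  "fourier f = (SOME g. has_fourier f g)"

definition log_symbol :: "real ^ ('n::finite) \<Rightarrow> real" where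
  "log_symbol \<xi> = ln (1 + (norm \<xi>)\<^sup>2)"

definition Y :: "real \<Rightarrow> ('n::finite) fn set" where
  "Y \<delta> = {f \<in> L2. \<exists>g. has_fourier f g \<and>
     integrable lborel (\<lambda>\<xi>. (1 + log_symbol \<xi>) powr \<delta> * (cmod (g \<xi>))\<^sup>2)}"

definition Y_norm :: "real \<Rightarrow> ('n::finite) fn \<Rightarrow> real" where
  "Y_norm \<delta> f =
     sqrt (\<integral>\<xi>. (1 + log_symbol \<xi>) powr \<delta> * (cmod (fourier f \<xi>))\<^sup>2 \<partial>lborel)"

text \<open>The unbounded operator \<open>L\<close> and the inverse \<open>(I + L)\<^sup>-\<^sup>1\<close> are given by their graphs:
  \<open>L_graph f g\<close> says that \<open>f\<close> is in the maximal domain of \<open>L\<close> and \<open>L f = g\<close>.\<close>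

definition L_graph :: "('n::finite) fn \<Rightarrow> 'n fn \<Rightarrow> bool" where
  "L_graph f g \<longleftrightarrow> (\<exists>F G. has_fourier f F \<and> has_fourier g G \<and>
     (AE \<xi> in lborel. G \<xi> = complex_of_real (log_symbol \<xi>) * F \<xi>))"

definition IL_inverse_graph :: "('n::finite) fn \<Rightarrow> 'n fn \<Rightarrow> bool" where
  "IL_inverse_graph f w \<longleftrightarrow> (\<exists>g. L_graph w g \<and> (AE x in lborel. w x + g x = f x))"

text \<open>Continuity and differentiability on \<open>[0,\<infinity>)\<close> of curves of functions with respect to a
  norm \<open>N\<close>; one-sided at \<open>0\<close>.\<close>

definition curve_continuous ::
    "(('n::finite) fn \<Rightarrow> real) \<Rightarrow> (real \<Rightarrow> 'n fn) \<Rightarrow> bool" where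
  "curve_continuous N u \<longleftrightarrow>
     (\<forall>t\<ge>0. ((\<lambda>s. N (\<lambda>x. u s x - u t x)) \<longlongrightarrow> 0) (at t within {0..}))"

definition curve_derivative ::
    "(('n::finite) fn \<Rightarrow> real) \<Rightarrow> (real \<Rightarrow> 'n fn) \<Rightarrow> (real \<Rightarrow> 'n fn) \<Rightarrow> bool" where
  "curve_derivative N u v \<longleftrightarrow>
     (\<forall>t\<ge>0. ((\<lambda>s. N (\<lambda>x. (u s x - u t x) / complex_of_real (s - t) - v t x)) \<longlongrightarrow> 0)
        (at t within {0..}))"

text \<open>A function \<open>u\<close> in \<open>C([0,\<infinity>),Y\<^sup>2) \<inter> C\<^sup>1([0,\<infinity>),Y\<^sup>1) \<inter> C\<^sup>2([0,\<infinity>),L\<^sup>2)\<close>, with time derivatives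
  \<open>v = u\<^sub>t\<close> and \<open>a = u\<^sub>t\<^sub>t\<close>, solving the Cauchy problem. For this regularity every term of
  the equation is in \<open>L\<^sup>2\<close>, and being a weak solution amounts to the equation holding in
  \<open>L\<^sup>2\<close> at each positive time.\<close>

definition is_solution :: "('n::finite) fn \<Rightarrow> 'n fn \<Rightarrow> (real \<Rightarrow> 'n fn) \<Rightarrow> bool" where
  "is_solution u0 u1 u \<longleftrightarrow> (\<exists>v a.
     (\<forall>t\<ge>0. u t \<in> Y 2 \<and> v t \<in> Y 1 \<and> a t \<in> L2) \<and>
     curve_continuous (Y_norm 2) u \<and>
     curve_derivative (Y_norm 1) u v \<and> curve_continuous (Y_norm 1) v \<and>
     curve_derivative L2_norm v a \<and> curve_continuous L2_norm a \<and>
     (\<forall>t>0. \<exists>Lu w. L_graph (u t) Lu \<and> IL_inverse_graph (v t) w \<and>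
        (AE x in lborel. a t x + Lu x + w x = 0)) \<and>
     (AE x in lborel. u 0 x = u0 x) \<and> (AE x in lborel. v 0 x = u1 x))"

definition I0 :: "real \<Rightarrow> ('n::finite) fn \<Rightarrow> 'n fn \<Rightarrow> real" where
  "I0 l u0 u1 = sqrt ((L11_norm u0)\<^sup>2 + (L11_norm u1)\<^sup>2 +
     (Y_norm (l + 1) u0)\<^sup>2 + (Y_norm l u1)\<^sup>2)"

definition P :: "('n::finite) fn \<Rightarrow> complex" where
  "P f = (\<integral>x. f x \<partial>lborel)"

end

theory Submission
  imports Defs "HOL-Probability.Probability" "HOL-Real_Asymp.Real_Asymp"
begin

text \<open>On the Fourier side the equation is, for almost every frequency, the damped oscillator
  \<open>y'' + b y' + l y = 0\<close> with \<open>l = log (1 + |\<xi>|\<^sup>2)\<close> and \<open>b = 1 / (1 + l)\<close>. For a root \<open>r\<close> of its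
  characteristic polynomial, the combination \<open>Z = v + (b + r) u\<close> satisfies \<open>Z' = r Z\<close> in \<open>L\<^sup>2\<close> of
  bounded frequencies, hence \<open>Z(t) = e\<^bsup>r t\<^esup> Z(0)\<close> almost everywhere; the two roots differ off a
  sphere and determine the transform of \<open>u(t)\<close> in terms of the transforms of the data.

  For small \<open>l\<close> the roots are real, one comparable to \<open>- l\<close> and the other close to \<open>- 1\<close>, so the
  transform behaves like \<open>e\<^bsup>- l t\<^esup> (P\<^sub>0 + P\<^sub>1)\<close>: this is bounded by a Gaussian of width
  \<open>t\<^bsup>-1/2\<^esup>\<close>, and bounded below on the ball of that radius. For the other frequencies a Lyapunov
  function gives decay like \<open>e\<^bsup>- c t / (1 + l)\<^esup> \<le> C ((1 + l) / t)\<^bsup>n/2\<^esup>\<close>, and the weight is absorbed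
  by the \<open>Y\<close> regularity of the data. Norms are transported by the Plancherel theorem, which is
  obtained by Gaussian regularization and the continuity of translations.\<close>

section \<open>The space \<open>L\<^sup>2\<close>\<close>

text \<open>The obstacle is that the curves are differentiable only in norm: transforms at different
  times are representatives chosen independently, with null sets depending on the time, so no scalar
  ODE can be solved at a fixed frequency. Splitting the equation into two first-order modes avoids
  this: for one mode it suffices that a real function of time, the L2 distance of
  \<open>e^(-rt) Z(t)\<close> from \<open>Z(0)\<close>, has derivative zero. The cutoff in frequency
  is there because the roots are unbounded, and multiplication by an unbounded function need not
  preserve L2. The threshold l = 1/16 separates the regimes. Below it the discriminant is at least
  1/4, so the real roots stay uniformly apart. Above it 16 l is at least 1, which makes the Lyapunov
  constants uniform. There the damping 1/(1+l) degenerates as l grows, so no uniform exponential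
  rate exists; the rate t^(-n/2) for the square is paid for by n/2 powers of 1+l on the first datum.
  The second enters divided by l, so it needs one power less.\<close>

lemma L2_I:
  assumes "f \<in> borel_measurable lborel" "g \<in> L2" "\<And>x. cmod (f x) \<le> cmod (g x)"
  shows "f \<in> L2" "L2_norm f \<le> L2_norm g"
proof -
  have [measurable]: "f \<in> borel_measurable borel" "g \<in> borel_measurable borel"
    and i: "integrable lborel (\<lambda>x. (cmod (g x))\<^sup>2)"
    using assms by (auto simp: L2_def)
  have j: "integrable lborel (\<lambda>x. (cmod (f x))\<^sup>2)"
    by (rule Bochner_Integration.integrable_bound[OF i]) (auto intro!: power_mono assms(3))
  then show "f \<in> L2" by (simp add: L2_def)
  show "L2_norm f \<le> L2_norm g"
    unfolding L2_norm_def
    by (intro real_sqrt_le_mono integral_mono i j power_mono assms(3)) auto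
qed

lemma L2_norm_nonneg [simp]: "L2_norm f \<ge> 0"
  by (simp add: L2_norm_def)

lemma L2_norm_sq: "(L2_norm f)\<^sup>2 = (\<integral>x. (cmod (f x))\<^sup>2 \<partial>lborel)"
  by (simp add: L2_norm_def)

lemma L2_cmult:
  assumes "f \<in> L2"
  shows "(\<lambda>x. c * f x) \<in> L2" "L2_norm (\<lambda>x. c * f x) = cmod c * L2_norm f"
  using assms by (auto simp: L2_def L2_norm_def norm_mult power_mult_distrib real_sqrt_mult)

lemma L2_product_integrable:
  assumes "f \<in> L2" "g \<in> L2"
  shows "integrable lborel (\<lambda>x. cmod (f x) * cmod (g x))"
proof -
  have [measurable]: "f \<in> borel_measurable borel" "g \<in> borel_measurable borel"
    and i: "integrable lborel (\<lambda>x. (cmod (f x))\<^sup>2 + (cmod (g x))\<^sup>2)"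
    using assms by (auto simp: L2_def)
  show ?thesis
  proof (rule Bochner_Integration.integrable_bound[OF i])
    show "AE x in lborel. norm (cmod (f x) * cmod (g x)) \<le> norm ((cmod (f x))\<^sup>2 + (cmod (g x))\<^sup>2)"
    proof (rule AE_I2)
      fix x
      have "cmod (f x) * cmod (g x) \<le> (cmod (f x))\<^sup>2 + (cmod (g x))\<^sup>2"
        using sum_squares_bound[of "cmod (f x)" "cmod (g x)"]
          mult_nonneg_nonneg[OF norm_ge_zero[of "f x"] norm_ge_zero[of "g x"]] by linarith
      then show "norm (cmod (f x) * cmod (g x)) \<le> norm ((cmod (f x))\<^sup>2 + (cmod (g x))\<^sup>2)"
        by (simp add: abs_mult)
    qed
  qed measurable
qed

text \<open>The integral of \<open>(s |f| - t |g|)^2\<close> is a nonnegative quadratic form in the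
  real numbers \<open>s\<close> and \<open>t\<close>; suitable values of these yield the
  inequality.\<close>

lemma L2_Cauchy_Schwarz:
  assumes "f \<in> L2" "g \<in> L2"
  shows "(\<integral>x. cmod (f x) * cmod (g x) \<partial>lborel) \<le> L2_norm f * L2_norm g"
proof -
  let ?I = "\<integral>x. cmod (f x) * cmod (g x) \<partial>lborel"
  have i: "integrable lborel (\<lambda>x. (cmod (f x))\<^sup>2)" "integrable lborel (\<lambda>x. (cmod (g x))\<^sup>2)"
    using assms by (auto simp: L2_def)
  note p = L2_product_integrable[OF assms]
  have *: "0 \<le> s\<^sup>2 * (L2_norm f)\<^sup>2 - 2 * s * t * ?I + t\<^sup>2 * (L2_norm g)\<^sup>2" for s t :: real
  proof -
    have "0 \<le> (\<integral>x. (s * cmod (f x) - t * cmod (g x))\<^sup>2 \<partial>lborel)" by simp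
    also have "\<dots> = (\<integral>x. s\<^sup>2 * (cmod (f x))\<^sup>2 - 2 * s * t * (cmod (f x) * cmod (g x)) + t\<^sup>2 * (cmod (g x))\<^sup>2 \<partial>lborel)"
      by (simp add: power2_eq_square algebra_simps)
    also have "\<dots> = s\<^sup>2 * (L2_norm f)\<^sup>2 - 2 * s * t * ?I + t\<^sup>2 * (L2_norm g)\<^sup>2"
      using i p by (simp add: L2_norm_sq)
    finally show ?thesis .
  qed
  have "?I\<^sup>2 \<le> (L2_norm f)\<^sup>2 * (L2_norm g)\<^sup>2"
  \<comment> \<open>If the norm of \<open>g\<close> vanishes, the form is affine in
    \<open>t\<close>, and a nonzero \<open>?I\<close> would let \<open>t\<close> make it negative.
    Otherwise \<open>s = (L2_norm g)^2\<close> and \<open>t = ?I\<close> produce the discriminant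
    inequality multiplied by \<open>(L2_norm g)^2\<close>.\<close>
  proof (cases "L2_norm g = 0")
    case True
    have "?I = 0"
    proof (rule ccontr)
      assume "?I \<noteq> 0"
      then show False
        using *[of 1 "((L2_norm f)\<^sup>2 + 1) / ?I"] zero_le_power2[of "L2_norm f"]
        unfolding True by simp
    qed
    then show ?thesis by simp
  next
    case False
    have "0 \<le> (L2_norm g)\<^sup>2 * ((L2_norm f)\<^sup>2 * (L2_norm g)\<^sup>2 - ?I\<^sup>2)"
      using *[of "(L2_norm g)\<^sup>2" "?I"] by (simp add: power2_eq_square algebra_simps)
    then show ?thesis using False by (simp add: zero_le_mult_iff)
  qed
  then show ?thesis
    by (metis L2_norm_nonneg abs_le_square_iff abs_of_nonneg abs_le_D1 mult_nonneg_nonneg power_mult_distrib)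
qed

lemma L2_add:
  assumes "f \<in> L2" "g \<in> L2"
  shows "(\<lambda>x. f x + g x) \<in> L2" "L2_norm (\<lambda>x. f x + g x) \<le> L2_norm f + L2_norm g"
proof -
  have m [measurable]: "f \<in> borel_measurable borel" "g \<in> borel_measurable borel"
    and i: "integrable lborel (\<lambda>x. (cmod (f x))\<^sup>2)" "integrable lborel (\<lambda>x. (cmod (g x))\<^sup>2)"
    using assms by (auto simp: L2_def)
  note p = L2_product_integrable[OF assms]
  have b: "(cmod (f x + g x))\<^sup>2 \<le> (cmod (f x))\<^sup>2 + 2 * (cmod (f x) * cmod (g x)) + (cmod (g x))\<^sup>2" for x
  proof -
    have "(cmod (f x + g x))\<^sup>2 \<le> (cmod (f x) + cmod (g x))\<^sup>2"
      by (intro power_mono norm_triangle_ineq) auto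
    then show ?thesis by (simp add: power2_eq_square algebra_simps)
  qed
  have ib: "integrable lborel (\<lambda>x. (cmod (f x))\<^sup>2 + 2 * (cmod (f x) * cmod (g x)) + (cmod (g x))\<^sup>2)"
    using i p by auto
  have sm: "integrable lborel (\<lambda>x. (cmod (f x + g x))\<^sup>2)"
    by (rule Bochner_Integration.integrable_bound[OF ib]) (use b in \<open>auto intro: order_trans[OF b]\<close>)
  then show "(\<lambda>x. f x + g x) \<in> L2" using m by (simp add: L2_def)
  have "(L2_norm (\<lambda>x. f x + g x))\<^sup>2 \<le> (\<integral>x. (cmod (f x))\<^sup>2 + 2 * (cmod (f x) * cmod (g x)) + (cmod (g x))\<^sup>2 \<partial>lborel)"
    unfolding L2_norm_sq by (intro integral_mono sm ib b)
  also have "\<dots> = (L2_norm f)\<^sup>2 + 2 * (\<integral>x. cmod (f x) * cmod (g x) \<partial>lborel) + (L2_norm g)\<^sup>2"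
    using i p by (simp add: L2_norm_sq)
  also have "\<dots> \<le> (L2_norm f + L2_norm g)\<^sup>2"
    using L2_Cauchy_Schwarz[OF assms] by (simp add: power2_eq_square algebra_simps)
  finally show "L2_norm (\<lambda>x. f x + g x) \<le> L2_norm f + L2_norm g"
    by (meson L2_norm_nonneg add_nonneg_nonneg power2_le_imp_le)
qed

lemma L2_diff:
  assumes "f \<in> L2" "g \<in> L2"
  shows "(\<lambda>x. f x - g x) \<in> L2" "L2_norm (\<lambda>x. f x - g x) \<le> L2_norm f + L2_norm g"
  using L2_add[OF assms(1) L2_cmult(1)[OF assms(2), of "-1"]] L2_cmult(2)[OF assms(2), of "-1"]
  by simp_all

lemma L2_norm_diff_le:
  assumes "f \<in> L2" "g \<in> L2"
  shows "\<bar>L2_norm f - L2_norm g\<bar> \<le> L2_norm (\<lambda>x. f x - g x)"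
proof -
  have "L2_norm f \<le> L2_norm (\<lambda>x. f x - g x) + L2_norm g"
    using L2_add(2)[OF L2_diff(1)[OF assms] assms(2)] by simp
  moreover have "L2_norm g \<le> L2_norm (\<lambda>x. g x - f x) + L2_norm f"
    using L2_add(2)[OF L2_diff(1)[OF assms(2,1)] assms(1)] by simp
  moreover have "L2_norm (\<lambda>x. g x - f x) = L2_norm (\<lambda>x. f x - g x)"
    by (simp add: L2_norm_def norm_minus_commute)
  ultimately show ?thesis by linarith
qed

lemma L2_norm_cong_AE:
  assumes "f \<in> borel_measurable lborel" "g \<in> borel_measurable lborel" "AE x in lborel. f x = g x"
  shows "L2_norm f = L2_norm g"
proof -
  have [measurable]: "f \<in> borel_measurable borel" "g \<in> borel_measurable borel" using assms by auto
  show ?thesis unfolding L2_norm_def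
    by (intro arg_cong[where f=sqrt] integral_cong_AE) (use assms in auto)
qed

lemma L2_norm_eq_0:
  assumes "f \<in> L2" "L2_norm f = 0"
  shows "AE x in lborel. f x = 0"
  using assms integral_nonneg_eq_0_iff_AE[of lborel "\<lambda>x. (cmod (f x))\<^sup>2"]
  by (auto simp: L2_def L2_norm_def)

section \<open>Translations and Gaussians\<close>

lemma lborel_integrable_affine:
  fixes f :: "'a::euclidean_space \<Rightarrow> 'b::{banach, second_countable_topology}"
  assumes "c \<noteq> 0" "integrable lborel f"
  shows "integrable lborel (\<lambda>x. f (t + c *\<^sub>R x))"
proof -
  have [measurable]: "f \<in> borel_measurable borel" using assms by auto
  have "integrable (density (distr lborel borel (\<lambda>x. t + c *\<^sub>R x)) (\<lambda>_. ennreal (\<bar>c\<bar>^DIM('a)))) f"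
    using assms lborel_affine[OF assms(1), of t] by simp
  then have "integrable lborel (\<lambda>x. \<bar>c\<bar>^DIM('a) *\<^sub>R f (t + c *\<^sub>R x))"
    by (subst (asm) integrable_density) (auto simp: integrable_distr_eq)
  then have "integrable lborel (\<lambda>x. inverse (\<bar>c\<bar>^DIM('a)) *\<^sub>R \<bar>c\<bar>^DIM('a) *\<^sub>R f (t + c *\<^sub>R x))"
    by (rule integrable_scaleR_right)
  then show ?thesis using assms(1) by simp
qed

lemma lborel_integral_affine:
  fixes f :: "'a::euclidean_space \<Rightarrow> 'b::{banach, second_countable_topology}"
  assumes "c \<noteq> 0" "f \<in> borel_measurable lborel"
  shows "(\<integral>x. f x \<partial>lborel) = \<bar>c\<bar>^DIM('a) *\<^sub>R (\<integral>x. f (t + c *\<^sub>R x) \<partial>lborel)"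
proof -
  have [measurable]: "f \<in> borel_measurable borel" using assms by auto
  have "(\<integral>x. f x \<partial>lborel) = (\<integral>x. f x \<partial>(density (distr lborel borel (\<lambda>x. t + c *\<^sub>R x)) (\<lambda>_. ennreal (\<bar>c\<bar>^DIM('a)))))"
    using lborel_affine[OF assms(1), of t] by simp
  also have "\<dots> = (\<integral>x. \<bar>c\<bar>^DIM('a) *\<^sub>R f (t + c *\<^sub>R x) \<partial>lborel)"
    by (subst integral_density) (auto simp: integral_distr)
  finally show ?thesis by simp
qed

lemma lborel_integral_translate:
  fixes f :: "'a::euclidean_space \<Rightarrow> 'b::{banach, second_countable_topology}"
  assumes "f \<in> borel_measurable lborel"
  shows "(\<integral>x. f (x + h) \<partial>lborel) = (\<integral>x. f x \<partial>lborel)"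
  using lborel_integral_affine[of 1 f h] assms by (simp add: add.commute)

lemma lborel_integrable_translate:
  fixes f :: "'a::euclidean_space \<Rightarrow> 'b::{banach, second_countable_topology}"
  assumes "integrable lborel f"
  shows "integrable lborel (\<lambda>x. f (x + h))"
  using lborel_integrable_affine[of 1 f h] assms by (simp add: add.commute)

text \<open>Openness gives pointwise convergence at the points of \<open>U\<close> but says nothing
  about its boundary. So dominated convergence is applied only to the loss \<open>D\<close>, which
  lives on \<open>U\<close>; translation invariance makes the gain equal to the loss, whence the
  factor 2.\<close>

lemma translation_L1_tendsto_open:
  fixes U :: "'a::euclidean_space set"
  assumes U: "open U" "emeasure lborel U < \<infinity>" and h: "h \<longlonglongrightarrow> 0"
  shows "(\<lambda>k. \<integral>x. \<bar>indicat_real U (x + h k) - indicat_real U x\<bar> \<partial>lborel) \<longlonglongrightarrow> 0"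
proof -
  have [measurable]: "U \<in> sets borel" using U by auto
  have iU: "integrable lborel (indicat_real U)" using U by simp
  note iUh = lborel_integrable_translate[OF iU]
  define D where "D k x = max 0 (indicat_real U x - indicat_real U (x + h k))" for k x
  have "(\<lambda>k. \<integral>x. D k x \<partial>lborel) \<longlonglongrightarrow> (\<integral>x. (0::real) \<partial>(lborel :: 'a measure))"
  proof (rule integral_dominated_convergence[where w="indicat_real U"])
    show "AE x in lborel. (\<lambda>k. D k x) \<longlonglongrightarrow> 0"
    proof (rule AE_I2)
      fix x
      show "(\<lambda>k. D k x) \<longlonglongrightarrow> 0"
      proof (cases "x \<in> U")
        case True
        have "(\<lambda>k. x + h k) \<longlonglongrightarrow> x + 0" by (intro tendsto_intros h)
        then have "\<forall>\<^sub>F k in sequentially. x + h k \<in> U"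
          using topological_tendstoD[OF _ U(1)] True by force
        then have "\<forall>\<^sub>F k in sequentially. D k x = 0"
          by eventually_elim (auto simp: D_def True)
        then show ?thesis by (simp add: tendsto_eventually)
      qed (auto simp: D_def)
    qed
    show "AE x in lborel. norm (D k x) \<le> indicat_real U x" for k
      by (rule AE_I2) (auto simp: D_def indicator_def)
  qed (use iU in \<open>auto simp: D_def\<close>)
  moreover have "(\<integral>x. \<bar>indicat_real U (x + h k) - indicat_real U x\<bar> \<partial>lborel) = 2 * (\<integral>x. D k x \<partial>lborel)" for k
  proof -
    have "(\<integral>x. \<bar>indicat_real U (x + h k) - indicat_real U x\<bar> \<partial>lborel)
        = (\<integral>x. 2 * D k x + indicat_real U (x + h k) - indicat_real U x \<partial>lborel)"
      by (rule Bochner_Integration.integral_cong) (auto simp: D_def max_def abs_if)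
    also have "\<dots> = 2 * (\<integral>x. D k x \<partial>lborel) + (\<integral>x. indicat_real U (x + h k) \<partial>lborel) - (\<integral>x. indicat_real U x \<partial>lborel)"
      using iU iUh by (simp add: D_def)
    finally show ?thesis by (subst (asm) lborel_integral_translate) auto
  qed
  ultimately show ?thesis using tendsto_mult_left[of _ 0 _ 2] by force
qed

text \<open>Induction over integrable functions. Outer regularity reduces indicators of Borel sets
  to open sets, and the passage to limits is a three-term estimate in which the translated error
  equals the untranslated one by invariance.\<close>

lemma translation_L1_tendsto:
  fixes f :: "'a::euclidean_space \<Rightarrow> 'b::{banach, second_countable_topology}"
  assumes "integrable lborel f" "h \<longlonglongrightarrow> 0"
  shows "(\<lambda>k. \<integral>x. norm (f (x + h k) - f x) \<partial>lborel) \<longlonglongrightarrow> 0"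
  using assms(1)
proof (induction rule: integrable_induct)
  case (base A c)
  have A[measurable]: "A \<in> sets borel" using base by simp
  have iA: "integrable lborel (indicat_real A)" using base by simp
  have "(\<lambda>k. \<integral>x. \<bar>indicat_real A (x + h k) - indicat_real A x\<bar> \<partial>lborel) \<longlonglongrightarrow> 0"
  proof (rule LIMSEQ_I)
    fix e :: real assume "e > 0"
    \<comment> \<open>The excess \<open>U - A\<close> is paid for twice, at \<open>x + h k\<close>
      and at \<open>x\<close>, hence e/4; the translation of \<open>U\<close> itself receives
      e/2.\<close>
    then obtain U where U: "open U" "A \<subseteq> U" "emeasure lborel (U - A) < ennreal (e/4)"
      using outer_regular_lborel[OF A, of "e/4"] by auto
    have [measurable]: "U \<in> sets borel" using U by auto
    have "emeasure lborel U \<le> emeasure lborel A + emeasure lborel (U - A)"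
      using U(2) by (subst emeasure_Un_Int) (auto simp: Un_absorb1)
    also have "\<dots> < \<infinity>"
      using U(3) base(2) by (metis ennreal_add_less_top ennreal_less_top infinity_ennreal_def order_less_trans)
    finally have fU: "emeasure lborel U < \<infinity>" .
    have iU: "integrable lborel (indicat_real U)" using fU by simp
    have iD: "integrable lborel (indicat_real (U - A))"
      by (intro integrable_real_indicator order_less_trans[OF U(3)]) auto
    have mD: "(\<integral>x. indicat_real (U - A) x \<partial>lborel) < e/4"
    proof -
      have "ennreal (measure lborel (U - A)) < ennreal (e/4)"
        using U(3) by (subst emeasure_eq_ennreal_measure[symmetric]) auto
      then show ?thesis using \<open>e > 0\<close> by (simp add: ennreal_less_iff)
    qed
    from LIMSEQ_D[OF translation_L1_tendsto_open[OF U(1) fU assms(2)], of "e/2"] \<open>e > 0\<close>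
    obtain N where N: "\<And>k. k \<ge> N \<Longrightarrow> norm ((\<integral>x. \<bar>indicat_real U (x + h k) - indicat_real U x\<bar> \<partial>lborel) - 0) < e/2"
      by auto
    show "\<exists>N. \<forall>k\<ge>N. norm ((\<integral>x. \<bar>indicat_real A (x + h k) - indicat_real A x\<bar> \<partial>lborel) - 0) < e"
    proof (intro exI allI impI)
      fix k assume "k \<ge> N"
      have "(\<integral>x. \<bar>indicat_real A (x + h k) - indicat_real A x\<bar> \<partial>lborel)
        \<le> (\<integral>x. indicat_real (U - A) (x + h k) + \<bar>indicat_real U (x + h k) - indicat_real U x\<bar> + indicat_real (U - A) x \<partial>lborel)"
        using U(2)
        by (intro integral_mono Bochner_Integration.integrable_add integrable_abs Bochner_Integration.integrable_diff
             iA iU iD lborel_integrable_translate[OF iA] lborel_integrable_translate[OF iU] lborel_integrable_translate[OF iD])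
           (auto simp: indicator_def split: if_splits)
      also have "\<dots> = (\<integral>x. indicat_real (U - A) (x + h k) \<partial>lborel)
          + (\<integral>x. \<bar>indicat_real U (x + h k) - indicat_real U x\<bar> \<partial>lborel) + (\<integral>x. indicat_real (U - A) x \<partial>lborel)"
        using iU iD lborel_integrable_translate[OF iU] lborel_integrable_translate[OF iD] by simp
      also have "(\<integral>x. indicat_real (U - A) (x + h k) \<partial>lborel) = (\<integral>x. indicat_real (U - A) x \<partial>lborel)"
        by (rule lborel_integral_translate) simp
      finally show "norm ((\<integral>x. \<bar>indicat_real A (x + h k) - indicat_real A x\<bar> \<partial>lborel) - 0) < e"
        using mD N[OF \<open>k \<ge> N\<close>] by simp
    qed
  qed
  then have "(\<lambda>k. (\<integral>x. \<bar>indicat_real A (x + h k) - indicat_real A x\<bar> \<partial>lborel) * norm c) \<longlonglongrightarrow> 0 * norm c"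
    by (rule tendsto_mult_right)
  then show ?case by (simp flip: scaleR_left_diff_distrib)
next
  case (add f g)
  note t = lborel_integrable_translate[OF add.hyps(1)] lborel_integrable_translate[OF add.hyps(2)]
  show ?case
  proof (rule tendsto_sandwich[OF _ _ tendsto_const])
    show "(\<lambda>k. (\<integral>x. norm (f (x + h k) - f x) \<partial>lborel) + (\<integral>x. norm (g (x + h k) - g x) \<partial>lborel)) \<longlonglongrightarrow> 0"
      using tendsto_add[OF add.IH] by simp
    show "\<forall>\<^sub>F k in sequentially. (\<integral>x. norm (f (x + h k) + g (x + h k) - (f x + g x)) \<partial>lborel)
       \<le> (\<integral>x. norm (f (x + h k) - f x) \<partial>lborel) + (\<integral>x. norm (g (x + h k) - g x) \<partial>lborel)"
    proof (intro always_eventually allI)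
      fix k
      have "(\<integral>x. norm (f (x + h k) + g (x + h k) - (f x + g x)) \<partial>lborel)
        \<le> (\<integral>x. norm (f (x + h k) - f x) + norm (g (x + h k) - g x) \<partial>lborel)"
        using t add by (intro integral_mono) (auto simp: add_diff_add norm_triangle_ineq)
      also have "\<dots> = (\<integral>x. norm (f (x + h k) - f x) \<partial>lborel) + (\<integral>x. norm (g (x + h k) - g x) \<partial>lborel)"
        using t add by (intro Bochner_Integration.integral_add) auto
      finally show "(\<integral>x. norm (f (x + h k) + g (x + h k) - (f x + g x)) \<partial>lborel)
        \<le> (\<integral>x. norm (f (x + h k) - f x) \<partial>lborel) + (\<integral>x. norm (g (x + h k) - g x) \<partial>lborel)" .
    qed
  qed auto
next
  case (lim f s)
  have "(\<lambda>i. \<integral>x. norm (s i x - f x) \<partial>lborel) \<longlonglongrightarrow> (\<integral>x. 0 \<partial>(lborel :: 'a measure))"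
  \<comment> \<open>The approximants of this induction satisfy
    \<open>norm (s i x) \<le> 2 * norm (f x)\<close>; the triangle inequality adds one more.\<close>
  proof (rule integral_dominated_convergence[where w="\<lambda>x. 3 * norm (f x)"])
    show "AE x in lborel. (\<lambda>i. norm (s i x - f x)) \<longlonglongrightarrow> 0"
      using lim.hyps(2) by (auto intro!: AE_I2 tendsto_norm_zero simp: LIM_zero_iff)
    show "AE x in lborel. norm (norm (s i x - f x)) \<le> 3 * norm (f x)" for i
    proof (rule AE_I2)
      fix x
      show "norm (norm (s i x - f x)) \<le> 3 * norm (f x)"
        using lim.hyps(3)[of x i] norm_triangle_ineq4[of "s i x" "f x"] by simp
    qed
    show "(\<lambda>x. norm (s i x - f x)) \<in> borel_measurable lborel" for i
      using lim.hyps(1)[of i] lim.hyps(4) by (auto dest!: borel_measurable_integrable)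
  qed (use lim in auto)
  then have l: "(\<lambda>i. \<integral>x. norm (s i x - f x) \<partial>lborel) \<longlonglongrightarrow> 0" by simp
  show ?case
  proof (rule LIMSEQ_I)
    fix e :: real assume "e > 0"
    with LIMSEQ_D[OF l, of "e/4"] obtain i where i: "(\<integral>x. norm (s i x - f x) \<partial>lborel) < e/4"
      by fastforce
    from LIMSEQ_D[OF lim.IH[of i], of "e/2"] \<open>e > 0\<close> obtain N where
      N: "\<And>k. k \<ge> N \<Longrightarrow> norm ((\<integral>x. norm (s i (x + h k) - s i x) \<partial>lborel) - 0) < e/2" by auto
    have ii: "integrable lborel (\<lambda>x. norm (s i x - f x))" using lim by auto
    show "\<exists>N. \<forall>k\<ge>N. norm ((\<integral>x. norm (f (x + h k) - f x) \<partial>lborel) - 0) < e"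
    proof (intro exI allI impI)
      fix k assume "k \<ge> N"
      note t = lborel_integrable_translate[OF lim.hyps(1)[of i], of "h k"] lborel_integrable_translate[OF lim.hyps(4), of "h k"]
        lborel_integrable_translate[OF ii, of "h k"]
      have "(\<integral>x. norm (f (x + h k) - f x) \<partial>lborel)
        \<le> (\<integral>x. norm (s i (x + h k) - f (x + h k)) + norm (s i (x + h k) - s i x) + norm (s i x - f x) \<partial>lborel)"
      proof (intro integral_mono)
        show "norm (f (x + h k) - f x) \<le> norm (s i (x + h k) - f (x + h k)) + norm (s i (x + h k) - s i x) + norm (s i x - f x)" for x
          by norm
      qed (use t ii lim in auto)
      also have "\<dots> = (\<integral>x. norm (s i (x + h k) - f (x + h k)) \<partial>lborel)
         + (\<integral>x. norm (s i (x + h k) - s i x) \<partial>lborel) + (\<integral>x. norm (s i x - f x) \<partial>lborel)"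
        using t ii lim by simp
      also have "(\<integral>x. norm (s i (x + h k) - f (x + h k)) \<partial>lborel) = (\<integral>x. norm (s i x - f x) \<partial>lborel)"
        by (rule lborel_integral_translate) (use ii in blast)
      finally show "norm ((\<integral>x. norm (f (x + h k) - f x) \<partial>lborel) - 0) < e"
        using i N[OF \<open>k \<ge> N\<close>] by simp
    qed
  qed
qed

text \<open>Applied to \<open>|f| f\<close>, which is integrable for \<open>f\<close> in \<open>L\<^sup>2\<close>, this transfers the
  continuity of translations from \<open>L\<^sup>1\<close> to \<open>L\<^sup>2\<close>.\<close>

lemma norm_diff_square_le:
  fixes z w :: "'a::real_inner"
  shows "(norm (z - w))\<^sup>2 \<le> 2 * norm (norm z *\<^sub>R z - norm w *\<^sub>R w)"
proof (cases "z = w")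
  case False
  let ?a = "norm z" and ?b = "norm w" and ?d = "norm (z - w)"
  let ?F = "?a *\<^sub>R z - ?b *\<^sub>R w"
  have zw: "z \<bullet> w = (?a\<^sup>2 + ?b\<^sup>2 - ?d\<^sup>2) / 2"
    by (simp add: power2_norm_eq_inner inner_diff inner_commute)
  \<comment> \<open>Pairing \<open>?F\<close> with \<open>z - w\<close> leaves the square of
    \<open>?a - ?b\<close> as a surplus. With \<open>?a + ?b \<ge> ?d\<close> the pairing is at
    least \<open>?d^3 / 2\<close>, and Cauchy-Schwarz allows one factor \<open>?d\<close> to be
    cancelled.\<close>
  have "?F \<bullet> (z - w) = ?a * ?a\<^sup>2 + ?b * ?b\<^sup>2 - (?a + ?b) * (z \<bullet> w)"
    by (simp add: inner_diff power2_norm_eq_inner inner_commute algebra_simps)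
  also have "\<dots> = (?a + ?b) / 2 * ?d\<^sup>2 + (?a + ?b) / 2 * (?a - ?b)\<^sup>2"
    unfolding zw by (simp add: field_simps power2_eq_square)
  also have "\<dots> \<ge> (?a + ?b) / 2 * ?d\<^sup>2" by simp
  also have "(?a + ?b) / 2 * ?d\<^sup>2 \<ge> ?d / 2 * ?d\<^sup>2"
    by (intro mult_right_mono) (auto simp: norm_triangle_ineq4)
  finally have "?d / 2 * ?d\<^sup>2 \<le> ?F \<bullet> (z - w)" .
  also have "\<dots> \<le> norm ?F * ?d" by (rule norm_cauchy_schwarz)
  finally have "?d * ?d\<^sup>2 \<le> ?d * (2 * norm ?F)" by (simp add: algebra_simps)
  then show ?thesis using False by (simp only: mult_le_cancel_left_pos zero_less_norm_iff right_minus_eq not_False_eq_True)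
qed simp

lemma translation_L2_tendsto:
  fixes f :: "'a::euclidean_space \<Rightarrow> complex"
  assumes [measurable]: "f \<in> borel_measurable lborel" and f: "integrable lborel (\<lambda>x. (cmod (f x))\<^sup>2)"
    and h: "h \<longlonglongrightarrow> 0"
  shows "(\<lambda>k. \<integral>x. (cmod (f (x + h k) - f x))\<^sup>2 \<partial>lborel) \<longlonglongrightarrow> 0"
proof (rule tendsto_sandwich[OF _ _ tendsto_const])
  have [measurable]: "f \<in> borel_measurable borel" using assms by simp
  define F where "F x = cmod (f x) *\<^sub>R f x" for x
  have F: "integrable lborel F"
    by (rule Bochner_Integration.integrable_bound[OF f]) (auto simp: F_def[abs_def] norm_mult power2_eq_square)
  show "(\<lambda>k. 2 * (\<integral>x. cmod (F (x + h k) - F x) \<partial>lborel)) \<longlonglongrightarrow> 0"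
    using tendsto_mult_left[OF translation_L1_tendsto[OF F h], of 2] by simp
  show "\<forall>\<^sub>F k in sequentially. (\<integral>x. (cmod (f (x + h k) - f x))\<^sup>2 \<partial>lborel) \<le> 2 * (\<integral>x. cmod (F (x + h k) - F x) \<partial>lborel)"
  proof (intro always_eventually allI)
    fix k
    have i: "integrable lborel (\<lambda>x. 2 * cmod (F (x + h k) - F x))"
      using F lborel_integrable_translate[OF F, of "h k"] by auto
    have b: "(cmod (f (x + h k) - f x))\<^sup>2 \<le> 2 * cmod (F (x + h k) - F x)" for x
      unfolding F_def by (rule norm_diff_square_le)
    have "(\<integral>x. (cmod (f (x + h k) - f x))\<^sup>2 \<partial>lborel) \<le> (\<integral>x. 2 * cmod (F (x + h k) - F x) \<partial>lborel)"
      by (intro integral_mono i b Bochner_Integration.integrable_bound[OF i]) (use b in auto)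
    then show "(\<integral>x. (cmod (f (x + h k) - f x))\<^sup>2 \<partial>lborel) \<le> 2 * (\<integral>x. cmod (F (x + h k) - F x) \<partial>lborel)" by simp
  qed
qed auto

section \<open>Gaussians and their Fourier transforms\<close>

lemma gauss_prod:
  fixes \<xi> :: "'a::euclidean_space"
  shows "(\<Prod>b\<in>Basis. exp (- \<i> * complex_of_real ((x \<bullet> b) * (\<xi> \<bullet> b))) * complex_of_real (exp (- (\<xi> \<bullet> b)\<^sup>2 / 2)))
    = exp (- \<i> * complex_of_real (x \<bullet> \<xi>)) * complex_of_real (exp (- (norm \<xi>)\<^sup>2 / 2))"
proof -
  have "(\<Prod>b\<in>Basis. complex_of_real (exp (- (\<xi> \<bullet> b)\<^sup>2 / 2))) = complex_of_real (exp (\<Sum>b\<in>Basis. - (\<xi> \<bullet> b)\<^sup>2 / 2))"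
    by (simp add: exp_sum)
  also have "(\<Sum>b\<in>Basis. - (\<xi> \<bullet> b)\<^sup>2 / 2) = - (norm \<xi>)\<^sup>2 / 2"
    unfolding power2_norm_eq_inner euclidean_inner[of \<xi> \<xi>]
    by (simp add: sum_negf sum_divide_distrib power2_eq_square)
  finally have 1: "(\<Prod>b\<in>Basis. complex_of_real (exp (- (\<xi> \<bullet> b)\<^sup>2 / 2))) = complex_of_real (exp (- (norm \<xi>)\<^sup>2 / 2))" .
  have "(\<Prod>b\<in>Basis. exp (- \<i> * complex_of_real ((x \<bullet> b) * (\<xi> \<bullet> b)))) = exp (\<Sum>b\<in>Basis. - \<i> * complex_of_real ((x \<bullet> b) * (\<xi> \<bullet> b)))"
    by (simp add: exp_sum)
  also have "(\<Sum>b\<in>Basis. - \<i> * complex_of_real ((x \<bullet> b) * (\<xi> \<bullet> b))) = - \<i> * complex_of_real (x \<bullet> \<xi>)"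
    unfolding euclidean_inner[of x \<xi>] by (simp add: sum_distrib_left sum_negf)
  finally show ?thesis using 1 by (simp only: prod.distrib)
qed

text \<open>This is the characteristic function of the standard normal law, taken at
  \<open>- t\<close> to match the sign of the exponent and multiplied by the normalization
  \<open>sqrt (2 * pi)\<close>.\<close>

lemma gauss_1d:
  "integrable lborel (\<lambda>y::real. exp (- \<i> * complex_of_real (t * y)) * complex_of_real (exp (- y\<^sup>2 / 2)))" (is ?I)
  "(\<integral>y. exp (- \<i> * complex_of_real (t * y)) * complex_of_real (exp (- y\<^sup>2 / 2)) \<partial>lborel)
    = complex_of_real (sqrt (2 * pi) * exp (- t\<^sup>2 / 2))" (is ?E)
proof -
  have n: "exp (- y\<^sup>2 / 2) = sqrt (2 * pi) * std_normal_density y" for y :: real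
    by (simp add: std_normal_density_def)
  have "integrable lborel (\<lambda>y::real. sqrt (2 * pi) * std_normal_density y)"
    using integrable_normal_moment[where \<mu>=0 and \<sigma>=1 and k=0] by simp
  then have g: "integrable lborel (\<lambda>y::real. exp (- y\<^sup>2 / 2))" unfolding n .
  show ?I by (rule Bochner_Integration.integrable_bound[OF g]) (auto simp: norm_mult)
  have "char std_normal_distribution (- t) = complex_of_real (exp (- t\<^sup>2 / 2))"
    by (simp add: char_std_normal_distribution)
  moreover have "char std_normal_distribution (- t)
     = (\<integral>y. std_normal_density y *\<^sub>R exp (\<i> * complex_of_real (- t * y)) \<partial>lborel)"
    unfolding char_def by (subst integral_density) auto
  ultimately have "(\<integral>y. std_normal_density y *\<^sub>R exp (\<i> * complex_of_real (- t * y)) \<partial>lborel) = complex_of_real (exp (- t\<^sup>2 / 2))"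
    by simp
  then have "complex_of_real (sqrt (2 * pi)) * (\<integral>y. std_normal_density y *\<^sub>R exp (\<i> * complex_of_real (- t * y)) \<partial>lborel)
     = complex_of_real (sqrt (2 * pi) * exp (- t\<^sup>2 / 2))" by simp
  then show ?E
    unfolding n by (subst (asm) integral_mult_right_zero[symmetric]) (simp add: scaleR_conv_of_real mult_ac)
qed

text \<open>\<open>lborel\<close> on a Euclidean space is the image of a product of copies of the
  line, and the integrand factors over the coordinates, so the one-dimensional formula multiplies
  up.\<close>

lemma gauss_fourier:
  fixes x :: "'a::euclidean_space"
  shows gauss_fourier_integrable: "integrable lborel (\<lambda>\<xi>. exp (- \<i> * complex_of_real (x \<bullet> \<xi>)) * complex_of_real (exp (- (norm \<xi>)\<^sup>2 / 2)))"
    and gauss_fourier_eq: "(\<integral>\<xi>. exp (- \<i> * complex_of_real (x \<bullet> \<xi>)) * complex_of_real (exp (- (norm \<xi>)\<^sup>2 / 2)) \<partial>lborel)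
      = complex_of_real (sqrt (2 * pi) ^ DIM('a) * exp (- (norm x)\<^sup>2 / 2))"
proof -
  interpret product_sigma_finite "\<lambda>_::'a. lborel :: real measure" ..
  define g where "g b y = exp (- \<i> * complex_of_real ((x \<bullet> b) * y)) * complex_of_real (exp (- y\<^sup>2 / 2))" for b y
  let ?F = "\<lambda>\<xi>::'a. \<Prod>b\<in>Basis. g b (\<xi> \<bullet> b)"
  have F: "exp (- \<i> * complex_of_real (x \<bullet> \<xi>)) * complex_of_real (exp (- (norm \<xi>)\<^sup>2 / 2)) = ?F \<xi>" for \<xi>
    unfolding g_def by (rule gauss_prod[symmetric])
  have [measurable]: "g b \<in> borel_measurable borel" for b unfolding g_def by measurable
  have [measurable]: "(\<lambda>f. \<Sum>b\<in>Basis. f b *\<^sub>R b) \<in> (\<Pi>\<^sub>M b\<in>(Basis::'a set). lborel) \<rightarrow>\<^sub>M borel" by measurable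
  have s: "?F (\<Sum>b\<in>Basis. f b *\<^sub>R b) = (\<Prod>b\<in>Basis. g b (f b))" for f
    by (intro prod.cong) auto
  have i: "integrable lborel (g b)" for b unfolding g_def by (rule gauss_1d)
  show "integrable lborel (\<lambda>\<xi>. exp (- \<i> * complex_of_real (x \<bullet> \<xi>)) * complex_of_real (exp (- (norm \<xi>)\<^sup>2 / 2)))"
    unfolding F by (subst lborel_eq, subst integrable_distr_eq) (auto simp: s intro!: product_integrable_prod i)
  have "(\<integral>\<xi>. ?F \<xi> \<partial>lborel) = (\<Prod>b\<in>Basis. \<integral>y. g b y \<partial>lborel)"
    by (subst lborel_eq, subst integral_distr) (auto simp: s intro!: product_integral_prod i)
  also have "\<dots> = (\<Prod>b\<in>(Basis::'a set). complex_of_real (sqrt (2 * pi) * exp (- (x \<bullet> b)\<^sup>2 / 2)))"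
    unfolding g_def gauss_1d ..
  also have "\<dots> = complex_of_real (sqrt (2 * pi) ^ DIM('a) * exp (\<Sum>b\<in>Basis. - (x \<bullet> b)\<^sup>2 / 2))"
    by (simp add: prod.distrib exp_sum)
  also have "(\<Sum>b\<in>Basis. - (x \<bullet> b)\<^sup>2 / 2) = - (norm x)\<^sup>2 / 2"
    unfolding power2_norm_eq_inner euclidean_inner[of x x]
    by (simp add: sum_negf sum_divide_distrib power2_eq_square)
  finally show "(\<integral>\<xi>. exp (- \<i> * complex_of_real (x \<bullet> \<xi>)) * complex_of_real (exp (- (norm \<xi>)\<^sup>2 / 2)) \<partial>lborel)
      = complex_of_real (sqrt (2 * pi) ^ DIM('a) * exp (- (norm x)\<^sup>2 / 2))" unfolding F .
qed

lemma gauss_integrable: "integrable lborel (\<lambda>\<xi>::'a::euclidean_space. exp (- (norm \<xi>)\<^sup>2 / 2))"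
  using integrable_norm[OF gauss_fourier_integrable[of "0::'a"]] by (simp add: norm_mult)

lemma gauss_integral:
  "(\<integral>\<xi>. exp (- (norm (\<xi>::'a::euclidean_space))\<^sup>2 / 2) \<partial>lborel) = sqrt (2 * pi) ^ DIM('a)"
proof -
  have "complex_of_real (\<integral>\<xi>. exp (- (norm (\<xi>::'a))\<^sup>2 / 2) \<partial>lborel) = complex_of_real (sqrt (2 * pi) ^ DIM('a))"
    using gauss_fourier_eq[of "0::'a"] by (simp del: of_real_power)
  then show ?thesis by (simp only: of_real_eq_iff)
qed

section \<open>The Plancherel theorem\<close>

lemma borel_measurable_cnj [measurable (raw)]:
  "f \<in> borel_measurable M \<Longrightarrow> (\<lambda>x. cnj (f x)) \<in> borel_measurable M"
  by (rule borel_measurable_continuous_on[where f = cnj]) (auto intro: continuous_intros)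

lemma fourier_L1_measurable:
  assumes "f \<in> borel_measurable lborel"
  shows "fourier_L1 f \<in> borel_measurable lborel"
proof -
  have [measurable]: "f \<in> borel_measurable borel" using assms by simp
  have "(\<lambda>\<xi>. \<integral>x. exp (- \<i> * complex_of_real (x \<bullet> \<xi>)) * f x \<partial>lborel) \<in> borel_measurable lborel"
    by (rule lborel.borel_measurable_lebesgue_integral) measurable
  then show ?thesis by (simp add: fourier_L1_def[abs_def])
qed

lemma fourier_L1_integrand:
  assumes "integrable lborel f"
  shows "integrable lborel (\<lambda>x. exp (- \<i> * complex_of_real (x \<bullet> \<xi>)) * f x)"
proof -
  have [measurable]: "f \<in> borel_measurable borel" using assms by auto
  show ?thesis
    by (rule Bochner_Integration.integrable_bound[OF assms]) (auto simp: norm_mult)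
qed

lemma fourier_L1_bound:
  assumes "integrable lborel f"
  shows "cmod (fourier_L1 f \<xi>) \<le> (\<integral>x. cmod (f x) \<partial>lborel)"
proof -
  have "cmod (fourier_L1 f \<xi>) \<le> (\<integral>x. cmod (exp (- \<i> * complex_of_real (x \<bullet> \<xi>)) * f x) \<partial>lborel)"
    unfolding fourier_L1_def by (rule integral_norm_bound)
  then show ?thesis by (simp add: norm_mult)
qed

lemma fourier_L1_add:
  assumes "integrable lborel f" "integrable lborel g"
  shows "fourier_L1 (\<lambda>x. a * f x + b * g x) \<xi> = a * fourier_L1 f \<xi> + b * fourier_L1 g \<xi>"
proof -
  have "fourier_L1 (\<lambda>x. a * f x + b * g x) \<xi> = (\<integral>x. a * (exp (- \<i> * complex_of_real (x \<bullet> \<xi>)) * f x)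
     + b * (exp (- \<i> * complex_of_real (x \<bullet> \<xi>)) * g x) \<partial>lborel)"
    unfolding fourier_L1_def by (simp add: algebra_simps)
  then show ?thesis
    using fourier_L1_integrand[OF assms(1), of \<xi>] fourier_L1_integrand[OF assms(2), of \<xi>]
    by (simp add: fourier_L1_def)
qed

text \<open>Fubini for the kernel \<open>k\<close>. Moving the transform from one factor to the
  other is what replaces an inversion formula in the proof of Plancherel.\<close>

lemma fourier_L1_multiplication:
  fixes f g :: "real ^ 'n::finite \<Rightarrow> complex"
  assumes f: "integrable lborel f" and g: "integrable lborel g"
  shows "(\<integral>\<xi>. fourier_L1 f \<xi> * g \<xi> \<partial>lborel) = (\<integral>x. f x * fourier_L1 g x \<partial>lborel)"
proof -
  have [measurable]: "f \<in> borel_measurable borel" "g \<in> borel_measurable borel" using assms by auto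
  define k where "k \<xi> x = exp (- \<i> * complex_of_real (x \<bullet> \<xi>)) * f x * g \<xi>" for \<xi> x
  have i: "integrable (lborel \<Otimes>\<^sub>M lborel) (case_prod k)"
  proof (rule lborel_pair.Fubini_integrable)
    show "case_prod k \<in> borel_measurable (lborel \<Otimes>\<^sub>M lborel)" unfolding k_def by measurable
    have "integrable lborel (\<lambda>\<xi>. (\<integral>x. cmod (f x) \<partial>lborel) * cmod (g \<xi>))" using g by auto
    then show "integrable lborel (\<lambda>\<xi>. \<integral>x. norm (case (\<xi>, x) of (\<xi>, x) \<Rightarrow> k \<xi> x) \<partial>lborel)"
      by (simp add: k_def norm_mult)
    show "AE \<xi> in lborel. integrable lborel (\<lambda>x. case (\<xi>, x) of (\<xi>, x) \<Rightarrow> k \<xi> x)"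
      using fourier_L1_integrand[OF f] by (simp add: k_def)
  qed
  have "(\<integral>\<xi>. fourier_L1 f \<xi> * g \<xi> \<partial>lborel) = (\<integral>\<xi>. \<integral>x. k \<xi> x \<partial>lborel \<partial>lborel)"
    by (simp add: fourier_L1_def k_def)
  also have "\<dots> = (\<integral>x. \<integral>\<xi>. k \<xi> x \<partial>lborel \<partial>lborel)"
    by (rule lborel_pair.Fubini_integral[OF i, symmetric])
  also have "\<dots> = (\<integral>x. f x * fourier_L1 g x \<partial>lborel)"
  proof (rule Bochner_Integration.integral_cong[OF refl])
    fix x
    have "(\<integral>\<xi>. k \<xi> x \<partial>lborel) = (\<integral>\<xi>. f x * (exp (- \<i> * complex_of_real (\<xi> \<bullet> x)) * g \<xi>) \<partial>lborel)"
      by (simp add: k_def inner_commute mult_ac)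
    then show "(\<integral>\<xi>. k \<xi> x \<partial>lborel) = f x * fourier_L1 g x"
      by (simp add: fourier_L1_def)
  qed
  finally show ?thesis .
qed

lemma scaled_gauss_fourier:
  fixes z :: "real ^ 'n::finite"
  assumes "e > 0"
  shows "integrable lborel (\<lambda>\<xi>::real^'n. exp (- (norm (e *\<^sub>R \<xi>))\<^sup>2 / 2))"
    and "(\<integral>\<xi>. exp (- \<i> * complex_of_real ((e *\<^sub>R z) \<bullet> \<xi>)) * complex_of_real (exp (- (norm (e *\<^sub>R \<xi>))\<^sup>2 / 2)) \<partial>lborel)
      = complex_of_real (sqrt (2 * pi) ^ CARD('n) * exp (- (norm z)\<^sup>2 / 2)) /\<^sub>R e ^ CARD('n)"
proof -
  show "integrable lborel (\<lambda>\<xi>::real^'n. exp (- (norm (e *\<^sub>R \<xi>))\<^sup>2 / 2))"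
    using lborel_integrable_affine[OF _ gauss_integrable, of e 0] assms by simp
  have "(\<integral>\<xi>. exp (- \<i> * complex_of_real (z \<bullet> \<xi>)) * complex_of_real (exp (- (norm \<xi>)\<^sup>2 / 2)) \<partial>lborel)
    = e ^ CARD('n) *\<^sub>R (\<integral>\<xi>. exp (- \<i> * complex_of_real (z \<bullet> (e *\<^sub>R \<xi>))) * complex_of_real (exp (- (norm (e *\<^sub>R \<xi>))\<^sup>2 / 2)) \<partial>lborel)"
    using assms
    by (subst lborel_integral_affine[of e _ 0]) auto
  then show "(\<integral>\<xi>. exp (- \<i> * complex_of_real ((e *\<^sub>R z) \<bullet> \<xi>)) * complex_of_real (exp (- (norm (e *\<^sub>R \<xi>))\<^sup>2 / 2)) \<partial>lborel)
      = complex_of_real (sqrt (2 * pi) ^ CARD('n) * exp (- (norm z)\<^sup>2 / 2)) /\<^sub>R e ^ CARD('n)"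
    unfolding gauss_fourier_eq using assms by simp
qed

lemma L2_cnj_translate:
  assumes "f \<in> L2"
  shows "(\<lambda>x. cnj (f (x - z))) \<in> L2" "L2_norm (\<lambda>x. cnj (f (x - z))) = L2_norm f"
proof -
  have [measurable]: "f \<in> borel_measurable borel" and i: "integrable lborel (\<lambda>x. (cmod (f x))\<^sup>2)"
    using assms by (auto simp: L2_def)
  show "(\<lambda>x. cnj (f (x - z))) \<in> L2"
    using lborel_integrable_translate[OF i, of "-z"] by (simp add: L2_def)
  show "L2_norm (\<lambda>x. cnj (f (x - z))) = L2_norm f"
    using lborel_integral_translate[of "\<lambda>x. (cmod (f x))\<^sup>2" "-z"] by (simp add: L2_norm_def)
qed

text \<open>The transform of an integrable function is bounded but not known in advance to be square
  integrable, so a Gaussian factor is inserted. The regularized square norm then becomes a Gaussian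
  average, at scale \<open>e\<close>, of the autocorrelation of \<open>f\<close>.\<close>

lemma gauss_regularized_fourier_square:
  fixes f :: "real ^ 'n::finite \<Rightarrow> complex"
  assumes f: "integrable lborel f" and f2: "f \<in> L2" and e: "e > 0"
  shows "integrable lborel (\<lambda>\<xi>. (cmod (fourier_L1 f \<xi>))\<^sup>2 * exp (- (norm (e *\<^sub>R \<xi>))\<^sup>2 / 2))"
    and "complex_of_real (\<integral>\<xi>. (cmod (fourier_L1 f \<xi>))\<^sup>2 * exp (- (norm (e *\<^sub>R \<xi>))\<^sup>2 / 2) \<partial>lborel)
      = complex_of_real (sqrt (2 * pi) ^ CARD('n)) *
        (\<integral>h. exp (- (norm h)\<^sup>2 / 2) *\<^sub>R (\<integral>x. f x * cnj (f (x - e *\<^sub>R h)) \<partial>lborel) \<partial>lborel)"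
proof -
  let ?c = "complex_of_real (sqrt (2 * pi) ^ CARD('n))"
  let ?k = "\<lambda>\<xi>::real^'n. exp (- (norm (e *\<^sub>R \<xi>))\<^sup>2 / 2)"
  let ?F = "fourier_L1 f"
  have fm [measurable]: "f \<in> borel_measurable borel" using assms by auto
  have Fm [measurable]: "?F \<in> borel_measurable borel" using fourier_L1_measurable[of f] by simp
  note ki = scaled_gauss_fourier(1)[OF e, where 'n='n]
  have Fb: "cmod (?F \<xi>) \<le> (\<integral>x. cmod (f x) \<partial>lborel)" for \<xi> by (rule fourier_L1_bound[OF f])
  have N0: "(\<integral>x. cmod (f x) \<partial>lborel) \<ge> 0" by simp
  show iF: "integrable lborel (\<lambda>\<xi>. (cmod (fourier_L1 f \<xi>))\<^sup>2 * ?k \<xi>)"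
  proof (rule Bochner_Integration.integrable_bound[OF integrable_mult_right[OF ki, of "(\<integral>x. cmod (f x) \<partial>lborel)\<^sup>2"]])
    show "AE \<xi> in lborel. norm ((cmod (?F \<xi>))\<^sup>2 * ?k \<xi>) \<le> norm ((\<integral>x. cmod (f x) \<partial>lborel)\<^sup>2 * ?k \<xi>)"
      by (intro AE_I2) (simp add: mult_right_mono power_mono Fb)
  qed measurable
  define H where "H \<xi> = cnj (?F \<xi>) * complex_of_real (?k \<xi>)" for \<xi>
  have H: "integrable lborel H"
  proof (rule Bochner_Integration.integrable_bound[OF integrable_mult_right[OF ki, of "\<integral>x. cmod (f x) \<partial>lborel"]])
    show "AE \<xi> in lborel. norm (H \<xi>) \<le> norm ((\<integral>x. cmod (f x) \<partial>lborel) * ?k \<xi>)"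
      using Fb by (intro AE_I2) (simp add: H_def norm_mult mult_right_mono)
  qed (simp add: H_def[abs_def])
  \<comment> \<open>Reflection with conjugation: the transform of \<open>f'\<close> is the conjugate
    of \<open>?F\<close>, so \<open>H\<close> is again a transform times a Gaussian.\<close>
  define f' where "f' y = cnj (f (- y))" for y
  have f': "integrable lborel f'"
    unfolding f'_def using lborel_integrable_affine[OF _ f, of "-1" 0] by simp
  have cF: "cnj (?F \<xi>) = fourier_L1 f' \<xi>" for \<xi>
  proof -
    have "cnj (?F \<xi>) = (\<integral>x. exp (\<i> * complex_of_real (x \<bullet> \<xi>)) * cnj (f x) \<partial>lborel)"
      unfolding fourier_L1_def by (subst Bochner_Integration.integral_cnj[symmetric]) (simp add: exp_cnj)
    also have "\<dots> = fourier_L1 f' \<xi>"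
      unfolding fourier_L1_def f'_def by (subst lborel_integral_affine[of "-1" _ 0]) auto
    finally show ?thesis .
  qed
  have FH: "fourier_L1 H x = ?c * (\<integral>h. cnj (f (x - e *\<^sub>R h)) * complex_of_real (exp (- (norm h)\<^sup>2 / 2)) \<partial>lborel)" for x
  proof -
    \<comment> \<open>The modulation moves the phase of the transform of \<open>H\<close> into the
      Gaussian. The transform of \<open>g\<close> is a narrow Gaussian centred at
      \<open>- x\<close>, which suggests the substitution \<open>y = - x + e *\<^sub>R h\<close>;
      its Jacobian cancels the factor \<open>e ^ CARD('n)\<close>.\<close>
    define g where "g \<xi> = exp (- \<i> * complex_of_real (x \<bullet> \<xi>)) * complex_of_real (?k \<xi>)" for \<xi>
    have g: "integrable lborel g"
      by (rule Bochner_Integration.integrable_bound[OF ki]) (auto simp: g_def[abs_def] norm_mult)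
    have gx: "fourier_L1 g (- x + e *\<^sub>R h) = ?c * complex_of_real (exp (- (norm h)\<^sup>2 / 2)) /\<^sub>R e ^ CARD('n)" for h
    proof -
      have "fourier_L1 g (- x + e *\<^sub>R h) =
        (\<integral>\<xi>. exp (- \<i> * complex_of_real ((e *\<^sub>R h) \<bullet> \<xi>)) * complex_of_real (?k \<xi>) \<partial>lborel)"
        unfolding fourier_L1_def g_def mult.assoc[symmetric] exp_add[symmetric]
        by (simp add: inner_commute algebra_simps)
      then show ?thesis unfolding scaled_gauss_fourier(2)[OF e] by simp
    qed
    have "fourier_L1 H x = (\<integral>\<xi>. fourier_L1 f' \<xi> * g \<xi> \<partial>lborel)"
      unfolding fourier_L1_def[of H] H_def cF g_def by (simp add: mult_ac inner_commute)
    also have "\<dots> = (\<integral>y. f' y * fourier_L1 g y \<partial>lborel)"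
      by (rule fourier_L1_multiplication[OF f' g])
    also have "\<dots> = e ^ CARD('n) *\<^sub>R (\<integral>h. f' (- x + e *\<^sub>R h) * fourier_L1 g (- x + e *\<^sub>R h) \<partial>lborel)"
      using fourier_L1_measurable[of g] g f' e by (subst lborel_integral_affine[of e _ "- x"]) auto
    also have "\<dots> = (\<integral>h. ?c * (cnj (f (x - e *\<^sub>R h)) * complex_of_real (exp (- (norm h)\<^sup>2 / 2))) \<partial>lborel)"
      unfolding integral_scaleR_right[symmetric] gx
      using e by (intro Bochner_Integration.integral_cong) (auto simp: f'_def)
    finally show ?thesis by simp
  qed
  define q where "q h x = exp (- (norm h)\<^sup>2 / 2) *\<^sub>R (f x * cnj (f (x - e *\<^sub>R h)))" for h x
  note f2s = L2_cnj_translate[OF f2]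
  have qn: "norm (q h x) = exp (- (norm h)\<^sup>2 / 2) * (cmod (f x) * cmod (cnj (f (x - e *\<^sub>R h))))" for h x
    by (simp add: q_def norm_mult)
  note fi = L2_product_integrable[OF f2 f2s(1)]
  \<comment> \<open>Joint integrability is where \<open>f \<in> L2\<close> enters: by Cauchy-Schwarz
    every inner integral is at most \<open>(L2_norm f)^2\<close> times the Gaussian in
    \<open>h\<close>.\<close>
  have q: "integrable (lborel \<Otimes>\<^sub>M lborel) (case_prod q)"
  proof (rule lborel_pair.Fubini_integrable)
    show m: "case_prod q \<in> borel_measurable (lborel \<Otimes>\<^sub>M lborel)" unfolding q_def by measurable
    show "AE h in lborel. integrable lborel (\<lambda>x. case (h, x) of (h, x) \<Rightarrow> q h x)"
    proof (rule AE_I2)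
      fix h
      have "integrable lborel (\<lambda>x. norm (q h x))" unfolding qn using fi[of "e *\<^sub>R h"] by auto
      then show "integrable lborel (\<lambda>x. case (h, x) of (h, x) \<Rightarrow> q h x)"
        by (subst (asm) integrable_norm_iff) (auto simp: q_def[abs_def])
    qed
    have b: "(\<integral>x. norm (q h x) \<partial>lborel) \<le> (L2_norm f)\<^sup>2 * exp (- (norm h)\<^sup>2 / 2)" for h
    proof -
      have "(\<integral>x. norm (q h x) \<partial>lborel) = exp (- (norm h)\<^sup>2 / 2) * (\<integral>x. cmod (f x) * cmod (cnj (f (x - e *\<^sub>R h))) \<partial>lborel)"
        unfolding qn by simp
      also have "\<dots> \<le> exp (- (norm h)\<^sup>2 / 2) * (L2_norm f * L2_norm f)"
        using L2_Cauchy_Schwarz[OF f2 f2s(1), of "e *\<^sub>R h"] unfolding f2s(2) by (intro mult_left_mono) auto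
      finally show ?thesis by (simp add: power2_eq_square mult_ac)
    qed
    have "integrable lborel (\<lambda>h. \<integral>x. norm (q h x) \<partial>lborel)"
    proof (rule Bochner_Integration.integrable_bound[OF integrable_mult_right[OF gauss_integrable, of "(L2_norm f)\<^sup>2"]])
      show "(\<lambda>h. \<integral>x. norm (q h x) \<partial>lborel) \<in> borel_measurable lborel"
        using m by (intro lborel.borel_measurable_lebesgue_integral) simp
      show "AE h in lborel. norm (\<integral>x. norm (q h x) \<partial>lborel) \<le> norm ((L2_norm f)\<^sup>2 * exp (- (norm h)\<^sup>2 / 2))"
        using b by (intro AE_I2) simp
    qed
    then show "integrable lborel (\<lambda>h. \<integral>x. norm (case (h, x) of (h, x) \<Rightarrow> q h x) \<partial>lborel)" by simp
  qed
  have "complex_of_real (\<integral>\<xi>. (cmod (?F \<xi>))\<^sup>2 * ?k \<xi> \<partial>lborel) = (\<integral>\<xi>. complex_of_real ((cmod (?F \<xi>))\<^sup>2 * ?k \<xi>) \<partial>lborel)"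
    by (rule integral_of_real[OF iF, symmetric])
  also have "\<dots> = (\<integral>\<xi>. ?F \<xi> * H \<xi> \<partial>lborel)"
    unfolding H_def by (intro Bochner_Integration.integral_cong) (simp_all add: complex_norm_square mult.assoc del: of_real_power)
  also have "\<dots> = (\<integral>x. f x * fourier_L1 H x \<partial>lborel)"
    by (rule fourier_L1_multiplication[OF f H])
  also have "\<dots> = (\<integral>x. ?c * (\<integral>h. q h x \<partial>lborel) \<partial>lborel)"
  proof (intro Bochner_Integration.integral_cong[OF refl])
    fix x
    have "f x * (\<integral>h. cnj (f (x - e *\<^sub>R h)) * complex_of_real (exp (- (norm h)\<^sup>2 / 2)) \<partial>lborel) = (\<integral>h. q h x \<partial>lborel)"
      unfolding integral_mult_right_zero[symmetric] q_def
      by (intro Bochner_Integration.integral_cong) (simp_all add: scaleR_conv_of_real)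
    then show "f x * fourier_L1 H x = ?c * (\<integral>h. q h x \<partial>lborel)" unfolding FH by (simp add: mult_ac)
  qed
  also have "\<dots> = ?c * (\<integral>x. \<integral>h. q h x \<partial>lborel \<partial>lborel)" by simp
  also have "(\<integral>x. \<integral>h. q h x \<partial>lborel \<partial>lborel) = (\<integral>h. \<integral>x. q h x \<partial>lborel \<partial>lborel)"
    by (rule lborel_pair.Fubini_integral[OF q])
  finally show "complex_of_real (\<integral>\<xi>. (cmod (fourier_L1 f \<xi>))\<^sup>2 * ?k \<xi> \<partial>lborel)
      = ?c * (\<integral>h. exp (- (norm h)\<^sup>2 / 2) *\<^sub>R (\<integral>x. f x * cnj (f (x - e *\<^sub>R h)) \<partial>lborel) \<partial>lborel)"
    by (simp add: q_def)
qed

text \<open>Cauchy-Schwarz bounds the change of the autocorrelation by the norm of \<open>f\<close>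
  times the L2 modulus of continuity of translations. The uniform bound serves as the majorant in
  the limit of vanishing regularization.\<close>

lemma autocorrelation_tendsto:
  assumes f2: "f \<in> L2" and h: "h \<longlonglongrightarrow> 0"
  shows "(\<lambda>k. \<integral>x. f x * cnj (f (x - h k)) \<partial>lborel) \<longlonglongrightarrow> complex_of_real ((L2_norm f)\<^sup>2)"
    and "cmod (\<integral>x. f x * cnj (f (x - z)) \<partial>lborel) \<le> (L2_norm f)\<^sup>2"
proof -
  have i: "integrable lborel (\<lambda>x. (cmod (f x))\<^sup>2)" and fm [measurable]: "f \<in> borel_measurable borel"
    using f2 by (auto simp: L2_def)
  note f2s = L2_cnj_translate[OF f2]
  have pi: "integrable lborel (\<lambda>x. f x * g x)" and pb: "cmod (\<integral>x. f x * g x \<partial>lborel) \<le> L2_norm f * L2_norm g"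
    if g: "g \<in> L2" for g
  proof -
    have [measurable]: "g \<in> borel_measurable borel" using g by (auto simp: L2_def)
    show "integrable lborel (\<lambda>x. f x * g x)"
      by (rule Bochner_Integration.integrable_bound[OF L2_product_integrable[OF f2 g]]) (auto simp: norm_mult)
    have "cmod (\<integral>x. f x * g x \<partial>lborel) \<le> (\<integral>x. cmod (f x * g x) \<partial>lborel)" by (rule integral_norm_bound)
    also have "\<dots> \<le> L2_norm f * L2_norm g" using L2_Cauchy_Schwarz[OF f2 g] by (simp add: norm_mult)
    finally show "cmod (\<integral>x. f x * g x \<partial>lborel) \<le> L2_norm f * L2_norm g" .
  qed
  show "cmod (\<integral>x. f x * cnj (f (x - z)) \<partial>lborel) \<le> (L2_norm f)\<^sup>2"
    using pb[OF f2s(1), of z] by (simp add: f2s power2_eq_square)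
  have f0: "(\<lambda>x. cnj (f x)) \<in> L2" using f2s(1)[of 0] by simp
  have "(\<integral>x. f x * cnj (f x) \<partial>lborel) = (\<integral>x. complex_of_real ((cmod (f x))\<^sup>2) \<partial>lborel)"
    by (simp add: complex_norm_square del: of_real_power)
  also have "\<dots> = complex_of_real ((L2_norm f)\<^sup>2)" unfolding L2_norm_sq by (rule integral_of_real[OF i])
  finally have A0: "(\<integral>x. f x * cnj (f x) \<partial>lborel) = complex_of_real ((L2_norm f)\<^sup>2)" .
  have lim: "(\<lambda>k. sqrt (\<integral>x. (cmod (f (x + (- h k)) - f x))\<^sup>2 \<partial>lborel)) \<longlonglongrightarrow> 0"
    using tendsto_real_sqrt[OF translation_L2_tendsto[of f "\<lambda>k. - h k", OF _ i]] tendsto_minus[OF h] fm by simp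
  have "(\<lambda>k. (\<integral>x. f x * cnj (f (x - h k)) \<partial>lborel) - (\<integral>x. f x * cnj (f x) \<partial>lborel)) \<longlonglongrightarrow> 0"
  proof (rule Lim_null_comparison)
    show "(\<lambda>k. L2_norm f * sqrt (\<integral>x. (cmod (f (x + (- h k)) - f x))\<^sup>2 \<partial>lborel)) \<longlonglongrightarrow> 0"
      using tendsto_mult_left[OF lim, of "L2_norm f"] by simp
    show "\<forall>\<^sub>F k in sequentially. norm ((\<integral>x. f x * cnj (f (x - h k)) \<partial>lborel) - (\<integral>x. f x * cnj (f x) \<partial>lborel))
       \<le> L2_norm f * sqrt (\<integral>x. (cmod (f (x + (- h k)) - f x))\<^sup>2 \<partial>lborel)"
    proof (intro always_eventually allI)
      fix k
      have "(\<integral>x. f x * cnj (f (x - h k)) \<partial>lborel) - (\<integral>x. f x * cnj (f x) \<partial>lborel)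
        = (\<integral>x. f x * (cnj (f (x - h k)) - cnj (f x)) \<partial>lborel)"
        using pi[OF f2s(1)[of "h k"]] pi[OF f0] by (simp add: algebra_simps)
      also have "cmod \<dots> \<le> L2_norm f * L2_norm (\<lambda>x. cnj (f (x - h k)) - cnj (f x))"
        by (rule pb[OF L2_diff(1)[OF f2s(1) f0]])
      also have "L2_norm (\<lambda>x. cnj (f (x - h k)) - cnj (f x)) = sqrt (\<integral>x. (cmod (f (x + (- h k)) - f x))\<^sup>2 \<partial>lborel)"
        unfolding L2_norm_def by (simp flip: complex_cnj_diff)
      finally show "norm ((\<integral>x. f x * cnj (f (x - h k)) \<partial>lborel) - (\<integral>x. f x * cnj (f x) \<partial>lborel))
       \<le> L2_norm f * sqrt (\<integral>x. (cmod (f (x + (- h k)) - f x))\<^sup>2 \<partial>lborel)" .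
    qed
  qed
  then show "(\<lambda>k. \<integral>x. f x * cnj (f (x - h k)) \<partial>lborel) \<longlonglongrightarrow> complex_of_real ((L2_norm f)\<^sup>2)"
    unfolding A0 by (simp add: LIM_zero_iff)
qed

text \<open>The regularization is removed along \<open>e k = 1 / (k + 1)\<close>. One factor
  \<open>?c\<close> comes from the transform of the Gaussian, the other from the total mass of the
  Gaussian average.\<close>

theorem Plancherel_L1_L2:
  fixes f :: "real ^ 'n::finite \<Rightarrow> complex"
  assumes f: "integrable lborel f" and f2: "f \<in> L2"
  shows "fourier_L1 f \<in> L2" "L2_norm (fourier_L1 f) = sqrt ((2 * pi) ^ CARD('n)) * L2_norm f"
proof -
  let ?F = "fourier_L1 f" and ?c = "sqrt (2 * pi) ^ CARD('n)"
  have Fm [measurable]: "?F \<in> borel_measurable borel" using fourier_L1_measurable[of f] f by auto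
  define e where "e k = inverse (real (Suc k))" for k
  have e: "e k > 0" for k by (simp add: e_def)
  have e0: "e \<longlonglongrightarrow> 0" unfolding e_def by (rule LIMSEQ_inverse_real_of_nat)
  define g where "g k \<xi> = (cmod (?F \<xi>))\<^sup>2 * exp (- (norm (e k *\<^sub>R \<xi>))\<^sup>2 / 2)" for k \<xi>
  have fm [measurable]: "f \<in> borel_measurable borel" using f by auto
  have "(\<lambda>k. \<integral>h. exp (- (norm h)\<^sup>2 / 2) *\<^sub>R (\<integral>x. f x * cnj (f (x - e k *\<^sub>R h)) \<partial>lborel) \<partial>lborel)
     \<longlonglongrightarrow> (\<integral>h. exp (- (norm (h::real^'n))\<^sup>2 / 2) *\<^sub>R complex_of_real ((L2_norm f)\<^sup>2) \<partial>lborel)"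
  proof (rule integral_dominated_convergence[where w="\<lambda>h. (L2_norm f)\<^sup>2 * exp (- (norm h)\<^sup>2 / 2)"])
    show "integrable lborel (\<lambda>h::real^'n. (L2_norm f)\<^sup>2 * exp (- (norm h)\<^sup>2 / 2))"
      by (intro integrable_mult_right gauss_integrable)
    show "AE h in lborel. (\<lambda>k. exp (- (norm h)\<^sup>2 / 2) *\<^sub>R (\<integral>x. f x * cnj (f (x - e k *\<^sub>R h)) \<partial>lborel))
       \<longlonglongrightarrow> exp (- (norm h)\<^sup>2 / 2) *\<^sub>R complex_of_real ((L2_norm f)\<^sup>2)"
    proof (intro AE_I2 tendsto_scaleR tendsto_const autocorrelation_tendsto[OF f2])
      fix h :: "real^'n"
      show "(\<lambda>k. e k *\<^sub>R h) \<longlonglongrightarrow> 0" using tendsto_scaleR[OF e0 tendsto_const, of h] by simp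
    qed
    show "AE h in lborel. norm (exp (- (norm h)\<^sup>2 / 2) *\<^sub>R (\<integral>x. f x * cnj (f (x - e k *\<^sub>R h)) \<partial>lborel))
        \<le> (L2_norm f)\<^sup>2 * exp (- (norm h)\<^sup>2 / 2)" for k
      using autocorrelation_tendsto(2)[OF f2 LIMSEQ_const_iff[THEN iffD2, OF refl]]
      by (intro AE_I2) (simp add: mult.commute)
    show "(\<lambda>h. exp (- (norm h)\<^sup>2 / 2) *\<^sub>R (\<integral>x. f x * cnj (f (x - e k *\<^sub>R h)) \<partial>lborel)) \<in> borel_measurable lborel" for k
      by measurable
  qed auto
  also have "(\<integral>h. exp (- (norm (h::real^'n))\<^sup>2 / 2) *\<^sub>R complex_of_real ((L2_norm f)\<^sup>2) \<partial>lborel)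
     = complex_of_real (?c * (L2_norm f)\<^sup>2)"
    using gauss_integrable[where 'a="real^'n"] gauss_integral[where 'a="real^'n"]
    by (subst integral_scaleR_left) (auto simp: scaleR_conv_of_real)
  finally have "(\<lambda>k. complex_of_real ?c * (\<integral>h. exp (- (norm h)\<^sup>2 / 2) *\<^sub>R (\<integral>x. f x * cnj (f (x - e k *\<^sub>R h)) \<partial>lborel) \<partial>lborel))
     \<longlonglongrightarrow> complex_of_real ?c * complex_of_real (?c * (L2_norm f)\<^sup>2)" by (rule tendsto_mult_left)
  then have "(\<lambda>k. complex_of_real (\<integral>\<xi>. g k \<xi> \<partial>lborel)) \<longlonglongrightarrow> complex_of_real (?c * (?c * (L2_norm f)\<^sup>2))"
    unfolding g_def gauss_regularized_fourier_square(2)[OF f f2 e] by simp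
  then have lim: "(\<lambda>k. \<integral>\<xi>. g k \<xi> \<partial>lborel) \<longlonglongrightarrow> ?c * (?c * (L2_norm f)\<^sup>2)"
    by (simp only: tendsto_of_real_iff)
  \<comment> \<open>The Gaussian factors increase to 1, so monotone convergence yields square
    integrability of \<open>?F\<close> together with the value of the integral.\<close>
  have "has_bochner_integral lborel (\<lambda>\<xi>. (cmod (?F \<xi>))\<^sup>2) (?c * (?c * (L2_norm f)\<^sup>2))"
  proof (rule has_bochner_integral_monotone_convergence[OF _ _ _ lim])
    show "integrable lborel (g k)" for k
      unfolding g_def by (rule gauss_regularized_fourier_square(1)[OF f f2 e])
    have "decseq e" by (auto simp: decseq_def e_def field_simps)
    then show "AE \<xi> in lborel. mono (\<lambda>k. g k \<xi>)"
      using e by (intro AE_I2) (auto simp: g_def mono_def decseq_def less_imp_le intro!: mult_left_mono power_mono mult_mono)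
    show "AE \<xi> in lborel. (\<lambda>k. g k \<xi>) \<longlonglongrightarrow> (cmod (?F \<xi>))\<^sup>2"
    proof (rule AE_I2)
      fix \<xi>
      have "(\<lambda>k. g k \<xi>) \<longlonglongrightarrow> (cmod (?F \<xi>))\<^sup>2 * exp (- (norm (0 *\<^sub>R \<xi>))\<^sup>2 / 2)"
        unfolding g_def by (intro tendsto_intros e0) auto
      then show "(\<lambda>k. g k \<xi>) \<longlonglongrightarrow> (cmod (?F \<xi>))\<^sup>2" by simp
    qed
  qed simp
  then have *: "integrable lborel (\<lambda>\<xi>. (cmod (?F \<xi>))\<^sup>2)" "(\<integral>\<xi>. (cmod (?F \<xi>))\<^sup>2 \<partial>lborel) = ?c * (?c * (L2_norm f)\<^sup>2)"
    by (auto simp: has_bochner_integral_iff)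
  then show "?F \<in> L2" using Fm by (simp add: L2_def)
  show "L2_norm ?F = sqrt ((2 * pi) ^ CARD('n)) * L2_norm f"
  proof -
    have "L2_norm ?F = sqrt ((?c * L2_norm f)\<^sup>2)"
      unfolding L2_norm_def[of ?F] *(2) by (simp add: power2_eq_square mult_ac)
    then show ?thesis by (simp only: real_sqrt_power real_sqrt_abs) simp
  qed
qed

section \<open>The Fourier transform on \<open>L\<^sup>2\<close>\<close>

lemma has_fourier_L2: "has_fourier f g \<Longrightarrow> f \<in> L2" "has_fourier f g \<Longrightarrow> g \<in> L2"
  by (auto simp: has_fourier_def)

lemma L2_norm_tendsto:
  assumes "\<And>k. \<phi> k \<in> L2" "f \<in> L2" "(\<lambda>k. L2_norm (\<lambda>x. \<phi> k x - f x)) \<longlonglongrightarrow> 0"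
  shows "(\<lambda>k. L2_norm (\<phi> k)) \<longlonglongrightarrow> L2_norm f"
proof -
  have "(\<lambda>k. L2_norm (\<phi> k) - L2_norm f) \<longlonglongrightarrow> 0"
    by (rule Lim_null_comparison[OF _ assms(3)]) (use L2_norm_diff_le[OF assms(1,2)] in auto)
  then show ?thesis by (simp add: LIM_zero_iff)
qed

text \<open>Both sides of the Plancherel identity for the approximants converge, since norms are
  continuous for L2 distance.\<close>

lemma has_fourier_norm:
  fixes f :: "real ^ 'n::finite \<Rightarrow> complex"
  assumes "has_fourier f g"
  shows "L2_norm g = sqrt ((2 * pi) ^ CARD('n)) * L2_norm f"
proof -
  from assms obtain \<phi> :: "nat \<Rightarrow> 'n fn" where p: "f \<in> L2" "g \<in> L2"
    "\<And>k. integrable lborel (\<phi> k)" "\<And>k. \<phi> k \<in> L2" "\<And>k. fourier_L1 (\<phi> k) \<in> L2"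
    "(\<lambda>k. L2_norm (\<lambda>x. \<phi> k x - f x)) \<longlonglongrightarrow> 0"
    "(\<lambda>k. L2_norm (\<lambda>\<xi>. fourier_L1 (\<phi> k) \<xi> - g \<xi>)) \<longlonglongrightarrow> 0"
    by (auto simp: has_fourier_def)
  have 1: "(\<lambda>k. L2_norm (fourier_L1 (\<phi> k))) \<longlonglongrightarrow> L2_norm g"
    by (intro L2_norm_tendsto p)
  have "(\<lambda>k. sqrt ((2 * pi) ^ CARD('n)) * L2_norm (\<phi> k)) \<longlonglongrightarrow> sqrt ((2 * pi) ^ CARD('n)) * L2_norm f"
    by (intro tendsto_mult_left L2_norm_tendsto p)
  then have "(\<lambda>k. L2_norm (fourier_L1 (\<phi> k))) \<longlonglongrightarrow> sqrt ((2 * pi) ^ CARD('n)) * L2_norm f"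
    using Plancherel_L1_L2[OF p(3,4)] by simp
  with 1 show ?thesis by (rule LIMSEQ_unique)
qed

section \<open>Linearity and uniqueness of the transform on L2\<close>

lemma L2_lin:
  assumes "f \<in> L2" "g \<in> L2"
  shows "(\<lambda>x. a * f x + b * g x) \<in> L2"
    and "L2_norm (\<lambda>x. a * f x + b * g x) \<le> cmod a * L2_norm f + cmod b * L2_norm g"
  using L2_add[OF L2_cmult(1)[OF assms(1), of a] L2_cmult(1)[OF assms(2), of b]]
    L2_cmult(2)[OF assms(1), of a] L2_cmult(2)[OF assms(2), of b] by auto

lemma has_fourier_lin:
  fixes f :: "real ^ 'n::finite \<Rightarrow> complex"
  assumes "has_fourier f F" "has_fourier g G"
  shows "has_fourier (\<lambda>x. a * f x + b * g x) (\<lambda>\<xi>. a * F \<xi> + b * G \<xi>)"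
proof -
  from assms obtain \<phi> :: "nat \<Rightarrow> 'n fn" where p: "f \<in> L2" "F \<in> L2"
    "\<And>k. integrable lborel (\<phi> k)" "\<And>k. \<phi> k \<in> L2" "\<And>k. fourier_L1 (\<phi> k) \<in> L2"
    "(\<lambda>k. L2_norm (\<lambda>x. \<phi> k x - f x)) \<longlonglongrightarrow> 0"
    "(\<lambda>k. L2_norm (\<lambda>\<xi>. fourier_L1 (\<phi> k) \<xi> - F \<xi>)) \<longlonglongrightarrow> 0"
    by (auto simp: has_fourier_def)
  from assms obtain \<psi> :: "nat \<Rightarrow> 'n fn" where q: "g \<in> L2" "G \<in> L2"
    "\<And>k. integrable lborel (\<psi> k)" "\<And>k. \<psi> k \<in> L2" "\<And>k. fourier_L1 (\<psi> k) \<in> L2"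
    "(\<lambda>k. L2_norm (\<lambda>x. \<psi> k x - g x)) \<longlonglongrightarrow> 0"
    "(\<lambda>k. L2_norm (\<lambda>\<xi>. fourier_L1 (\<psi> k) \<xi> - G \<xi>)) \<longlonglongrightarrow> 0"
    by (auto simp: has_fourier_def)
  define \<theta> where "\<theta> k x = a * \<phi> k x + b * \<psi> k x" for k x
  have ft: "fourier_L1 (\<theta> k) = (\<lambda>\<xi>. a * fourier_L1 (\<phi> k) \<xi> + b * fourier_L1 (\<psi> k) \<xi>)" for k
    unfolding \<theta>_def by (rule ext, rule fourier_L1_add[OF p(3) q(3)])
  have lim: "(\<lambda>k. L2_norm (\<lambda>x. (a * h k x + b * l k x) - (a * H x + b * L x))) \<longlonglongrightarrow> 0"
    if m: "\<And>k. h k \<in> L2" "\<And>k. l k \<in> L2" "H \<in> L2" "L \<in> L2"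
      "(\<lambda>k. L2_norm (\<lambda>x. h k x - H x)) \<longlonglongrightarrow> 0" "(\<lambda>k. L2_norm (\<lambda>x. l k x - L x)) \<longlonglongrightarrow> 0"
    for h l :: "nat \<Rightarrow> 'n fn" and H L
  proof (rule tendsto_sandwich[OF _ _ tendsto_const])
    show "(\<lambda>k. cmod a * L2_norm (\<lambda>x. h k x - H x) + cmod b * L2_norm (\<lambda>x. l k x - L x)) \<longlonglongrightarrow> 0"
      using tendsto_add[OF tendsto_mult_left[OF m(5), of "cmod a"] tendsto_mult_left[OF m(6), of "cmod b"]] by simp
    show "\<forall>\<^sub>F k in sequentially. L2_norm (\<lambda>x. (a * h k x + b * l k x) - (a * H x + b * L x))
       \<le> cmod a * L2_norm (\<lambda>x. h k x - H x) + cmod b * L2_norm (\<lambda>x. l k x - L x)"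
      using L2_lin(2)[OF L2_diff(1)[OF m(1,3)] L2_diff(1)[OF m(2,4)], where a=a and b=b]
      by (simp add: algebra_simps)
  qed auto
  show ?thesis
    unfolding has_fourier_def
  proof (intro conjI exI[of _ \<theta>] allI)
    show "(\<lambda>k. L2_norm (\<lambda>x. \<theta> k x - (a * f x + b * g x))) \<longlonglongrightarrow> 0"
      unfolding \<theta>_def by (intro lim p q)
    show "(\<lambda>k. L2_norm (\<lambda>\<xi>. fourier_L1 (\<theta> k) \<xi> - (a * F \<xi> + b * G \<xi>))) \<longlonglongrightarrow> 0"
      unfolding ft by (intro lim p q)
    show "fourier_L1 (\<theta> k) \<in> L2" for k unfolding ft by (intro L2_lin p q)
    show "integrable lborel (\<theta> k)" for k unfolding \<theta>_def using p q by auto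
    show "\<theta> k \<in> L2" for k unfolding \<theta>_def by (intro L2_lin p q)
  qed (auto intro!: L2_lin p q)
qed

lemma has_fourier_diff:
  assumes "has_fourier f F" "has_fourier g G"
  shows "has_fourier (\<lambda>x. f x - g x) (\<lambda>\<xi>. F \<xi> - G \<xi>)"
  using has_fourier_lin[OF assms, of 1 "-1"] by simp

text \<open>By linearity the difference is a transform of the zero function, and the norm identity
  makes it vanish.\<close>

lemma has_fourier_unique:
  assumes "has_fourier f F" "has_fourier f G"
  shows "AE \<xi> in lborel. F \<xi> = G \<xi>"
proof -
  have h: "has_fourier (\<lambda>x. 0) (\<lambda>\<xi>. F \<xi> - G \<xi>)" using has_fourier_diff[OF assms] by simp
  have "L2_norm (\<lambda>\<xi>. F \<xi> - G \<xi>) = 0" unfolding has_fourier_norm[OF h] by (simp add: L2_norm_def)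
  from L2_norm_eq_0[OF has_fourier_L2(2)[OF h] this] show ?thesis by simp
qed

lemma L2_cong_AE:
  assumes "f \<in> L2" "g \<in> borel_measurable lborel" "AE x in lborel. f x = g x"
  shows "g \<in> L2"
proof -
  have [measurable]: "f \<in> borel_measurable borel" "g \<in> borel_measurable borel" using assms by (auto simp: L2_def)
  have "integrable lborel (\<lambda>x. (cmod (f x))\<^sup>2) \<longleftrightarrow> integrable lborel (\<lambda>x. (cmod (g x))\<^sup>2)"
    by (rule integrable_cong_AE) (use assms(3) in auto)
  then show ?thesis using assms by (auto simp: L2_def)
qed

text \<open>The approximants see \<open>f\<close> and \<open>F\<close> only through L2 distances.
  This makes it possible to transform the equation and the initial conditions, which hold only
  almost everywhere.\<close>

lemma has_fourier_cong:
  assumes h: "has_fourier f F"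
    and f': "f' \<in> borel_measurable lborel" "AE x in lborel. f x = f' x"
    and F': "F' \<in> borel_measurable lborel" "AE x in lborel. F x = F' x"
  shows "has_fourier f' F'"
proof -
  from h obtain \<phi> :: "nat \<Rightarrow> 'a fn" where p: "f \<in> L2" "F \<in> L2"
    "\<And>k. integrable lborel (\<phi> k)" "\<And>k. \<phi> k \<in> L2" "\<And>k. fourier_L1 (\<phi> k) \<in> L2"
    "(\<lambda>k. L2_norm (\<lambda>x. \<phi> k x - f x)) \<longlonglongrightarrow> 0"
    "(\<lambda>k. L2_norm (\<lambda>\<xi>. fourier_L1 (\<phi> k) \<xi> - F \<xi>)) \<longlonglongrightarrow> 0"
    by (auto simp: has_fourier_def)
  have f2: "f' \<in> L2" "F' \<in> L2" using L2_cong_AE p f' F' by blast+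
  have "L2_norm (\<lambda>x. \<phi> k x - f x) = L2_norm (\<lambda>x. \<phi> k x - f' x)" for k
    by (rule L2_norm_cong_AE) (use p(1) p(4)[of k] f' in \<open>auto simp: L2_def\<close>)
  moreover have "L2_norm (\<lambda>x. fourier_L1 (\<phi> k) x - F x) = L2_norm (\<lambda>x. fourier_L1 (\<phi> k) x - F' x)" for k
    by (rule L2_norm_cong_AE) (use p(2) p(5)[of k] F' in \<open>auto simp: L2_def\<close>)
  ultimately show ?thesis unfolding has_fourier_def using p f2 by (intro conjI exI[of _ \<phi>]) auto
qed

lemma has_fourier_fourier_L1:
  assumes "integrable lborel f" "f \<in> L2"
  shows "has_fourier f (fourier_L1 f)"
  unfolding has_fourier_def using assms Plancherel_L1_L2[OF assms]
  by (intro conjI exI[of _ "\<lambda>_. f"]) (auto simp: L2_norm_def)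

lemma has_fourier_fourier: "has_fourier f F \<Longrightarrow> has_fourier f (fourier f)"
  unfolding fourier_def using someI[of "has_fourier f" F] by simp

section \<open>The logarithmic symbol and the spaces Y\<close>

lemma log_symbol_nonneg [simp]: "log_symbol \<xi> \<ge> 0"
  by (simp add: log_symbol_def)

lemma log_symbol_measurable [measurable]: "log_symbol \<in> borel_measurable borel"
  unfolding log_symbol_def[abs_def] by measurable

text \<open>Membership in \<open>Y\<close> provides one transform with a finite weighted integral;
  uniqueness carries this over to any other, in particular to \<open>fourier f\<close> and to
  \<open>fourier_L1 f\<close>.\<close>

lemma Y_weighted_integrable:
  assumes "f \<in> Y \<delta>" "has_fourier f g"
  shows "integrable lborel (\<lambda>\<xi>. (1 + log_symbol \<xi>) powr \<delta> * (cmod (g \<xi>))\<^sup>2)"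
proof -
  from assms(1) obtain h where h: "has_fourier f h"
    and i: "integrable lborel (\<lambda>\<xi>. (1 + log_symbol \<xi>) powr \<delta> * (cmod (h \<xi>))\<^sup>2)"
    by (auto simp: Y_def)
  have [measurable]: "g \<in> borel_measurable borel" "h \<in> borel_measurable borel"
    using has_fourier_L2(2)[OF h] has_fourier_L2(2)[OF assms(2)] by (auto simp: L2_def)
  have "AE \<xi> in lborel. h \<xi> = g \<xi>" by (rule has_fourier_unique[OF h assms(2)])
  then have "integrable lborel (\<lambda>\<xi>. (1 + log_symbol \<xi>) powr \<delta> * (cmod (h \<xi>))\<^sup>2) \<longleftrightarrow>
    integrable lborel (\<lambda>\<xi>. (1 + log_symbol \<xi>) powr \<delta> * (cmod (g \<xi>))\<^sup>2)"
    by (intro integrable_cong_AE) auto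
  with i show ?thesis by simp
qed

lemma Y_has_fourier: "f \<in> Y \<delta> \<Longrightarrow> has_fourier f (fourier f)"
  by (auto simp: Y_def intro: has_fourier_fourier)

lemma Y_mono:
  assumes "f \<in> Y \<delta>" "\<delta>' \<le> \<delta>"
  shows "f \<in> Y \<delta>'"
proof -
  note h = Y_has_fourier[OF assms(1)]
  have [measurable]: "fourier f \<in> borel_measurable borel"
    using has_fourier_L2(2)[OF h] by (auto simp: L2_def)
  have "integrable lborel (\<lambda>\<xi>. (1 + log_symbol \<xi>) powr \<delta>' * (cmod (fourier f \<xi>))\<^sup>2)"
    by (rule Bochner_Integration.integrable_bound[OF Y_weighted_integrable[OF assms(1) h]])
       (auto intro!: mult_right_mono powr_mono assms)
  then show ?thesis using h has_fourier_L2(1)[OF h] by (auto simp: Y_def)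
qed

lemma Y_lin:
  fixes f :: "real ^ 'n::finite \<Rightarrow> complex"
  assumes "f \<in> Y \<delta>" "g \<in> Y \<delta>"
  shows "(\<lambda>x. a * f x + b * g x) \<in> Y \<delta>"
proof -
  note h = Y_has_fourier[OF assms(1)] Y_has_fourier[OF assms(2)]
  note l = has_fourier_lin[OF h, of a b]
  let ?w = "\<lambda>\<xi>::real^'n. (1 + log_symbol \<xi>) powr \<delta>"
  have [measurable]: "fourier f \<in> borel_measurable borel" "fourier g \<in> borel_measurable borel"
    using has_fourier_L2(2)[OF h(1)] has_fourier_L2(2)[OF h(2)] by (auto simp: L2_def)
  have i: "integrable lborel (\<lambda>\<xi>. 2 * (cmod a)\<^sup>2 * (?w \<xi> * (cmod (fourier f \<xi>))\<^sup>2)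
      + 2 * (cmod b)\<^sup>2 * (?w \<xi> * (cmod (fourier g \<xi>))\<^sup>2))"
    using Y_weighted_integrable[OF assms(1) h(1)] Y_weighted_integrable[OF assms(2) h(2)] by auto
  have sq: "(cmod (x + y))\<^sup>2 \<le> 2 * (cmod x)\<^sup>2 + 2 * (cmod y)\<^sup>2" for x y
  proof -
    have "(cmod (x + y))\<^sup>2 \<le> (cmod x + cmod y)\<^sup>2" by (intro power_mono norm_triangle_ineq) auto
    also have "\<dots> \<le> 2 * (cmod x)\<^sup>2 + 2 * (cmod y)\<^sup>2"
      using sum_squares_bound[of "cmod x" "cmod y"] by (simp add: power2_sum)
    finally show ?thesis .
  qed
  have "integrable lborel (\<lambda>\<xi>. ?w \<xi> * (cmod (a * fourier f \<xi> + b * fourier g \<xi>))\<^sup>2)"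
  proof (rule Bochner_Integration.integrable_bound[OF i])
    have "?w \<xi> * (cmod (a * fourier f \<xi> + b * fourier g \<xi>))\<^sup>2
       \<le> ?w \<xi> * (2 * (cmod (a * fourier f \<xi>))\<^sup>2 + 2 * (cmod (b * fourier g \<xi>))\<^sup>2)" for \<xi>
      by (intro mult_left_mono sq) auto
    then have "?w \<xi> * (cmod (a * fourier f \<xi> + b * fourier g \<xi>))\<^sup>2
      \<le> 2 * (cmod a)\<^sup>2 * (?w \<xi> * (cmod (fourier f \<xi>))\<^sup>2) + 2 * (cmod b)\<^sup>2 * (?w \<xi> * (cmod (fourier g \<xi>))\<^sup>2)" for \<xi>
      by (simp add: norm_mult power_mult_distrib algebra_simps)
    then show "AE \<xi> in lborel. norm (?w \<xi> * (cmod (a * fourier f \<xi> + b * fourier g \<xi>))\<^sup>2)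
      \<le> norm (2 * (cmod a)\<^sup>2 * (?w \<xi> * (cmod (fourier f \<xi>))\<^sup>2) + 2 * (cmod b)\<^sup>2 * (?w \<xi> * (cmod (fourier g \<xi>))\<^sup>2))"
      by (intro AE_I2) simp
  qed measurable
  then show ?thesis using l has_fourier_L2(1)[OF l] unfolding Y_def by blast
qed

lemma L2_norm_le_Y_norm:
  fixes f :: "real ^ 'n::finite \<Rightarrow> complex"
  assumes "f \<in> Y \<delta>" "\<delta> \<ge> 0"
  shows "sqrt ((2 * pi) ^ CARD('n)) * L2_norm f \<le> Y_norm \<delta> f"
proof -
  note h = Y_has_fourier[OF assms(1)]
  have "(cmod (fourier f \<xi>))\<^sup>2 \<le> (1 + log_symbol \<xi>) powr \<delta> * (cmod (fourier f \<xi>))\<^sup>2" for \<xi>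
    using mult_right_mono[OF ge_one_powr_ge_zero[of "1 + log_symbol \<xi>" \<delta>], of "(cmod (fourier f \<xi>))\<^sup>2"] assms(2)
    by simp
  then have "L2_norm (fourier f) \<le> Y_norm \<delta> f"
    unfolding L2_norm_def Y_norm_def
    using Y_weighted_integrable[OF assms(1) h] has_fourier_L2(2)[OF h]
    by (intro real_sqrt_le_mono integral_mono) (auto simp: L2_def)
  then show ?thesis unfolding has_fourier_norm[OF h] .
qed

section \<open>Bounded multipliers and their evolutions\<close>

lemma L2_bounded_mult:
  assumes "f \<in> L2" "c \<in> borel_measurable lborel" "\<And>\<xi>. cmod (c \<xi>) \<le> M"
  shows "(\<lambda>\<xi>. c \<xi> * f \<xi>) \<in> L2" "L2_norm (\<lambda>\<xi>. c \<xi> * f \<xi>) \<le> M * L2_norm f"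
proof -
  have M: "M \<ge> 0" using assms(3)[of 0] norm_ge_zero order_trans by blast
  have [measurable]: "f \<in> borel_measurable borel" "c \<in> borel_measurable borel" using assms by (auto simp: L2_def)
  have b: "cmod (c \<xi> * f \<xi>) \<le> cmod (complex_of_real M * f \<xi>)" for \<xi>
    using assms(3)[of \<xi>] M by (simp add: norm_mult mult_right_mono)
  have m: "(\<lambda>\<xi>. c \<xi> * f \<xi>) \<in> borel_measurable lborel" by simp
  show "(\<lambda>\<xi>. c \<xi> * f \<xi>) \<in> L2" by (rule L2_I(1)[OF m L2_cmult(1)[OF assms(1)] b])
  have "L2_norm (\<lambda>\<xi>. c \<xi> * f \<xi>) \<le> L2_norm (\<lambda>\<xi>. complex_of_real M * f \<xi>)"
    by (rule L2_I(2)[OF m L2_cmult(1)[OF assms(1)] b])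
  then show "L2_norm (\<lambda>\<xi>. c \<xi> * f \<xi>) \<le> M * L2_norm f" using L2_cmult(2)[OF assms(1), of "complex_of_real M"] M by simp
qed

text \<open>Since \<open>Z\<close> is differentiable only in L2, the integrating factor is applied
  at the level of functions: \<open>G s\<close> is \<open>e^(-rs) Z s\<close>, and the real function
  \<open>g\<close>, its distance from \<open>G 0\<close>, has derivative zero, hence stays at
  \<open>g 0 = 0\<close>. Boundedness of \<open>r\<close> keeps all exponential multipliers bounded
  on L2.\<close>

lemma multiplier_evolution:
  fixes Z :: "real \<Rightarrow> real ^ 'n::finite \<Rightarrow> complex" and r :: "real ^ 'n \<Rightarrow> complex"
  assumes Z: "\<And>t. t \<ge> 0 \<Longrightarrow> Z t \<in> L2"
    and r: "r \<in> borel_measurable lborel" "\<And>\<xi>. cmod (r \<xi>) \<le> M"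
    and c0: "((\<lambda>s. L2_norm (\<lambda>\<xi>. Z s \<xi> - Z 0 \<xi>)) \<longlongrightarrow> 0) (at 0 within {0..})"
    and d: "\<And>t. t > 0 \<Longrightarrow>
      ((\<lambda>s. L2_norm (\<lambda>\<xi>. (Z s \<xi> - Z t \<xi>) / complex_of_real (s - t) - r \<xi> * Z t \<xi>)) \<longlongrightarrow> 0) (at t within {0..})"
    and t: "t \<ge> 0"
  shows "AE \<xi> in lborel. Z t \<xi> = exp (r \<xi> * complex_of_real t) * Z 0 \<xi>"
proof -
  have M: "M \<ge> 0" using r(2)[of 0] norm_ge_zero order_trans by blast
  have [measurable]: "r \<in> borel_measurable borel" using r by simp
  have rh: "\<bar>Re (r \<xi> * complex_of_real h)\<bar> \<le> M * \<bar>h\<bar>" "cmod (r \<xi> * complex_of_real h) \<le> M * \<bar>h\<bar>" for \<xi> h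
  proof -
    show "cmod (r \<xi> * complex_of_real h) \<le> M * \<bar>h\<bar>" using r(2)[of \<xi>] by (simp add: norm_mult mult_right_mono)
    then show "\<bar>Re (r \<xi> * complex_of_real h)\<bar> \<le> M * \<bar>h\<bar>" using abs_Re_le_cmod order_trans by blast
  qed
  have eb: "cmod (exp (- r \<xi> * complex_of_real s)) \<le> exp (M * \<bar>s\<bar>)" for \<xi> s
    using rh(1)[of \<xi> s] by (simp add: abs_le_iff)
  have T0: "cmod (exp (r \<xi> * complex_of_real h) - 1) \<le> exp (M * \<bar>h\<bar>) * (M * \<bar>h\<bar>)" for \<xi> h
  proof -
    have "cmod (exp (r \<xi> * complex_of_real h) - 1) \<le> exp \<bar>Re (r \<xi> * complex_of_real h)\<bar> * cmod (r \<xi> * complex_of_real h)"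
      using Taylor_exp[of "r \<xi> * complex_of_real h" 0] by simp
    also have "\<dots> \<le> exp (M * \<bar>h\<bar>) * (M * \<bar>h\<bar>)" using rh[of \<xi> h] by (intro mult_mono) auto
    finally show ?thesis .
  qed
  \<comment> \<open>The second-order remainder is needed for differentiability, while
    \<open>T0\<close> suffices for continuity at the endpoint.\<close>
  have T1: "cmod (exp (r \<xi> * complex_of_real h) - 1 - r \<xi> * complex_of_real h) \<le> exp (M * \<bar>h\<bar>) * (M * \<bar>h\<bar>)\<^sup>2" for \<xi> h
  proof -
    have "cmod (exp (r \<xi> * complex_of_real h) - 1 - r \<xi> * complex_of_real h)
      \<le> exp \<bar>Re (r \<xi> * complex_of_real h)\<bar> * (cmod (r \<xi> * complex_of_real h))\<^sup>2"
      using Taylor_exp[of "r \<xi> * complex_of_real h" 1] by (simp add: power2_eq_square diff_diff_eq)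
    also have "\<dots> \<le> exp (M * \<bar>h\<bar>) * (M * \<bar>h\<bar>)\<^sup>2" using rh[of \<xi> h] by (intro mult_mono power_mono) auto
    finally show ?thesis .
  qed
  define G where "G s \<xi> = exp (- r \<xi> * complex_of_real s) * Z s \<xi>" for s \<xi>
  have G: "G s \<in> L2" if "s \<ge> 0" for s
    unfolding G_def by (rule L2_bounded_mult(1)[OF Z[OF that] _ eb]) measurable
  define g where "g s = L2_norm (\<lambda>\<xi>. G s \<xi> - G 0 \<xi>)" for s
  have gd: "\<bar>g s - g p\<bar> \<le> L2_norm (\<lambda>\<xi>. G s \<xi> - G p \<xi>)" if "s \<ge> 0" "p \<ge> 0" for s p
    unfolding g_def using L2_norm_diff_le[OF L2_diff(1)[OF G[OF that(1)] G[of 0]] L2_diff(1)[OF G[OF that(2)] G[of 0]]]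
    by simp
  \<comment> \<open>Writing the factor at the old time through the one at the new time lets a single
    bounded multiplier be pulled out of \<open>G s - G p\<close>.\<close>
  have exp_split: "exp (- r \<xi> * complex_of_real p) = exp (- r \<xi> * complex_of_real s) * exp (r \<xi> * complex_of_real (s - p))" for \<xi> s p
    by (simp add: exp_add[symmetric] algebra_simps)
  \<comment> \<open>The differential equation is assumed at positive times only, so constancy on the
    closed interval requires continuity at 0 separately.\<close>
  have cont0: "(g \<longlongrightarrow> g 0) (at 0 within {0..})"
  proof -
    have "((\<lambda>s. g s - g 0) \<longlongrightarrow> 0) (at 0 within {0..})"
    proof (rule Lim_null_comparison)
      show "((\<lambda>s. exp (M * \<bar>s\<bar>) * (L2_norm (\<lambda>\<xi>. Z s \<xi> - Z 0 \<xi>) + exp (M * \<bar>s\<bar>) * (M * \<bar>s\<bar>) * L2_norm (Z 0))) \<longlongrightarrow> 0) (at 0 within {0..})"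
      proof -
        have "((\<lambda>s. exp (M * \<bar>s\<bar>) * (L2_norm (\<lambda>\<xi>. Z s \<xi> - Z 0 \<xi>) + exp (M * \<bar>s\<bar>) * (M * \<bar>s\<bar>) * L2_norm (Z 0)))
          \<longlongrightarrow> exp (M * \<bar>0\<bar>) * (0 + exp (M * \<bar>0\<bar>) * (M * \<bar>0\<bar>) * L2_norm (Z 0))) (at 0 within {0..})"
          by (intro tendsto_intros c0)
        then show ?thesis by simp
      qed
      show "\<forall>\<^sub>F s in at 0 within {0..}. norm (g s - g 0) \<le> exp (M * \<bar>s\<bar>) * (L2_norm (\<lambda>\<xi>. Z s \<xi> - Z 0 \<xi>) + exp (M * \<bar>s\<bar>) * (M * \<bar>s\<bar>) * L2_norm (Z 0))"
      proof (rule eventually_at_filter[THEN iffD2], intro always_eventually allI impI)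
        fix s :: real assume "s \<in> {0..}"
        then have s: "s \<ge> 0" by simp
        note D = L2_diff(1)[OF Z[OF s] Z[of 0]]
        have m: "(\<lambda>\<xi>. exp (r \<xi> * complex_of_real s) - 1) \<in> borel_measurable lborel"
          "(\<lambda>\<xi>. exp (- r \<xi> * complex_of_real s)) \<in> borel_measurable lborel" by measurable
        note E = L2_bounded_mult[OF Z[of 0] m(1) T0, simplified]
        have "(\<lambda>\<xi>. G s \<xi> - G 0 \<xi>) = (\<lambda>\<xi>. exp (- r \<xi> * complex_of_real s) * ((Z s \<xi> - Z 0 \<xi>) - (exp (r \<xi> * complex_of_real s) - 1) * Z 0 \<xi>))"
          unfolding G_def using exp_split[of _ 0 s] by (auto simp: algebra_simps)
        then have "g s \<le> exp (M * \<bar>s\<bar>) * L2_norm (\<lambda>\<xi>. (Z s \<xi> - Z 0 \<xi>) - (exp (r \<xi> * complex_of_real s) - 1) * Z 0 \<xi>)"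
          unfolding g_def using L2_bounded_mult(2)[OF L2_diff(1)[OF D E(1)] m(2) eb] by simp
        also have "\<dots> \<le> exp (M * \<bar>s\<bar>) * (L2_norm (\<lambda>\<xi>. Z s \<xi> - Z 0 \<xi>) + exp (M * \<bar>s\<bar>) * (M * \<bar>s\<bar>) * L2_norm (Z 0))"
          using E(2) by (intro mult_left_mono order_trans[OF L2_diff(2)[OF D E(1)]]) auto
        finally show "norm (g s - g 0) \<le> exp (M * \<bar>s\<bar>) * (L2_norm (\<lambda>\<xi>. Z s \<xi> - Z 0 \<xi>) + exp (M * \<bar>s\<bar>) * (M * \<bar>s\<bar>) * L2_norm (Z 0))"
          by (simp add: g_def) (simp add: L2_norm_def)
      qed
    qed
    then show ?thesis by (simp add: LIM_zero_iff)
  qed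
  have der: "(g has_real_derivative 0) (at p)" if p: "p > 0" for p
  proof -
    have at: "at p within {0..} = at p"
      using p by (intro at_within_interior) simp
    let ?B = "\<lambda>s. exp (M * \<bar>s\<bar>) * (L2_norm (\<lambda>\<xi>. (Z s \<xi> - Z p \<xi>) / complex_of_real (s - p) - r \<xi> * Z p \<xi>)
        + exp (M * \<bar>s - p\<bar>) * M\<^sup>2 * \<bar>s - p\<bar> * L2_norm (Z p))"
    have "((\<lambda>s. (g s - g p) / (s - p)) \<longlongrightarrow> 0) (at p)"
    proof (rule Lim_null_comparison)
      have "(?B \<longlongrightarrow> exp (M * \<bar>p\<bar>) * (0 + exp (M * \<bar>p - p\<bar>) * M\<^sup>2 * \<bar>p - p\<bar> * L2_norm (Z p))) (at p)"
        by (intro tendsto_intros d[OF p, unfolded at])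
      then show "(?B \<longlongrightarrow> 0) (at p)" by simp
      have "\<forall>\<^sub>F s in at p. s \<in> {0<..}" using p by (intro eventually_at_topological[THEN iffD2] exI[of _ "{0<..}"]) auto
      then show "\<forall>\<^sub>F s in at p. norm ((g s - g p) / (s - p)) \<le> ?B s"
        unfolding eventually_at_filter
      proof eventually_elim
        case (elim s)
        show ?case
        proof (intro impI)
          assume sp: "s \<noteq> p"
          have s: "s \<ge> 0" "s > 0" using elim sp by auto
          let ?h = "s - p"
          have rZ: "(\<lambda>\<xi>. r \<xi> * Z p \<xi>) \<in> L2" by (rule L2_bounded_mult(1)[OF Z r]) (use p in simp)
          have "(\<lambda>\<xi>. (Z s \<xi> - Z p \<xi>) / complex_of_real ?h) \<in> L2"
            using L2_cmult(1)[OF L2_diff(1)[OF Z[OF s(1)] Z[of p]], of "1 / complex_of_real ?h"] p by simp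
          note D = L2_diff(1)[OF this rZ]
          have m: "(\<lambda>\<xi>. exp (r \<xi> * complex_of_real ?h) - 1 - r \<xi> * complex_of_real ?h) \<in> borel_measurable lborel"
            "(\<lambda>\<xi>. exp (- r \<xi> * complex_of_real s)) \<in> borel_measurable lborel" by measurable
          have Zp: "Z p \<in> L2" using Z p by simp
          note E = L2_bounded_mult[OF Zp m(1) T1]
          let ?d = "\<lambda>\<xi>. (Z s \<xi> - Z p \<xi>) / complex_of_real ?h - r \<xi> * Z p \<xi>"
          let ?e = "\<lambda>\<xi>. (exp (r \<xi> * complex_of_real ?h) - 1 - r \<xi> * complex_of_real ?h) * Z p \<xi>"
          note D' = L2_cmult[OF D, of "complex_of_real ?h"]
          \<comment> \<open>The increment of \<open>G\<close> is split into the error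
            \<open>?d\<close> of the difference quotient and the Taylor remainder \<open>?e\<close>;
            after division by \<open>?h\<close> both tend to zero in norm.\<close>
          have eq: "(\<lambda>\<xi>. G s \<xi> - G p \<xi>) = (\<lambda>\<xi>. exp (- r \<xi> * complex_of_real s) * (complex_of_real ?h * ?d \<xi> - ?e \<xi>))"
          proof
            fix \<xi>
            have "complex_of_real ?h * ?d \<xi> = Z s \<xi> - Z p \<xi> - complex_of_real ?h * r \<xi> * Z p \<xi>"
              using sp by (simp add: right_diff_distrib[of "complex_of_real ?h" "_ / _"] mult.assoc del: of_real_diff)
            then have x: "complex_of_real ?h * ?d \<xi> - ?e \<xi> = Z s \<xi> - exp (r \<xi> * complex_of_real ?h) * Z p \<xi>"
              by (simp add: algebra_simps)
            show "G s \<xi> - G p \<xi> = exp (- r \<xi> * complex_of_real s) * (complex_of_real ?h * ?d \<xi> - ?e \<xi>)"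
              unfolding x G_def exp_split[of \<xi> p s] by (simp add: algebra_simps)
          qed
          have ring: "a * (k * x + c * (M * k)\<^sup>2 * y) = a * (x + c * M\<^sup>2 * k * y) * k" for a k x c y :: real
            by algebra
          have "\<bar>g s - g p\<bar> \<le> L2_norm (\<lambda>\<xi>. G s \<xi> - G p \<xi>)" by (rule gd) (use s p in auto)
          also have "\<dots> \<le> exp (M * \<bar>s\<bar>) * L2_norm (\<lambda>\<xi>. complex_of_real ?h * ?d \<xi> - ?e \<xi>)"
            unfolding eq by (rule L2_bounded_mult(2)[OF L2_diff(1)[OF D'(1) E(1)] m(2) eb])
          also have "\<dots> \<le> exp (M * \<bar>s\<bar>) * (\<bar>?h\<bar> * L2_norm ?d + exp (M * \<bar>?h\<bar>) * (M * \<bar>?h\<bar>)\<^sup>2 * L2_norm (Z p))"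
            using E(2) L2_diff(2)[OF D'(1) E(1)] unfolding D'(2) norm_of_real by (intro mult_left_mono) (linarith, simp)
          also have "\<dots> = ?B s * \<bar>?h\<bar>"
            by (rule ring)
          finally show "norm ((g s - g p) / (s - p)) \<le> ?B s"
            using sp by (simp add: divide_le_eq abs_divide)
        qed
      qed
    qed
    then show ?thesis by (simp add: has_field_derivative_iff)
  qed
  have "g t = g 0"
  proof (cases "t = 0")
    case False
    then have t: "t > 0" using t by simp
    have "continuous_on {0..t} g"
    proof (rule continuous_on_eq_continuous_within[THEN iffD2], intro ballI)
      fix x assume "x \<in> {0..t}"
      then consider "x = 0" | "x > 0" by fastforce
      then show "continuous (at x within {0..t}) g"
      proof cases
        case 1
        then show ?thesis
          using tendsto_within_subset[OF cont0, of "{0..t}"] by (auto simp: continuous_within)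
      next
        case 2
        then show ?thesis using der DERIV_isCont continuous_at_imp_continuous_at_within by blast
      qed
    qed
    then show ?thesis using DERIV_isconst2[of 0 t g t] t der by auto
  qed simp
  then have "L2_norm (\<lambda>\<xi>. G t \<xi> - G 0 \<xi>) = 0" by (simp add: g_def L2_norm_def)
  from L2_norm_eq_0[OF L2_diff(1)[OF G[OF t] G] this]
  have "AE \<xi> in lborel. G t \<xi> - G 0 \<xi> = 0" by simp
  then show ?thesis
  proof eventually_elim
    case (elim \<xi>)
    then have "exp (- r \<xi> * complex_of_real t) * Z t \<xi> = Z 0 \<xi>" by (simp add: G_def)
    then have "exp (r \<xi> * complex_of_real t) * Z 0 \<xi> = (exp (r \<xi> * complex_of_real t) * exp (- r \<xi> * complex_of_real t)) * Z t \<xi>"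
      by (simp add: mult.assoc)
    then show ?case by (simp add: exp_add[symmetric])
  qed
qed

section \<open>The damped oscillator\<close>

lemma has_real_derivative_inner:
  assumes "(f has_vector_derivative f') (at s)" "(g has_vector_derivative g') (at s)"
  shows "((\<lambda>s. f s \<bullet> g s) has_real_derivative (f s \<bullet> g' + f' \<bullet> g s)) (at s)"
  unfolding has_field_derivative_def
  by (rule has_derivative_eq_rhs[OF has_derivative_inner[OF assms[unfolded has_vector_derivative_def]]])
     (auto simp: fun_eq_iff algebra_simps)

text \<open>The energy alone loses only \<open>b |y'|^2\<close>, with no control of
  \<open>y\<close>. The small cross term in \<open>En\<close> adds a loss proportional to
  \<open>l |y|^2\<close>. \<open>En\<close> remains between 1/4 and 3/4 of \<open>p + q\<close>,
  which explains the factor 3. The parameter \<open>L\<close> stands for an upper bound of 1/l, so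
  that the rate is uniform over all \<open>l \<ge> 1/L\<close>.\<close>

lemma damped_oscillator_decay:
  fixes y y' :: "real \<Rightarrow> complex" and l b L :: real
  assumes l: "l > 0" and b: "0 < b" "b \<le> 1" and L: "L \<ge> 0" "1 \<le> L * l"
    and y: "\<And>s. (y has_vector_derivative y' s) (at s)"
    and y': "\<And>s. (y' has_vector_derivative (- (l *\<^sub>R y s) - b *\<^sub>R y' s)) (at s)"
    and t: "t \<ge> 0"
  shows "(cmod (y t))\<^sup>2 \<le> 3 * exp (- (b * t / (4 * (1 + L)))) * ((cmod (y 0))\<^sup>2 + (cmod (y' 0))\<^sup>2 / l)"
proof -
  \<comment> \<open>Chosen so that \<open>k * (1 + L) = 1/2\<close>: the cross term then costs at
    most \<open>(p + q) / 4\<close>, and its bad contribution to the derivative is absorbed by the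
    damping of \<open>y'\<close>.\<close>
  define k where "k = 1 / (2 * (1 + L))"
  have k: "k > 0" "k * L + k = 1/2" using L by (auto simp: k_def field_simps)
  define p where "p s = l * (y s \<bullet> y s)" for s
  define q where "q s = y' s \<bullet> y' s" for s
  define m where "m s = y s \<bullet> y' s" for s
  define En where "En s = (q s + p s) / 2 + k * b * m s" for s
  have pq: "p s \<ge> 0" "q s \<ge> 0" for s using l by (auto simp: p_def q_def)
  \<comment> \<open>Young's inequality weighted by \<open>L\<close>; the hypothesis
    \<open>1 \<le> L * l\<close> turns \<open>|y|^2 / L\<close> into at most
    \<open>p\<close>.\<close>
  have m: "\<bar>m s\<bar> \<le> (p s + L * q s) / 2" for s
  proof -
    have Lp: "L > 0" using L by (cases "L = 0") auto
    have "\<bar>m s\<bar> \<le> norm (y s) * norm (y' s)" unfolding m_def by (rule Cauchy_Schwarz_ineq2)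
    also have "2 * (norm (y s) * norm (y' s)) \<le> (norm (y s))\<^sup>2 / L + L * (norm (y' s))\<^sup>2"
    proof -
      have "0 \<le> (norm (y s) - L * norm (y' s))\<^sup>2 / L" using Lp by simp
      then show ?thesis using Lp by (simp add: power2_diff field_simps power2_eq_square)
    qed
    also have "(norm (y s))\<^sup>2 / L \<le> p s"
    proof -
      have "(norm (y s))\<^sup>2 * 1 \<le> (norm (y s))\<^sup>2 * (L * l)" by (intro mult_left_mono L) auto
      then show ?thesis using Lp by (simp add: p_def power2_norm_eq_inner divide_le_eq mult_ac)
    qed
    finally show ?thesis by (simp add: q_def power2_norm_eq_inner)
  qed
  have bm: "\<bar>k * b * m s\<bar> \<le> k * ((p s + L * q s) / 2)" for s
  proof -
    have "\<bar>k * b * m s\<bar> = k * (b * \<bar>m s\<bar>)" using k b by (simp add: abs_mult)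
    also have "\<dots> \<le> k * (1 * ((p s + L * q s) / 2))"
      using k b m[of s] by (intro mult_left_mono mult_mono) auto
    finally show ?thesis by simp
  qed
  have bm': "- (k * b * m s) \<le> (k * p s + k * (L * q s)) / 2" "k * b * m s \<le> (k * p s + k * (L * q s)) / 2" for s
    using bm[of s] by (simp_all add: abs_le_iff distrib_left)
  have kh: "k \<le> 1/2" using k(2) mult_nonneg_nonneg[of k L] k(1) L(1) by linarith
  have kp: "k * p s \<le> p s / 2" for s
    using mult_right_mono[OF kh pq(1)[of s]] by simp
  have kLq: "k * (L * q s) \<le> q s / 2" for s
    using pq[of s] k mult_right_mono[of "k * L" "1/2" "q s"] by (auto simp: mult.assoc)
  have kLk: "k * (L * q s) + k * q s = q s / 2" for s
    using arg_cong[OF k(2), of "\<lambda>x. x * q s"] by (simp add: algebra_simps)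
  have Elow: "(p s + q s) / 4 \<le> En s" for s
    using bm'[of s] kp[of s] kLq[of s] by (simp add: En_def field_simps)
  have Eup: "En s \<le> 3/4 * (p s + q s)" for s
    using bm'[of s] kp[of s] kLq[of s] by (simp add: En_def field_simps)
  have dE: "(En has_real_derivative (- b * q s + k * b * q s - k * b * p s - k * b * (b * m s))) (at s)" for s
  proof -
    have "((\<lambda>s. (y' s \<bullet> y' s + l * (y s \<bullet> y s)) / 2 + k * b * (y s \<bullet> y' s)) has_real_derivative
      ((y' s \<bullet> (- (l *\<^sub>R y s) - b *\<^sub>R y' s) + (- (l *\<^sub>R y s) - b *\<^sub>R y' s) \<bullet> y' s + l * (y s \<bullet> y' s + y' s \<bullet> y s)) / 2
        + k * b * (y s \<bullet> (- (l *\<^sub>R y s) - b *\<^sub>R y' s) + y' s \<bullet> y' s))) (at s)"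
      by (rule DERIV_add DERIV_cdivide DERIV_cmult has_real_derivative_inner y y')+
    moreover have "(y' s \<bullet> (- (l *\<^sub>R y s) - b *\<^sub>R y' s) + (- (l *\<^sub>R y s) - b *\<^sub>R y' s) \<bullet> y' s + l * (y s \<bullet> y' s + y' s \<bullet> y s)) / 2
        + k * b * (y s \<bullet> (- (l *\<^sub>R y s) - b *\<^sub>R y' s) + y' s \<bullet> y' s)
      = - b * q s + k * b * q s - k * b * p s - k * b * (b * m s)"
      by (simp add: q_def p_def m_def inner_diff inner_commute[of "y' s" "y s"] algebra_simps)
    ultimately show ?thesis
      unfolding En_def[abs_def] q_def p_def m_def by simp
  qed
  \<comment> \<open>All terms contain a factor \<open>b\<close>, which is taken out. Half of
    \<open>k * p\<close> pays for the product \<open>b * m\<close>, and by the choice of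
    \<open>k\<close> the terms in \<open>q\<close> with positive sign amount to at most
    \<open>q / 2\<close>.\<close>
  have dis: "- b * q s + k * b * q s - k * b * p s - k * b * (b * m s) \<le> - (k / 2 * b) * En s" for s
  proof -
    have "- (k * (b * m s)) \<le> k * ((p s + L * q s) / 2)"
      using bm[of s] by (simp add: mult.assoc abs_le_iff)
    then have "- q s + k * q s - k * p s - k * (b * m s) \<le> - q s + k * q s - k * p s / 2 + k * (L * q s) / 2"
      by (simp add: algebra_simps)
    also have "\<dots> \<le> - (q s) / 2 - k * p s / 2"
    proof -
      have "0 \<le> k * (L * q s)" using k(1) L(1) pq(2)[of s] by simp
      then show ?thesis using kLk[of s] by (simp add: field_simps)
    qed
    also have "\<dots> \<le> - (k * q s) / 2 - k * p s / 2"
      using mult_right_mono[of k 1 "q s"] pq[of s] kh by simp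
    also have "\<dots> \<le> - (k / 2) * En s"
    proof -
      have "k / 2 * En s \<le> k / 2 * (p s + q s)"
        using Eup[of s] k pq[of s] by (intro mult_left_mono) auto
      then show ?thesis by (simp add: algebra_simps)
    qed
    finally have "b * (- q s + k * q s - k * p s - k * (b * m s)) \<le> b * (- (k / 2) * En s)"
      using b by (intro mult_left_mono) auto
    then show ?thesis by (simp add: algebra_simps)
  qed
  define g where "g s = exp (k / 2 * b * s) * En s" for s
  have "g t \<le> g 0"
  proof (rule DERIV_nonpos_imp_nonincreasing[OF t])
    fix x
    have "(g has_real_derivative (exp (k / 2 * b * x) * (k / 2 * b) * En x
       + (- b * q x + k * b * q x - k * b * p x - k * b * (b * m x)) * exp (k / 2 * b * x))) (at x)"
      unfolding g_def[abs_def] by (rule derivative_eq_intros dE refl)+ (simp add: algebra_simps)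
    moreover have "exp (k / 2 * b * x) * (k / 2 * b) * En x
       + (- b * q x + k * b * q x - k * b * p x - k * b * (b * m x)) * exp (k / 2 * b * x) \<le> 0"
      using mult_left_mono[OF dis[of x], of "exp (k / 2 * b * x)"] by (simp add: algebra_simps)
    ultimately show "\<exists>d. (g has_real_derivative d) (at x) \<and> d \<le> 0" by blast
  qed
  then have "exp (k / 2 * b * t) * En t \<le> En 0" by (simp add: g_def)
  then have "En t \<le> exp (- (k / 2 * b * t)) * En 0"
    by (simp add: exp_minus field_simps)
  also have "\<dots> \<le> exp (- (k / 2 * b * t)) * (3/4 * (p 0 + q 0))"
    by (intro mult_left_mono Eup) auto
  finally have "p t \<le> 3 * exp (- (k / 2 * b * t)) * (p 0 + q 0)"
    using Elow[of t] pq[of t] by (simp add: algebra_simps)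
  then have "l * (cmod (y t))\<^sup>2 \<le> l * (3 * exp (- (k / 2 * b * t)) * ((cmod (y 0))\<^sup>2 + (cmod (y' 0))\<^sup>2 / l))"
    using l by (simp add: p_def q_def power2_norm_eq_inner algebra_simps)
  then have "(cmod (y t))\<^sup>2 \<le> 3 * exp (- (k / 2 * b * t)) * ((cmod (y 0))\<^sup>2 + (cmod (y' 0))\<^sup>2 / l)"
    using l by simp
  also have "k / 2 * b * t = b * t / (4 * (1 + L))" using L by (simp add: k_def field_simps)
  finally show ?thesis .
qed

text \<open>The explicit combination of exponentials solves the oscillator with data
  \<open>c0\<close> and \<open>c1\<close>. Checking this uses only the sum and the product of the
  roots, so the overdamped and the oscillating regimes are one case.\<close>

lemma two_roots_solution_bound:
  fixes r1 r2 c0 c1 :: complex and l b L t :: real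
  assumes "l > 0" "0 < b" "b \<le> 1" "L \<ge> 0" "1 \<le> L * l" "t \<ge> 0"
    and r: "r1 \<noteq> r2" "r1 + r2 = - complex_of_real b" "r1 * r2 = complex_of_real l"
  shows "(cmod ((exp (r1 * complex_of_real t) * (c1 + (complex_of_real b + r1) * c0)
      - exp (r2 * complex_of_real t) * (c1 + (complex_of_real b + r2) * c0)) / (r1 - r2)))\<^sup>2
    \<le> 3 * exp (- (b * t / (4 * (1 + L)))) * ((cmod c0)\<^sup>2 + (cmod c1)\<^sup>2 / l)"
proof -
  define z1 where "z1 = c1 + (complex_of_real b + r1) * c0"
  define z2 where "z2 = c1 + (complex_of_real b + r2) * c0"
  define y where "y s = (exp (r1 * complex_of_real s) * z1 - exp (r2 * complex_of_real s) * z2) / (r1 - r2)" for s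
  define y' where "y' s = (r1 * exp (r1 * complex_of_real s) * z1 - r2 * exp (r2 * complex_of_real s) * z2) / (r1 - r2)" for s
  have d: "((\<lambda>s. exp (r * complex_of_real s)) has_vector_derivative r * exp (r * complex_of_real s)) (at s)" for r s
  proof -
    have "((\<lambda>z. exp (r * z)) has_field_derivative (exp (r * complex_of_real s) * r)) (at (complex_of_real s))"
      by (auto intro!: derivative_eq_intros)
    from has_vector_derivative_real_field[OF this] show ?thesis by (simp add: mult.commute)
  qed
  have dy: "(y has_vector_derivative y' s) (at s)" for s
    unfolding y_def[abs_def] y'_def
    by (rule has_vector_derivative_divide has_vector_derivative_diff has_vector_derivative_mult_left d)+
  have b: "complex_of_real b = - (r1 + r2)" using r by simp
  have dy': "(y' has_vector_derivative (- (l *\<^sub>R y s) - b *\<^sub>R y' s)) (at s)" for s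
  proof -
    have "(y' has_vector_derivative ((r1 * (r1 * exp (r1 * complex_of_real s)) * z1 - r2 * (r2 * exp (r2 * complex_of_real s)) * z2) / (r1 - r2))) (at s)"
      unfolding y'_def[abs_def]
      by (rule has_vector_derivative_divide has_vector_derivative_diff has_vector_derivative_mult_left has_vector_derivative_mult_right d)+
    moreover have "(r1 * (r1 * exp (r1 * complex_of_real s)) * z1 - r2 * (r2 * exp (r2 * complex_of_real s)) * z2) / (r1 - r2)
       = - (l *\<^sub>R y s) - b *\<^sub>R y' s"
      unfolding scaleR_conv_of_real b r(3)[symmetric] y_def y'_def
      by (simp add: divide_inverse algebra_simps)
    ultimately show ?thesis by simp
  qed
  have y0: "y 0 = c0" "y' 0 = c1"
    using r(1) unfolding y_def y'_def z1_def z2_def b by (simp_all add: divide_simps algebra_simps)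
  show ?thesis
    using damped_oscillator_decay[OF assms(1-5) dy dy' assms(6)] unfolding y0 unfolding y_def z1_def z2_def .
qed

text \<open>The roots of the characteristic polynomial are \<open>(w - b) / 2\<close>, the slow one,
  and \<open>- (w + b) / 2\<close>, the fast one. The last bound splits
  \<open>1 - (w + b) / 2\<close> as \<open>(1 - b) - (w - b) / 2\<close>, of sizes at most
  \<open>l\<close> and \<open>2 * l\<close>.\<close>

lemma small_symbol_roots:
  fixes l b w :: real
  assumes l: "0 \<le> l" "l \<le> 1/16" and b: "b = 1 / (1 + l)" and w: "w = sqrt (b\<^sup>2 - 4 * l)"
  shows "b\<^sup>2 - 4 * l > 0" "1/2 \<le> w" "w \<le> 1" "- 2 * l \<le> (w - b) / 2" "(w - b) / 2 \<le> - l" "1/2 \<le> (w + b) / 2" "(w + b) / 2 \<le> 1"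
    "\<bar>1 - (w + b) / 2\<bar> \<le> 3 * l"
proof -
  have b1: "b \<le> 1" "16/17 \<le> b" using l by (auto simp: b field_simps)
  have "(16/17)\<^sup>2 \<le> b\<^sup>2" using b1 by (intro power_mono) auto
  then have d: "1/4 \<le> b\<^sup>2 - 4 * l" using l by (simp add: power2_eq_square)
  then show "b\<^sup>2 - 4 * l > 0" by simp
  have "sqrt ((1/2)\<^sup>2) \<le> w" unfolding w using d by (intro real_sqrt_le_mono) (simp add: power2_eq_square)
  then show w1: "1/2 \<le> w" by simp
  have "b\<^sup>2 \<le> 1" using b1 by (simp add: power_le_one)
  then show w2: "w \<le> 1" unfolding w using l by (simp add: real_le_lsqrt)
  show "1/2 \<le> (w + b) / 2" "(w + b) / 2 \<le> 1" using w1 w2 b1 by auto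
  have "w\<^sup>2 = b\<^sup>2 - 4 * l" unfolding w using d by simp
  \<comment> \<open>The slow root is a difference of nearly equal numbers; the product formula
    rewrites it as \<open>- 2 * l / (w + b)\<close> with \<open>w + b\<close> between 1 and
    2.\<close>
  then have e: "(w - b) * (w + b) = - 4 * l" by (simp add: power2_eq_square algebra_simps)
  then have wb: "w - b = - 4 * l / (w + b)" 
    using w1 b1 nonzero_eq_divide_eq[of "w + b" "w - b" "- 4 * l"] by simp
  show r1: "- 2 * l \<le> (w - b) / 2" unfolding wb using w1 b1 l mult_left_mono[of 1 "w + b" l] by (simp add: field_simps)
  show "(w - b) / 2 \<le> - l" unfolding wb using w1 w2 b1 l mult_left_mono[of "w + b" 2 l] by (simp add: field_simps)
  have "1 - b \<le> l" using l unfolding b by (simp add: field_simps)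
  then show "\<bar>1 - (w + b) / 2\<bar> \<le> 3 * l" using r1 w2 b1 l by (intro abs_leI) (simp_all add: field_simps)
qed

text \<open>The coefficient of the slow mode is \<open>c0 + c1\<close> up to
  \<open>3 * l * cmod c0\<close>, which is how \<open>P u0 + P u1\<close> becomes the leading
  profile; the fast mode is exponentially small. The constant 4 counts two modes and the factor
  \<open>1 / w \<le> 2\<close>.\<close>

lemma low_frequency_bounds:
  fixes c0 c1 :: complex and l b w t :: real
  assumes l: "0 \<le> l" "l \<le> 1/16" and b: "b = 1 / (1 + l)" and w: "w = sqrt (b\<^sup>2 - 4 * l)" and t: "t \<ge> 0"
  defines "y \<equiv> (exp (complex_of_real ((w - b) / 2) * complex_of_real t) * (c1 + (complex_of_real b + complex_of_real ((w - b) / 2)) * c0)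
      - exp (complex_of_real (- (w + b) / 2) * complex_of_real t) * (c1 + (complex_of_real b + complex_of_real (- (w + b) / 2)) * c0)) / complex_of_real w"
  shows "cmod y \<le> 4 * exp (- l * t) * (cmod c0 + cmod c1)"
    and "exp (- 2 * l * t) * (cmod (c0 + c1) - 3 * l * cmod c0) - 2 * exp (- t / 2) * (cmod c0 + cmod c1) \<le> cmod y"
proof -
  note s = small_symbol_roots[OF l b w]
  \<comment> \<open>The coefficients of the slow and the fast mode: adding \<open>b\<close> to one
    root gives minus the other.\<close>
  define a where "a = c1 + complex_of_real ((w + b) / 2) * c0"
  define d where "d = c1 + complex_of_real (- (w - b) / 2) * c0"
  define e1 where "e1 = exp ((w - b) / 2 * t)"
  define e2 where "e2 = exp (- (w + b) / 2 * t)"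
  have y: "y = (complex_of_real e1 * a - complex_of_real e2 * d) / complex_of_real w"
    unfolding y_def a_def d_def e1_def e2_def of_real_mult[symmetric] exp_of_real of_real_add[symmetric]
    by (simp add: field_simps)
  have na: "cmod a \<le> cmod c0 + cmod c1"
  proof -
    have "cmod a \<le> cmod c1 + \<bar>(w + b) / 2\<bar> * cmod c0"
      unfolding a_def by (rule order_trans[OF norm_triangle_ineq]) (simp only: norm_mult norm_of_real)
    then show ?thesis using mult_right_mono[of "\<bar>(w + b) / 2\<bar>" 1 "cmod c0"] s by simp
  qed
  have nd: "cmod d \<le> cmod c0 + cmod c1"
  proof -
    have "cmod d \<le> cmod c1 + \<bar>- (w - b) / 2\<bar> * cmod c0"
      unfolding d_def by (rule order_trans[OF norm_triangle_ineq]) (simp only: norm_mult norm_of_real)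
    then show ?thesis using mult_right_mono[of "\<bar>- (w - b) / 2\<bar>" 1 "cmod c0"] s l by simp
  qed
  have e2h: "e2 \<le> exp (- t / 2)" unfolding e2_def using mult_right_mono[OF s(6) t] by (simp add: algebra_simps)
  have e1u: "e1 \<le> exp (- l * t)" unfolding e1_def using mult_right_mono[OF s(5) t] by simp
  have e1l: "exp (- 2 * l * t) \<le> e1" unfolding e1_def using mult_right_mono[OF s(4) t] by simp
  have e2u: "e2 \<le> exp (- l * t)"
    using e2h mult_right_mono[of l "1/2" t] l t by (simp add: order_trans[OF e2h])
  have e: "e1 > 0" "e2 > 0" by (auto simp: e1_def e2_def)
  have wi: "1 \<le> 1 / w" "1 / w \<le> 2" using s by (auto simp: field_simps)
  have ny: "cmod y = cmod (complex_of_real e1 * a - complex_of_real e2 * d) * (1 / w)"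
    unfolding y using s by (simp add: norm_divide)
  have "cmod (complex_of_real e1 * a - complex_of_real e2 * d) \<le> e1 * cmod a + e2 * cmod d"
    using norm_triangle_ineq4[of "complex_of_real e1 * a" "complex_of_real e2 * d"] e by (simp add: norm_mult)
  also have "\<dots> \<le> exp (- l * t) * (cmod c0 + cmod c1) + exp (- l * t) * (cmod c0 + cmod c1)"
    using e by (intro add_mono mult_mono e1u e2u na nd) auto
  finally have n2: "cmod (complex_of_real e1 * a - complex_of_real e2 * d) \<le> 2 * exp (- l * t) * (cmod c0 + cmod c1)" by (simp add: mult_ac)
  have "cmod y \<le> (2 * exp (- l * t) * (cmod c0 + cmod c1)) * 2"
    unfolding ny using wi s by (intro mult_mono n2) auto
  then show "cmod y \<le> 4 * exp (- l * t) * (cmod c0 + cmod c1)" by simp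
  have "cmod (c0 + c1) - 3 * l * cmod c0 \<le> cmod a"
  proof -
    have "c0 + c1 = a + complex_of_real (1 - (w + b) / 2) * c0" by (simp add: a_def algebra_simps)
    then have "cmod (c0 + c1) \<le> cmod a + \<bar>1 - (w + b) / 2\<bar> * cmod c0"
      by (metis norm_mult norm_of_real norm_triangle_ineq)
    also have "\<bar>1 - (w + b) / 2\<bar> * cmod c0 \<le> 3 * l * cmod c0" by (intro mult_right_mono s) auto
    finally show ?thesis by simp
  qed
  show "exp (- 2 * l * t) * (cmod (c0 + c1) - 3 * l * cmod c0) - 2 * exp (- t / 2) * (cmod c0 + cmod c1) \<le> cmod y"
  proof -
    have "exp (- 2 * l * t) * (cmod (c0 + c1) - 3 * l * cmod c0) \<le> exp (- 2 * l * t) * cmod a"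
      by (intro mult_left_mono \<open>_ \<le> cmod a\<close>) auto
    also have "\<dots> \<le> e1 * cmod a" by (intro mult_right_mono e1l) auto
    finally have 1: "exp (- 2 * l * t) * (cmod (c0 + c1) - 3 * l * cmod c0) \<le> e1 * cmod a" .
    have 2: "e2 * cmod d \<le> exp (- t / 2) * (cmod c0 + cmod c1)" using e by (intro mult_mono e2h nd) auto
    have 3: "0 \<le> exp (- t / 2) * (cmod c0 + cmod c1)" by simp
    have "e1 * cmod a - e2 * cmod d \<le> cmod (complex_of_real e1 * a - complex_of_real e2 * d)"
      using norm_triangle_ineq2[of "complex_of_real e1 * a" "complex_of_real e2 * d"] e by (simp add: norm_mult)
    also have "\<dots> \<le> cmod y" unfolding ny using mult_left_mono[OF wi(1) norm_ge_zero] by (metis mult_1_right)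
    finally show ?thesis using 1 2 3 by linarith
  qed
qed

section \<open>Solutions on the Fourier side\<close>

lemma has_fourier_difference_quotient:
  assumes "has_fourier f F" "has_fourier g G" "has_fourier h H"
  shows "has_fourier (\<lambda>x. (f x - g x) / c - h x) (\<lambda>\<xi>. (F \<xi> - G \<xi>) / c - H \<xi>)"
  using has_fourier_diff[OF has_fourier_lin[OF assms(1,2), of "1 / c" "- 1 / c"] assms(3)]
  by (simp add: diff_divide_distrib)

lemma Y_difference_quotient:
  assumes "f \<in> Y \<delta>" "g \<in> Y \<delta>" "h \<in> Y \<delta>"
  shows "(\<lambda>x. (f x - g x) / c - h x) \<in> Y \<delta>"
  using Y_lin[OF Y_lin[OF assms(1,2), of "1 / c" "- 1 / c"] assms(3), of 1 "-1"]
  by (simp add: diff_divide_distrib)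

lemma has_fourier_L2_norm_le_Y_norm:
  assumes "has_fourier f F" "f \<in> Y \<delta>" "\<delta> \<ge> 0"
  shows "L2_norm F \<le> Y_norm \<delta> f"
  unfolding has_fourier_norm[OF assms(1)] by (rule L2_norm_le_Y_norm[OF assms(2,3)])

lemma tendsto_zero_at_within_halfline:
  fixes f g :: "real \<Rightarrow> real"
  assumes "(g \<longlongrightarrow> 0) (at t within {0..})" "\<And>s. s \<ge> 0 \<Longrightarrow> s \<noteq> t \<Longrightarrow> \<bar>f s\<bar> \<le> g s"
  shows "(f \<longlongrightarrow> 0) (at t within {0..})"
  by (rule Lim_null_comparison[OF _ assms(1)]) (use assms(2) in \<open>auto simp: eventually_at_filter\<close>)

definition damping :: "real ^ ('n::finite) \<Rightarrow> real" where
  "damping \<xi> = 1 / (1 + log_symbol \<xi>)"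

lemma damping_measurable [measurable]: "damping \<in> borel_measurable borel"
  unfolding damping_def[abs_def] by measurable

lemma damping_bounds: "0 < damping \<xi>" "damping \<xi> \<le> 1"
  by (auto simp: damping_def divide_le_eq add_pos_nonneg)

text \<open>By Plancherel the \<open>Y\<close> norms dominate L2 norms of transforms, so every
  regularity statement passes to the Fourier side in L2. The second derivative is then eliminated
  through the equation, which is why the statements about it concern positive times only.\<close>

lemma solution_transform:
  fixes u0 u1 :: "real ^ 'n::finite \<Rightarrow> complex"
  assumes sol: "is_solution u0 u1 u" and m: "u0 \<in> borel_measurable lborel" "u1 \<in> borel_measurable lborel"
  obtains U V where
    "\<And>t. t \<ge> 0 \<Longrightarrow> has_fourier (u t) (U t)" "\<And>t. t \<ge> 0 \<Longrightarrow> V t \<in> L2"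
    "has_fourier u0 (U 0)" "has_fourier u1 (V 0)"
    "\<And>t. t \<ge> 0 \<Longrightarrow> ((\<lambda>s. L2_norm (\<lambda>\<xi>. U s \<xi> - U t \<xi>)) \<longlongrightarrow> 0) (at t within {0..})"
    "\<And>t. t \<ge> 0 \<Longrightarrow> ((\<lambda>s. L2_norm (\<lambda>\<xi>. V s \<xi> - V t \<xi>)) \<longlongrightarrow> 0) (at t within {0..})"
    "\<And>t. t \<ge> 0 \<Longrightarrow> ((\<lambda>s. L2_norm (\<lambda>\<xi>. (U s \<xi> - U t \<xi>) / complex_of_real (s - t) - V t \<xi>)) \<longlongrightarrow> 0) (at t within {0..})"
    "\<And>t. t > 0 \<Longrightarrow> (\<lambda>\<xi>. - (complex_of_real (log_symbol \<xi>) * U t \<xi>) - complex_of_real (damping \<xi>) * V t \<xi>) \<in> L2"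
    "\<And>t. t > 0 \<Longrightarrow> ((\<lambda>s. L2_norm (\<lambda>\<xi>. (V s \<xi> - V t \<xi>) / complex_of_real (s - t)
        - (- (complex_of_real (log_symbol \<xi>) * U t \<xi>) - complex_of_real (damping \<xi>) * V t \<xi>))) \<longlongrightarrow> 0) (at t within {0..})"
proof -
  from sol obtain v a where
    mem: "\<And>t. t \<ge> 0 \<Longrightarrow> u t \<in> Y 2" "\<And>t. t \<ge> 0 \<Longrightarrow> v t \<in> Y 1" "\<And>t. t \<ge> 0 \<Longrightarrow> a t \<in> L2"
    and cu: "curve_continuous (Y_norm 2) u" and du: "curve_derivative (Y_norm 1) u v"
    and cv: "curve_continuous (Y_norm 1) v" and dv: "curve_derivative L2_norm v a"
    and eq: "\<And>t. t > 0 \<Longrightarrow> \<exists>Lu w. L_graph (u t) Lu \<and> IL_inverse_graph (v t) w \<and> (AE x in lborel. a t x + Lu x + w x = 0)"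
    and init: "AE x in lborel. u 0 x = u0 x" "AE x in lborel. v 0 x = u1 x"
    unfolding is_solution_def by blast
  define U where "U t = fourier (u t)" for t
  define V where "V t = fourier (v t)" for t
  define A where "A t \<xi> = - (complex_of_real (log_symbol \<xi>) * U t \<xi>) - complex_of_real (damping \<xi>) * V t \<xi>" for t \<xi>
  have hU: "has_fourier (u t) (U t)" if "t \<ge> 0" for t unfolding U_def by (rule Y_has_fourier[OF mem(1)[OF that]])
  have hV: "has_fourier (v t) (V t)" if "t \<ge> 0" for t unfolding V_def by (rule Y_has_fourier[OF mem(2)[OF that]])
  have u1: "u t \<in> Y 1" if "t \<ge> 0" for t using Y_mono[OF mem(1)[OF that], of 1] by simp
  have measU: "U t \<in> borel_measurable borel" "V t \<in> borel_measurable borel" if "t \<ge> 0" for t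
    using has_fourier_L2(2)[OF hU[OF that]] has_fourier_L2(2)[OF hV[OF that]] by (auto simp: L2_def)
  have Ydiff: "(\<lambda>x. f x - g x) \<in> Y \<delta>" if "f \<in> Y \<delta>" "g \<in> Y \<delta>" for f g :: "'n fn" and \<delta>
    using Y_lin[OF that, of 1 "-1"] by simp
  have hA: "has_fourier (a t) (A t)" if t: "t > 0" for t
  proof -
    have t0: "t \<ge> 0" using t by simp
    note [measurable] = measU[OF t0]
    from eq[OF t] obtain Lu w where Lu: "L_graph (u t) Lu" and w: "IL_inverse_graph (v t) w"
      and aeq: "AE x in lborel. a t x + Lu x + w x = 0" by blast
    from Lu obtain F1 G1 where F1: "has_fourier (u t) F1" and G1: "has_fourier Lu G1"
      and FG1: "AE \<xi> in lborel. G1 \<xi> = complex_of_real (log_symbol \<xi>) * F1 \<xi>" by (auto simp: L_graph_def)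
    from w obtain g F2 G2 where F2: "has_fourier w F2" and G2: "has_fourier g G2"
      and FG2: "AE \<xi> in lborel. G2 \<xi> = complex_of_real (log_symbol \<xi>) * F2 \<xi>"
      and veq: "AE x in lborel. w x + g x = v t x" by (auto simp: IL_inverse_graph_def L_graph_def)
    have 1: "has_fourier (\<lambda>x. (-1) * Lu x + (-1) * w x) (\<lambda>\<xi>. (-1) * G1 \<xi> + (-1) * F2 \<xi>)"
      by (rule has_fourier_lin[OF G1 F2])
    have U: "AE \<xi> in lborel. F1 \<xi> = U t \<xi>" by (rule has_fourier_unique[OF F1 hU[OF t0]])
    \<comment> \<open>The inverse operator is known only by its graph: transforming
      \<open>w + L w = v t\<close> gives \<open>(1 + l) F2 = V t\<close>, so \<open>F2\<close> is
      the damping times \<open>V t\<close>.\<close>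
    have "has_fourier (v t) (\<lambda>\<xi>. 1 * F2 \<xi> + 1 * G2 \<xi>)"
      by (rule has_fourier_cong[OF has_fourier_lin[OF F2 G2, of 1 1]])
         (use veq has_fourier_L2[OF F2] has_fourier_L2[OF G2] has_fourier_L2[OF hV[OF t0]] in \<open>auto simp: L2_def\<close>)
    from has_fourier_unique[OF this hV[OF t0]] have V: "AE \<xi> in lborel. F2 \<xi> + G2 \<xi> = V t \<xi>" by simp
    show ?thesis
    proof (rule has_fourier_cong[OF 1])
      show "a t \<in> borel_measurable lborel" using mem(3)[OF t0] by (simp add: L2_def)
      show "AE x in lborel. -1 * Lu x + -1 * w x = a t x"
        using aeq
      proof eventually_elim
        case (elim x)
        then have "a t x = - (Lu x + w x)" by (simp only: add.assoc eq_neg_iff_add_eq_0)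
        then show ?case by simp
      qed
      show "A t \<in> borel_measurable lborel" unfolding A_def[abs_def] by measurable
      show "AE \<xi> in lborel. - 1 * G1 \<xi> + - 1 * F2 \<xi> = A t \<xi>"
        using FG1 FG2 U V
      proof eventually_elim
        case (elim \<xi>)
        have nz: "1 + complex_of_real (log_symbol \<xi>) \<noteq> 0"
          using log_symbol_nonneg[of \<xi>] by (metis add_nonneg_eq_0_iff of_real_1 of_real_add of_real_eq_0_iff zero_le_one zero_neq_one)
        have "V t \<xi> = (1 + complex_of_real (log_symbol \<xi>)) * F2 \<xi>" using elim by (simp add: algebra_simps)
        then have "complex_of_real (damping \<xi>) * V t \<xi> = F2 \<xi>"
          using nz by (simp add: damping_def)
        then show ?case using elim by (simp add: A_def)
      qed
    qed
  qed
  have "((\<lambda>s. L2_norm (\<lambda>\<xi>. U s \<xi> - U t \<xi>)) \<longlongrightarrow> 0) (at t within {0..})" if t: "t \<ge> 0" for t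
  proof (rule tendsto_zero_at_within_halfline)
    show "((\<lambda>s. Y_norm 2 (\<lambda>x. u s x - u t x)) \<longlongrightarrow> 0) (at t within {0..})"
      using cu t by (auto simp: curve_continuous_def)
    show "\<bar>L2_norm (\<lambda>\<xi>. U s \<xi> - U t \<xi>)\<bar> \<le> Y_norm 2 (\<lambda>x. u s x - u t x)" if "s \<ge> 0" for s
      using has_fourier_L2_norm_le_Y_norm[OF has_fourier_diff[OF hU[OF that] hU[OF t]] Ydiff[OF mem(1)[OF that] mem(1)[OF t]]] by simp
  qed
  moreover have "((\<lambda>s. L2_norm (\<lambda>\<xi>. V s \<xi> - V t \<xi>)) \<longlongrightarrow> 0) (at t within {0..})" if t: "t \<ge> 0" for t
  proof (rule tendsto_zero_at_within_halfline)
    show "((\<lambda>s. Y_norm 1 (\<lambda>x. v s x - v t x)) \<longlongrightarrow> 0) (at t within {0..})"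
      using cv t by (auto simp: curve_continuous_def)
    show "\<bar>L2_norm (\<lambda>\<xi>. V s \<xi> - V t \<xi>)\<bar> \<le> Y_norm 1 (\<lambda>x. v s x - v t x)" if "s \<ge> 0" for s
      using has_fourier_L2_norm_le_Y_norm[OF has_fourier_diff[OF hV[OF that] hV[OF t]] Ydiff[OF mem(2)[OF that] mem(2)[OF t]]] by simp
  qed
  moreover have "((\<lambda>s. L2_norm (\<lambda>\<xi>. (U s \<xi> - U t \<xi>) / complex_of_real (s - t) - V t \<xi>)) \<longlongrightarrow> 0) (at t within {0..})" if t: "t \<ge> 0" for t
  proof (rule tendsto_zero_at_within_halfline)
    show "((\<lambda>s. Y_norm 1 (\<lambda>x. (u s x - u t x) / complex_of_real (s - t) - v t x)) \<longlongrightarrow> 0) (at t within {0..})"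
      using du t by (auto simp: curve_derivative_def)
    show "\<bar>L2_norm (\<lambda>\<xi>. (U s \<xi> - U t \<xi>) / complex_of_real (s - t) - V t \<xi>)\<bar>
        \<le> Y_norm 1 (\<lambda>x. (u s x - u t x) / complex_of_real (s - t) - v t x)" if "s \<ge> 0" for s
      using has_fourier_L2_norm_le_Y_norm[OF has_fourier_difference_quotient[OF hU[OF that] hU[OF t] hV[OF t]]
          Y_difference_quotient[OF u1[OF that] u1[OF t] mem(2)[OF t]]] by simp
  qed
  moreover have "((\<lambda>s. L2_norm (\<lambda>\<xi>. (V s \<xi> - V t \<xi>) / complex_of_real (s - t) - A t \<xi>)) \<longlongrightarrow> 0) (at t within {0..})" if t: "t > 0" for t
  proof (rule tendsto_zero_at_within_halfline)
    have t0: "t \<ge> 0" using t by simp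
    have "((\<lambda>s. L2_norm (\<lambda>x. (v s x - v t x) / complex_of_real (s - t) - a t x)) \<longlongrightarrow> 0) (at t within {0..})"
      using dv t by (auto simp: curve_derivative_def)
    from tendsto_mult_left[OF this, of "sqrt ((2 * pi) ^ CARD('n))"]
    show "((\<lambda>s. sqrt ((2 * pi) ^ CARD('n)) * L2_norm (\<lambda>x. (v s x - v t x) / complex_of_real (s - t) - a t x)) \<longlongrightarrow> 0) (at t within {0..})"
      by simp
    show "\<bar>L2_norm (\<lambda>\<xi>. (V s \<xi> - V t \<xi>) / complex_of_real (s - t) - A t \<xi>)\<bar>
        \<le> sqrt ((2 * pi) ^ CARD('n)) * L2_norm (\<lambda>x. (v s x - v t x) / complex_of_real (s - t) - a t x)" if "s \<ge> 0" for s
      using has_fourier_norm[OF has_fourier_difference_quotient[OF hV[OF that] hV[OF t0] hA[OF t]]] by simp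
  qed
  moreover have "has_fourier u0 (U 0)"
    by (rule has_fourier_cong[OF hU[of 0]]) (use init m measU[of 0] in auto)
  moreover have "has_fourier u1 (V 0)"
    by (rule has_fourier_cong[OF hV[of 0]]) (use init m measU[of 0] in auto)
  moreover have "A t \<in> L2" if "t > 0" for t by (rule has_fourier_L2(2)[OF hA[OF that]])
  moreover note hU has_fourier_L2(2)[OF hV]
  ultimately show thesis
    by (intro that[of U V]) (simp_all add: A_def[abs_def])
qed

section \<open>Evolution of the characteristic modes\<close>

lemma L2_bounded_lin:
  assumes "f \<in> L2" "g \<in> L2" "c \<in> borel_measurable lborel" "d \<in> borel_measurable lborel"
    "\<And>\<xi>. cmod (c \<xi>) \<le> M" "\<And>\<xi>. cmod (d \<xi>) \<le> M"
  shows "(\<lambda>\<xi>. c \<xi> * f \<xi> + d \<xi> * g \<xi>) \<in> L2"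
    and "L2_norm (\<lambda>\<xi>. c \<xi> * f \<xi> + d \<xi> * g \<xi>) \<le> M * L2_norm f + M * L2_norm g"
proof -
  note c = L2_bounded_mult[OF assms(1,3,5)] and d = L2_bounded_mult[OF assms(2,4,6)]
  show "(\<lambda>\<xi>. c \<xi> * f \<xi> + d \<xi> * g \<xi>) \<in> L2" by (rule L2_add(1)[OF c(1) d(1)])
  show "L2_norm (\<lambda>\<xi>. c \<xi> * f \<xi> + d \<xi> * g \<xi>) \<le> M * L2_norm f + M * L2_norm g"
    using L2_add(2)[OF c(1) d(1)] c(2) d(2) by linarith
qed

text \<open>Restricted to frequencies with \<open>norm \<xi> \<le> R\<close>, the root is a bounded
  multiplier and the general evolution lemma applies to the truncated mode \<open>Z\<close>. The
  balls of integer radius exhaust the space, and countably many null sets may be collected.\<close>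

lemma characteristic_mode_evolution:
  fixes U V :: "real \<Rightarrow> real ^ 'n::finite \<Rightarrow> complex" and r :: "real ^ 'n \<Rightarrow> complex"
  assumes L2: "\<And>t. t \<ge> 0 \<Longrightarrow> U t \<in> L2" "\<And>t. t \<ge> 0 \<Longrightarrow> V t \<in> L2"
    and cU: "((\<lambda>s. L2_norm (\<lambda>\<xi>. U s \<xi> - U 0 \<xi>)) \<longlongrightarrow> 0) (at 0 within {0..})"
    and cV: "((\<lambda>s. L2_norm (\<lambda>\<xi>. V s \<xi> - V 0 \<xi>)) \<longlongrightarrow> 0) (at 0 within {0..})"
    and dU: "\<And>t. t \<ge> 0 \<Longrightarrow> ((\<lambda>s. L2_norm (\<lambda>\<xi>. (U s \<xi> - U t \<xi>) / complex_of_real (s - t) - V t \<xi>)) \<longlongrightarrow> 0) (at t within {0..})"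
    and A: "\<And>t. t > 0 \<Longrightarrow> (\<lambda>\<xi>. - (complex_of_real (log_symbol \<xi>) * U t \<xi>) - complex_of_real (damping \<xi>) * V t \<xi>) \<in> L2"
    and dV: "\<And>t. t > 0 \<Longrightarrow> ((\<lambda>s. L2_norm (\<lambda>\<xi>. (V s \<xi> - V t \<xi>) / complex_of_real (s - t)
        - (- (complex_of_real (log_symbol \<xi>) * U t \<xi>) - complex_of_real (damping \<xi>) * V t \<xi>))) \<longlongrightarrow> 0) (at t within {0..})"
    and r: "r \<in> borel_measurable borel" "\<And>\<xi>. cmod (r \<xi>) \<le> 2 + log_symbol \<xi>"
      "\<And>\<xi>. r \<xi> * (complex_of_real (damping \<xi>) + r \<xi>) = - complex_of_real (log_symbol \<xi>)"
    and t: "t \<ge> 0"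
  shows "AE \<xi> in lborel. V t \<xi> + (complex_of_real (damping \<xi>) + r \<xi>) * U t \<xi>
    = exp (r \<xi> * complex_of_real t) * (V 0 \<xi> + (complex_of_real (damping \<xi>) + r \<xi>) * U 0 \<xi>)"
proof -
  have "AE \<xi> in lborel. norm \<xi> \<le> real R \<longrightarrow> V t \<xi> + (complex_of_real (damping \<xi>) + r \<xi>) * U t \<xi>
    = exp (r \<xi> * complex_of_real t) * (V 0 \<xi> + (complex_of_real (damping \<xi>) + r \<xi>) * U 0 \<xi>)" for R :: nat
  proof -
    define i :: "real ^ 'n \<Rightarrow> complex" where "i \<xi> = (if norm \<xi> \<le> real R then 1 else 0)" for \<xi>
    define d where "d \<xi> = i \<xi> * (complex_of_real (damping \<xi>) + r \<xi>)" for \<xi>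
    define \<rho> where "\<rho> \<xi> = i \<xi> * r \<xi>" for \<xi>
    \<comment> \<open>On the ball \<open>r\<close> is at most 2 + l and \<open>damping + r\<close>
      at most 3 + l in modulus, so one constant bounds all three multipliers.\<close>
    define M where "M = 3 + ln (1 + (real R)\<^sup>2)"
    have [measurable]: "r \<in> borel_measurable borel" "i \<in> borel_measurable borel"
      using r by (auto simp: i_def[abs_def])
    have im: "i \<in> borel_measurable lborel" and dm: "d \<in> borel_measurable lborel" and rm: "\<rho> \<in> borel_measurable lborel"
      unfolding d_def[abs_def] \<rho>_def[abs_def] by measurable
    have M1: "1 \<le> M" by (simp add: M_def)
    have ls: "log_symbol \<xi> \<le> M - 3" if "norm \<xi> \<le> real R" for \<xi> :: "real ^ 'n"
      unfolding log_symbol_def M_def using that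
      by (simp add: add_pos_nonneg ln_le_cancel_iff power_mono)
    have ib: "cmod (i \<xi>) \<le> M" for \<xi> using M1 by (simp add: i_def)
    have rb: "cmod (\<rho> \<xi>) \<le> M" for \<xi>
      using ls[of \<xi>] r(2)[of \<xi>] M1 by (auto simp: \<rho>_def i_def)
    have db: "cmod (d \<xi>) \<le> M" for \<xi>
    proof (cases "norm \<xi> \<le> real R")
      case True
      have "cmod (d \<xi>) \<le> cmod (complex_of_real (damping \<xi>)) + cmod (r \<xi>)"
        using True norm_triangle_ineq[of "complex_of_real (damping \<xi>)" "r \<xi>"] by (simp add: d_def i_def)
      also have "cmod (complex_of_real (damping \<xi>)) \<le> 1" using damping_bounds[of \<xi>] by simp
      finally show ?thesis using ls[OF True] r(2)[of \<xi>] by simp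
    qed (use M1 in \<open>simp add: d_def i_def\<close>)
    define Z where "Z t \<xi> = i \<xi> * V t \<xi> + d \<xi> * U t \<xi>" for t \<xi>
    have "AE \<xi> in lborel. Z t \<xi> = exp (\<rho> \<xi> * complex_of_real t) * Z 0 \<xi>"
    proof (rule multiplier_evolution[OF _ rm rb _ _ t])
      show "Z t \<in> L2" if "t \<ge> 0" for t
        unfolding Z_def by (rule L2_bounded_lin(1)[OF L2(2)[OF that] L2(1)[OF that] im dm ib db])
      show "((\<lambda>s. L2_norm (\<lambda>\<xi>. Z s \<xi> - Z 0 \<xi>)) \<longlongrightarrow> 0) (at 0 within {0..})"
      proof (rule tendsto_zero_at_within_halfline)
        show "((\<lambda>s. M * L2_norm (\<lambda>\<xi>. V s \<xi> - V 0 \<xi>) + M * L2_norm (\<lambda>\<xi>. U s \<xi> - U 0 \<xi>)) \<longlongrightarrow> 0) (at 0 within {0..})"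
          using tendsto_add[OF tendsto_mult_left[OF cV, of M] tendsto_mult_left[OF cU, of M]] by simp
        show "\<bar>L2_norm (\<lambda>\<xi>. Z s \<xi> - Z 0 \<xi>)\<bar> \<le> M * L2_norm (\<lambda>\<xi>. V s \<xi> - V 0 \<xi>) + M * L2_norm (\<lambda>\<xi>. U s \<xi> - U 0 \<xi>)"
          if "s \<ge> 0" for s
        proof -
          have e: "(\<lambda>\<xi>. Z s \<xi> - Z 0 \<xi>) = (\<lambda>\<xi>. i \<xi> * (V s \<xi> - V 0 \<xi>) + d \<xi> * (U s \<xi> - U 0 \<xi>))"
            by (auto simp: Z_def algebra_simps)
          show ?thesis unfolding e
            using L2_bounded_lin(2)[OF L2_diff(1)[OF L2(2)[OF that] L2(2)[of 0]] L2_diff(1)[OF L2(1)[OF that] L2(1)[of 0]] im dm ib db]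
            by simp
        qed
      qed
      fix p :: real assume p: "p > 0"
      then have p0: "p \<ge> 0" by simp
      define A where "A \<xi> = - (complex_of_real (log_symbol \<xi>) * U p \<xi>) - complex_of_real (damping \<xi>) * V p \<xi>" for \<xi>
      have AL: "A \<in> L2" unfolding A_def using assms(6)[OF p] .
      let ?DU = "\<lambda>s \<xi>. (U s \<xi> - U p \<xi>) / complex_of_real (s - p) - V p \<xi>"
      let ?DV = "\<lambda>s \<xi>. (V s \<xi> - V p \<xi>) / complex_of_real (s - p) - A \<xi>"
      show "((\<lambda>s. L2_norm (\<lambda>\<xi>. (Z s \<xi> - Z p \<xi>) / complex_of_real (s - p) - \<rho> \<xi> * Z p \<xi>)) \<longlongrightarrow> 0) (at p within {0..})"
      proof (rule tendsto_zero_at_within_halfline)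
        show "((\<lambda>s. M * L2_norm (?DV s) + M * L2_norm (?DU s)) \<longlongrightarrow> 0) (at p within {0..})"
          using tendsto_add[OF tendsto_mult_left[OF dV[OF p], of M] tendsto_mult_left[OF dU[OF p0], of M]]
          by (simp add: A_def)
        show "\<bar>L2_norm (\<lambda>\<xi>. (Z s \<xi> - Z p \<xi>) / complex_of_real (s - p) - \<rho> \<xi> * Z p \<xi>)\<bar> \<le> M * L2_norm (?DV s) + M * L2_norm (?DU s)"
          if s: "s \<ge> 0" for s
        proof -
          \<comment> \<open>The characteristic equation replaces \<open>r * (damping + r)\<close> by
            minus the symbol: the derivative of the mode, computed from the system, is
            \<open>r\<close> times the mode itself.\<close>
          have "\<rho> \<xi> * Z p \<xi> = i \<xi> * A \<xi> + d \<xi> * V p \<xi>" for \<xi>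
          proof (cases "norm \<xi> \<le> real R")
            case True
            have "r \<xi> * (V p \<xi> + (complex_of_real (damping \<xi>) + r \<xi>) * U p \<xi>)
               = r \<xi> * V p \<xi> + (r \<xi> * (complex_of_real (damping \<xi>) + r \<xi>)) * U p \<xi>" by (simp add: algebra_simps)
            then show ?thesis using True
              unfolding r(3) by (simp add: \<rho>_def Z_def d_def i_def A_def algebra_simps)
          qed (simp add: \<rho>_def Z_def d_def i_def)
          then have e: "(\<lambda>\<xi>. (Z s \<xi> - Z p \<xi>) / complex_of_real (s - p) - \<rho> \<xi> * Z p \<xi>) = (\<lambda>\<xi>. i \<xi> * ?DV s \<xi> + d \<xi> * ?DU s \<xi>)"
            by (auto simp: Z_def diff_divide_distrib add_divide_distrib algebra_simps)
          have q: "(\<lambda>\<xi>. (f \<xi> - g \<xi>) / complex_of_real (s - p) - h \<xi>) \<in> L2" if "f \<in> L2" "g \<in> L2" "h \<in> L2" for f g h :: "'n fn"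
            using L2_diff(1)[OF L2_cmult(1)[OF L2_diff(1)[OF that(1,2)], of "1 / complex_of_real (s - p)"] that(3)] by simp
          show ?thesis unfolding e
            using L2_bounded_lin(2)[OF q[OF L2(2)[OF s] L2(2)[OF p0] AL] q[OF L2(1)[OF s] L2(1)[OF p0] L2(2)[OF p0]] im dm ib db]
            by simp
        qed
      qed
    qed
    then show ?thesis by eventually_elim (auto simp: Z_def d_def i_def \<rho>_def)
  qed
  then have "AE \<xi> in lborel. \<forall>R::nat. norm \<xi> \<le> real R \<longrightarrow> V t \<xi> + (complex_of_real (damping \<xi>) + r \<xi>) * U t \<xi>
    = exp (r \<xi> * complex_of_real t) * (V 0 \<xi> + (complex_of_real (damping \<xi>) + r \<xi>) * U 0 \<xi>)"
    unfolding AE_all_countable by blast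
  then show ?thesis
    by eventually_elim (meson real_arch_simple)
qed

section \<open>The characteristic roots as functions of the frequency\<close>

definition discriminant :: "real ^ ('n::finite) \<Rightarrow> real" where
  "discriminant \<xi> = (damping \<xi>)\<^sup>2 - 4 * log_symbol \<xi>"

text \<open>A square root of the discriminant for either sign: one of the two summands always
  vanishes. Built from real square roots, it is visibly measurable.\<close>

definition root_gap :: "real ^ ('n::finite) \<Rightarrow> complex" where
  "root_gap \<xi> = complex_of_real (sqrt (max 0 (discriminant \<xi>))) + \<i> * complex_of_real (sqrt (max 0 (- discriminant \<xi>)))"

definition char_root :: "complex \<Rightarrow> real ^ ('n::finite) \<Rightarrow> complex" where
  "char_root \<sigma> \<xi> = (\<sigma> * root_gap \<xi> - complex_of_real (damping \<xi>)) / 2"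

lemma root_gap_square: "root_gap \<xi> * root_gap \<xi> = complex_of_real (discriminant \<xi>)"
proof (cases "discriminant \<xi> \<ge> 0")
  case True
  then show ?thesis by (simp add: root_gap_def max_def flip: of_real_mult)
next
  case False
  then have "root_gap \<xi> = \<i> * complex_of_real (sqrt (- discriminant \<xi>))" by (simp add: root_gap_def max_def)
  moreover have "sqrt (- discriminant \<xi>) * sqrt (- discriminant \<xi>) = - discriminant \<xi>" using False by simp
  ultimately show ?thesis
    by (simp add: algebra_simps flip: of_real_mult)
qed

lemma char_root_measurable [measurable]: "char_root \<sigma> \<in> borel_measurable borel"
  unfolding char_root_def[abs_def] root_gap_def discriminant_def by measurable

lemma char_root_equation:
  assumes "\<sigma> * \<sigma> = 1"
  shows "char_root \<sigma> \<xi> * (complex_of_real (damping \<xi>) + char_root \<sigma> \<xi>) = - complex_of_real (log_symbol \<xi>)"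
proof -
  have "char_root \<sigma> \<xi> * (complex_of_real (damping \<xi>) + char_root \<sigma> \<xi>)
    = ((\<sigma> * \<sigma>) * (root_gap \<xi> * root_gap \<xi>) - (complex_of_real (damping \<xi>))\<^sup>2) / 4"
    by (simp add: char_root_def power2_eq_square field_simps)
  then show ?thesis unfolding assms root_gap_square by (simp add: discriminant_def)
qed

lemma char_root_bound:
  assumes "cmod \<sigma> = 1"
  shows "cmod (char_root \<sigma> \<xi>) \<le> 2 + log_symbol \<xi>"
proof -
  have "(cmod (root_gap \<xi>))\<^sup>2 = \<bar>discriminant \<xi>\<bar>"
    using arg_cong[OF root_gap_square[of \<xi>], of cmod] by (simp add: norm_mult power2_eq_square)
  also have "\<dots> \<le> 1 + 4 * log_symbol \<xi>"
  proof -
    have "(damping \<xi>)\<^sup>2 \<le> 1" using damping_bounds[of \<xi>] by (simp add: power_le_one)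
    then show ?thesis
      using zero_le_power2[of "damping \<xi>"] log_symbol_nonneg[of \<xi>]
      unfolding discriminant_def by (intro abs_leI) linarith+
  qed
  also have "\<dots> \<le> (2 + log_symbol \<xi>)\<^sup>2" using log_symbol_nonneg[of \<xi>] by (simp add: power2_sum)
  finally have "cmod (root_gap \<xi>) \<le> 2 + log_symbol \<xi>"
    by (rule power2_le_imp_le) (use log_symbol_nonneg[of \<xi>] in simp)
  moreover have "cmod (\<sigma> * root_gap \<xi> - complex_of_real (damping \<xi>)) \<le> cmod (root_gap \<xi>) + damping \<xi>"
    using norm_triangle_ineq4[of "\<sigma> * root_gap \<xi>" "complex_of_real (damping \<xi>)"] assms damping_bounds[of \<xi>]
    by (simp add: norm_mult)
  ultimately have "cmod (\<sigma> * root_gap \<xi> - complex_of_real (damping \<xi>)) \<le> (2 + log_symbol \<xi>) + (2 + log_symbol \<xi>)"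
    using damping_bounds[of \<xi>] log_symbol_nonneg[of \<xi>] by linarith
  then show ?thesis by (simp add: char_root_def norm_divide)
qed

lemma char_root_sum_product:
  "char_root 1 \<xi> + char_root (- 1) \<xi> = - complex_of_real (damping \<xi>)"
  "char_root 1 \<xi> - char_root (- 1) \<xi> = root_gap \<xi>"
  "char_root 1 \<xi> * char_root (- 1) \<xi> = complex_of_real (log_symbol \<xi>)"
proof -
  show s: "char_root 1 \<xi> + char_root (- 1) \<xi> = - complex_of_real (damping \<xi>)"
    by (simp add: char_root_def field_simps)
  show "char_root 1 \<xi> - char_root (- 1) \<xi> = root_gap \<xi>"
    by (simp add: char_root_def field_simps)
  have "char_root (- 1) \<xi> = - (complex_of_real (damping \<xi>) + char_root 1 \<xi>)"
    using s by (simp add: algebra_simps eq_neg_iff_add_eq_0)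
  then show "char_root 1 \<xi> * char_root (- 1) \<xi> = complex_of_real (log_symbol \<xi>)"
    using char_root_equation[of 1 \<xi>] by (simp only: mult_minus_right) simp
qed

text \<open>Vanishing means \<open>4 l (1 + l)^2 = 1\<close>, whose left side is strictly increasing
  in \<open>l\<close>. So \<open>l\<close>, and with it the norm of the frequency, is determined,
  and the zero set lies in one sphere.\<close>

lemma AE_discriminant_nonzero: "AE \<xi> in lborel. discriminant (\<xi> :: real ^ 'n::finite) \<noteq> 0"
proof (cases "\<exists>\<eta> :: real ^ 'n. discriminant \<eta> = 0")
  case True
  then obtain \<eta> :: "real ^ 'n" where \<eta>: "discriminant \<eta> = 0" by blast
  have l: "4 * log_symbol \<xi> * (1 + log_symbol \<xi>)\<^sup>2 = 1" if "discriminant \<xi> = 0" for \<xi> :: "real ^ 'n"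
    using that log_symbol_nonneg[of \<xi>] by (simp add: discriminant_def damping_def power_divide field_simps)
  have mono: "4 * a * (1 + a)\<^sup>2 < 4 * c * (1 + c)\<^sup>2" if "0 \<le> a" "a < c" for a c :: real
    using that by (intro mult_strict_mono[of "4 * a" "4 * c"] power_strict_mono) auto
  have "norm \<xi> = norm \<eta>" if "discriminant \<xi> = 0" for \<xi> :: "real ^ 'n"
  proof -
    have "log_symbol \<xi> = log_symbol \<eta>"
      using l[OF that] l[OF \<eta>] mono[of "log_symbol \<xi>" "log_symbol \<eta>"] mono[of "log_symbol \<eta>" "log_symbol \<xi>"]
        log_symbol_nonneg[of \<xi>] log_symbol_nonneg[of \<eta>]
      by (metis less_irrefl linorder_neqE_linordered_idom)
    then have "(norm \<xi>)\<^sup>2 = (norm \<eta>)\<^sup>2"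
      by (simp add: log_symbol_def add_pos_nonneg)
    then show ?thesis by simp
  qed
  then have sub: "{\<xi> :: real ^ 'n. discriminant \<xi> = 0} \<subseteq> sphere 0 (norm \<eta>)" by auto
  have "sphere (0 :: real ^ 'n) (norm \<eta>) \<in> null_sets lborel"
    using negligible_sphere[of "0 :: real ^ 'n" "norm \<eta>"]
    by (auto simp: null_sets_completion_iff negligible_iff_null_sets)
  then show ?thesis
    by (rule AE_I') (use sub in auto)
qed auto

text \<open>The scalar oscillator at time \<open>t\<close> with initial value \<open>c0\<close> and
  velocity \<open>c1\<close>. Where the roots coincide, division by zero makes it 0 instead of the
  confluent solution; this affects only a null set.\<close>

definition propagator :: "real \<Rightarrow> real ^ ('n::finite) \<Rightarrow> complex \<Rightarrow> complex \<Rightarrow> complex" where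
  "propagator t \<xi> c0 c1 =
    (exp (char_root 1 \<xi> * complex_of_real t) * (c1 + (complex_of_real (damping \<xi>) + char_root 1 \<xi>) * c0)
     - exp (char_root (- 1) \<xi> * complex_of_real t) * (c1 + (complex_of_real (damping \<xi>) + char_root (- 1) \<xi>) * c0))
    / root_gap \<xi>"

text \<open>Subtracting the two modes at time \<open>t\<close> cancels the velocity and leaves
  \<open>root_gap\<close> times the transform, which can be divided out almost everywhere.\<close>

lemma solution_representation:
  fixes u0 u1 :: "real ^ 'n::finite \<Rightarrow> complex"
  assumes sol: "is_solution u0 u1 u"
    and u: "integrable lborel u0" "u0 \<in> L2" "integrable lborel u1" "u1 \<in> L2" and t: "t \<ge> 0"
  obtains U where "has_fourier (u t) U"
    "AE \<xi> in lborel. discriminant \<xi> \<noteq> 0 \<and> U \<xi> = propagator t \<xi> (fourier_L1 u0 \<xi>) (fourier_L1 u1 \<xi>)"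
proof -
  obtain U V where UV:
    "\<And>t. t \<ge> 0 \<Longrightarrow> has_fourier (u t) (U t)" "\<And>t. t \<ge> 0 \<Longrightarrow> V t \<in> L2"
    "has_fourier u0 (U 0)" "has_fourier u1 (V 0)"
    "\<And>t. t \<ge> 0 \<Longrightarrow> ((\<lambda>s. L2_norm (\<lambda>\<xi>. U s \<xi> - U t \<xi>)) \<longlongrightarrow> 0) (at t within {0..})"
    "\<And>t. t \<ge> 0 \<Longrightarrow> ((\<lambda>s. L2_norm (\<lambda>\<xi>. V s \<xi> - V t \<xi>)) \<longlongrightarrow> 0) (at t within {0..})"
    "\<And>t. t \<ge> 0 \<Longrightarrow> ((\<lambda>s. L2_norm (\<lambda>\<xi>. (U s \<xi> - U t \<xi>) / complex_of_real (s - t) - V t \<xi>)) \<longlongrightarrow> 0) (at t within {0..})"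
    "\<And>t. t > 0 \<Longrightarrow> (\<lambda>\<xi>. - (complex_of_real (log_symbol \<xi>) * U t \<xi>) - complex_of_real (damping \<xi>) * V t \<xi>) \<in> L2"
    "\<And>t. t > 0 \<Longrightarrow> ((\<lambda>s. L2_norm (\<lambda>\<xi>. (V s \<xi> - V t \<xi>) / complex_of_real (s - t)
        - (- (complex_of_real (log_symbol \<xi>) * U t \<xi>) - complex_of_real (damping \<xi>) * V t \<xi>))) \<longlongrightarrow> 0) (at t within {0..})"
    using solution_transform[OF sol] u by (auto simp: L2_def)
  have mode: "AE \<xi> in lborel. V t \<xi> + (complex_of_real (damping \<xi>) + char_root \<sigma> \<xi>) * U t \<xi>
    = exp (char_root \<sigma> \<xi> * complex_of_real t) * (V 0 \<xi> + (complex_of_real (damping \<xi>) + char_root \<sigma> \<xi>) * U 0 \<xi>)"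
    if "\<sigma> * \<sigma> = 1" "cmod \<sigma> = 1" for \<sigma>
    by (rule characteristic_mode_evolution[OF has_fourier_L2(2)[OF UV(1)] UV(2) UV(5)[of 0] UV(6)[of 0] UV(7-9)
          char_root_measurable char_root_bound[OF that(2)] char_root_equation[OF that(1)] t]) auto
  have "AE \<xi> in lborel. U 0 \<xi> = fourier_L1 u0 \<xi>" "AE \<xi> in lborel. V 0 \<xi> = fourier_L1 u1 \<xi>"
    using has_fourier_unique[OF UV(3) has_fourier_fourier_L1[OF u(1,2)]]
      has_fourier_unique[OF UV(4) has_fourier_fourier_L1[OF u(3,4)]] by auto
  then have "AE \<xi> in lborel. discriminant \<xi> \<noteq> 0 \<and> U t \<xi> = propagator t \<xi> (fourier_L1 u0 \<xi>) (fourier_L1 u1 \<xi>)"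
    using mode[of 1, simplified] mode[of "- 1", simplified] AE_discriminant_nonzero
  proof eventually_elim
    case (elim \<xi>)
    have nz: "root_gap \<xi> \<noteq> 0" using elim(5) root_gap_square[of \<xi>] by auto
    have "root_gap \<xi> * U t \<xi> = (V t \<xi> + (complex_of_real (damping \<xi>) + char_root 1 \<xi>) * U t \<xi>)
       - (V t \<xi> + (complex_of_real (damping \<xi>) + char_root (- 1) \<xi>) * U t \<xi>)"
      unfolding char_root_sum_product(2)[symmetric] by (simp add: algebra_simps)
    then have "root_gap \<xi> * U t \<xi> = root_gap \<xi> * propagator t \<xi> (fourier_L1 u0 \<xi>) (fourier_L1 u1 \<xi>)"
      using nz elim unfolding elim(3,4) by (simp add: propagator_def)
    with nz elim(5) show ?case by simp
  qed
  with UV(1)[OF t] show thesis by (rule that)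
qed

text \<open>The constant 68 is \<open>4 (1 + L)\<close> with \<open>L = 16\<close>.\<close>

lemma propagator_high_frequency:
  assumes "discriminant \<xi> \<noteq> 0" "1/16 \<le> log_symbol \<xi>" "t \<ge> 0"
  shows "(cmod (propagator t \<xi> c0 c1))\<^sup>2 \<le> 3 * exp (- (damping \<xi> * t / 68)) * ((cmod c0)\<^sup>2 + (cmod c1)\<^sup>2 / log_symbol \<xi>)"
proof -
  have "root_gap \<xi> \<noteq> 0" using assms(1) root_gap_square[of \<xi>] by auto
  then have ne: "char_root 1 \<xi> \<noteq> char_root (- 1) \<xi>" using char_root_sum_product(2)[of \<xi>] by auto
  have "0 < log_symbol \<xi>" "1 \<le> 16 * log_symbol \<xi>" using assms(2) by auto
  from two_roots_solution_bound[OF this(1) damping_bounds _ this(2) assms(3) ne char_root_sum_product(1,3)]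
  show ?thesis unfolding propagator_def char_root_sum_product(2) by simp
qed

lemma propagator_low_frequency:
  assumes l: "log_symbol \<xi> \<le> 1/16" and t: "t \<ge> 0"
  shows "cmod (propagator t \<xi> c0 c1) \<le> 4 * exp (- log_symbol \<xi> * t) * (cmod c0 + cmod c1)"
    and "exp (- 2 * log_symbol \<xi> * t) * (cmod (c0 + c1) - 3 * log_symbol \<xi> * cmod c0)
      - 2 * exp (- t / 2) * (cmod c0 + cmod c1) \<le> cmod (propagator t \<xi> c0 c1)"
proof -
  define w where "w = sqrt ((damping \<xi>)\<^sup>2 - 4 * log_symbol \<xi>)"
  have b: "damping \<xi> = 1 / (1 + log_symbol \<xi>)" by (simp add: damping_def)
  have "discriminant \<xi> > 0"
    using small_symbol_roots(1)[OF log_symbol_nonneg l b w_def] by (simp add: discriminant_def)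
  then have g: "root_gap \<xi> = complex_of_real w" by (simp add: root_gap_def w_def discriminant_def max_def)
  have r: "char_root 1 \<xi> = complex_of_real ((w - damping \<xi>) / 2)"
    "char_root (- 1) \<xi> = complex_of_real (- (w + damping \<xi>) / 2)"
    by (auto simp: char_root_def g)
  note bounds = low_frequency_bounds[OF log_symbol_nonneg l b w_def t, where ?c0.0 = c0 and ?c1.0 = c1]
  show "cmod (propagator t \<xi> c0 c1) \<le> 4 * exp (- log_symbol \<xi> * t) * (cmod c0 + cmod c1)"
    using bounds(1) unfolding propagator_def g r .
  show "exp (- 2 * log_symbol \<xi> * t) * (cmod (c0 + c1) - 3 * log_symbol \<xi> * cmod c0)
      - 2 * exp (- t / 2) * (cmod c0 + cmod c1) \<le> cmod (propagator t \<xi> c0 c1)"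
    using bounds(2) unfolding propagator_def g r .
qed

section \<open>Decay rates\<close>

text \<open>The phase differs from 1 by at most \<open>|x \<bullet> \<xi>|\<close>, so the first
  moment in the \<open>L11\<close> norm gives a linear modulus of continuity at the origin.\<close>

lemma fourier_L1_near_0:
  fixes f :: "real ^ 'n::finite \<Rightarrow> complex"
  assumes "f \<in> L11"
  shows "cmod (fourier_L1 f \<xi> - P f) \<le> norm \<xi> * L11_norm f"
proof -
  have f: "integrable lborel f" and w: "integrable lborel (\<lambda>x. (1 + norm x) * cmod (f x))"
    using assms by (auto simp: L11_def)
  have "fourier_L1 f \<xi> - P f = (\<integral>x. exp (- \<i> * complex_of_real (x \<bullet> \<xi>)) * f x - f x \<partial>lborel)"
    unfolding fourier_L1_def P_def using fourier_L1_integrand[OF f] f by simp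
  also have "cmod \<dots> \<le> (\<integral>x. cmod (exp (- \<i> * complex_of_real (x \<bullet> \<xi>)) * f x - f x) \<partial>lborel)"
    by (rule integral_norm_bound)
  also have "\<dots> \<le> (\<integral>x. norm \<xi> * ((1 + norm x) * cmod (f x)) \<partial>lborel)"
  proof (intro integral_mono)
    show "integrable lborel (\<lambda>x. norm \<xi> * ((1 + norm x) * cmod (f x)))" using w by simp
    show "integrable lborel (\<lambda>x. cmod (exp (- \<i> * complex_of_real (x \<bullet> \<xi>)) * f x - f x))"
      using fourier_L1_integrand[OF f, of \<xi>] f by auto
    fix x
    have "cmod (exp (- \<i> * complex_of_real (x \<bullet> \<xi>)) - 1) \<le> \<bar>x \<bullet> \<xi>\<bar>"
      using Taylor_exp[of "- \<i> * complex_of_real (x \<bullet> \<xi>)" 0] by (simp add: norm_mult)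
    also have "\<dots> \<le> norm \<xi> * (1 + norm x)"
      using Cauchy_Schwarz_ineq2[of x \<xi>] by (simp add: algebra_simps add_increasing)
    finally have "cmod (exp (- \<i> * complex_of_real (x \<bullet> \<xi>)) - 1) * cmod (f x) \<le> norm \<xi> * (1 + norm x) * cmod (f x)"
      by (intro mult_right_mono) auto
    then show "cmod (exp (- \<i> * complex_of_real (x \<bullet> \<xi>)) * f x - f x) \<le> norm \<xi> * ((1 + norm x) * cmod (f x))"
      unfolding norm_mult[symmetric] by (simp add: algebra_simps)
  qed
  finally show ?thesis by (simp add: L11_norm_def)
qed

text \<open>Raise \<open>x / k \<le> exp (x / k)\<close> to the power \<open>k\<close>. It exchanges
  exponential decay in \<open>t / (1 + l)\<close> for an algebraic rate and a power of the
  weight.\<close>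

lemma exp_minus_le_powr:
  fixes x k :: real
  assumes "x > 0" "k > 0"
  shows "exp (- x) \<le> (k / x) powr k"
proof -
  have "x / k \<le> exp (x / k)" using exp_ge_add_one_self[of "x / k"] by linarith
  then have "(x / k) powr k \<le> exp (x / k) powr k" using assms by (intro powr_mono2) auto
  also have "\<dots> = exp x" using assms by (simp add: powr_def)
  finally show ?thesis using assms
    by (simp add: exp_minus powr_divide field_simps)
qed

section \<open>Comparison of the symbol with the squared frequency\<close>

lemma log_symbol_le: "log_symbol \<xi> \<le> (norm \<xi>)\<^sup>2"
  unfolding log_symbol_def by (rule ln_add_one_self_le_self) simp

text \<open>The number \<open>1 + |\<xi>|^2\<close> is the exponential of the symbol, to which the
  quadratic bound on [0,1] applies. This turns \<open>exp (- 2 l t)\<close> into a Gaussian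
  majorant.\<close>

lemma norm_square_le_log_symbol:
  assumes "log_symbol \<xi> \<le> 1"
  shows "(norm \<xi>)\<^sup>2 \<le> 2 * log_symbol \<xi>"
proof -
  have "1 + (norm \<xi>)\<^sup>2 = exp (log_symbol \<xi>)" by (simp add: log_symbol_def add_pos_nonneg)
  also have "\<dots> \<le> 1 + log_symbol \<xi> + (log_symbol \<xi>)\<^sup>2" by (rule exp_bound) (use assms in auto)
  also have "(log_symbol \<xi>)\<^sup>2 \<le> log_symbol \<xi>"
    using mult_left_mono[OF assms log_symbol_nonneg[of \<xi>]] by (simp add: power2_eq_square)
  finally show ?thesis by simp
qed

lemma high_frequency_weight:
  assumes l: "1/16 \<le> log_symbol \<xi>" and t: "t > 0" and k: "k > 0" and that: "x \<ge> 0" "y \<ge> 0"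
  shows "3 * exp (- (damping \<xi> * t / 68)) * (x + y / log_symbol \<xi>)
    \<le> 51 * (68 * k) powr k * t powr (- k) * ((1 + log_symbol \<xi>) powr k * x + (1 + log_symbol \<xi>) powr (k - 1) * y)"
proof -
  let ?l = "log_symbol \<xi>"
  have l1: "1 + ?l > 0" using l by linarith
  have "exp (- (damping \<xi> * t / 68)) \<le> (k / (damping \<xi> * t / 68)) powr k"
    by (rule exp_minus_le_powr) (use damping_bounds[of \<xi>] t k in auto)
  also have "k / (damping \<xi> * t / 68) = (68 * k) * (1 + ?l) / t" by (simp add: damping_def)
  also have "\<dots> powr k = (68 * k) powr k * t powr (- k) * (1 + ?l) powr k"
  proof -
    have "(68 * k * (1 + ?l) / t) powr k = (68 * k * (1 + ?l)) powr k / t powr k"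
      by (rule powr_divide)
    also have "(68 * k * (1 + ?l)) powr k = (68 * k) powr k * (1 + ?l) powr k"
      by (rule powr_mult)
    finally show ?thesis by (simp add: powr_minus divide_inverse mult_ac)
  qed
  finally have e: "exp (- (damping \<xi> * t / 68)) \<le> (68 * k) powr k * t powr (- k) * (1 + ?l) powr k" .
  \<comment> \<open>For \<open>l \<ge> 1/16\<close> the symbol and \<open>1 + l\<close> are
    comparable. This saves one power of the weight on the velocity datum, and 51 is 3 times
    17.\<close>
  have "1 / ?l \<le> 17 / (1 + ?l)" using l l1 by (simp add: divide_simps)
  from mult_right_mono[OF this that(2)] have "x + y / ?l \<le> 17 * (x + y / (1 + ?l))"
    using that(1) by (simp add: algebra_simps add_increasing add_mono)
  then have "3 * exp (- (damping \<xi> * t / 68)) * (x + y / ?l)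
    \<le> 3 * ((68 * k) powr k * t powr (- k) * (1 + ?l) powr k) * (17 * (x + y / (1 + ?l)))"
    using e l l1 that by (intro mult_mono) auto
  also have "\<dots> = 51 * (68 * k) powr k * t powr (- k) * ((1 + ?l) powr k * x + ((1 + ?l) powr k / (1 + ?l)) * y)"
    by (simp add: algebra_simps)
  also have "(1 + ?l) powr k / (1 + ?l) = (1 + ?l) powr (k - 1)"
    using l1 by (simp add: powr_diff)
  finally show ?thesis .
qed

text \<open>At low frequencies the transforms of the data are bounded by their L1 norms, and the
  Gaussian integral supplies the rate; at high frequencies the weighted integrals supply it.
  \<open>C\<close> depends on the data alone, so it serves every solution and every positive
  time.\<close>

lemma solution_upper_bound:
  fixes u0 u1 :: "real ^ 'n::finite \<Rightarrow> complex"
  assumes u0: "integrable lborel u0" "u0 \<in> Y \<delta>" "real CARD('n) / 2 \<le> \<delta>"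
    and u1: "integrable lborel u1" "u1 \<in> Y \<gamma>" "real CARD('n) / 2 - 1 \<le> \<gamma>"
  obtains C where "C > 0"
    "\<And>u t. is_solution u0 u1 u \<Longrightarrow> t > 0 \<Longrightarrow> L2_norm (u t) \<le> C * t powr (- (real CARD('n) / 4))"
proof -
  define k where "k = real CARD('n) / 2"
  have k: "k > 0" by (simp add: k_def)
  define F0 where "F0 = fourier_L1 u0"
  define F1 where "F1 = fourier_L1 u1"
  have u0L: "u0 \<in> L2" and u1L: "u1 \<in> L2" using u0 u1 by (auto simp: Y_def)
  have m [measurable]: "F0 \<in> borel_measurable borel" "F1 \<in> borel_measurable borel"
    using fourier_L1_measurable[of u0] fourier_L1_measurable[of u1] u0 u1 by (auto simp: F0_def F1_def)
  define N where "N = (\<integral>x. cmod (u0 x) \<partial>lborel) + (\<integral>x. cmod (u1 x) \<partial>lborel)"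
  have N: "cmod (F0 \<xi>) + cmod (F1 \<xi>) \<le> N" for \<xi>
    unfolding N_def F0_def F1_def by (intro add_mono fourier_L1_bound u0 u1)
  define W0 where "W0 \<xi> = (1 + log_symbol \<xi>) powr k * (cmod (F0 \<xi>))\<^sup>2" for \<xi>
  define W1 where "W1 \<xi> = (1 + log_symbol \<xi>) powr (k - 1) * (cmod (F1 \<xi>))\<^sup>2" for \<xi>
  have W: "integrable lborel W0" "integrable lborel W1"
    unfolding W0_def[abs_def] W1_def[abs_def] F0_def F1_def k_def
    by (rule Y_weighted_integrable[OF Y_mono[OF u0(2,3)] has_fourier_fourier_L1[OF u0(1) u0L]]
        Y_weighted_integrable[OF Y_mono[OF u1(2,3)] has_fourier_fourier_L1[OF u1(1) u1L]])+
  have Wn: "W0 \<xi> \<ge> 0" "W1 \<xi> \<ge> 0" for \<xi> by (auto simp: W0_def W1_def)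
  define D where "D = 51 * (68 * k) powr k"
  define G where "G = 16 * N\<^sup>2 * 2 powr (- k) * sqrt (2 * pi) ^ CARD('n) + D * ((\<integral>\<xi>. W0 \<xi> \<partial>lborel) + (\<integral>\<xi>. W1 \<xi> \<partial>lborel))"
  have G0: "G \<ge> 0" using Wn by (simp add: G_def D_def)
  let ?c = "sqrt ((2 * pi) ^ CARD('n))"
  have c: "?c > 0" by simp
  show thesis
  \<comment> \<open>Adding 1 keeps the constant positive even if \<open>G\<close> is zero.\<close>
  proof (rule that[of "(sqrt G + 1) / ?c"])
    show "(sqrt G + 1) / ?c > 0" using G0 c by (intro divide_pos_pos add_nonneg_pos) auto
    fix u t assume sol: "is_solution u0 u1 u" and t: "t > (0::real)"
    obtain U where U: "has_fourier (u t) U"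
      and rep: "AE \<xi> in lborel. discriminant \<xi> \<noteq> 0 \<and> U \<xi> = propagator t \<xi> (F0 \<xi>) (F1 \<xi>)"
      using solution_representation[OF sol u0(1) u0L u1(1) u1L, of t] t by (auto simp: F0_def F1_def)
    have UL: "integrable lborel (\<lambda>\<xi>. (cmod (U \<xi>))\<^sup>2)" using has_fourier_L2(2)[OF U] by (simp add: L2_def)
    \<comment> \<open>With this scale \<open>?g\<close> is \<open>exp (- t |\<xi>|^2)\<close>, whose
      integral is a multiple of \<open>t powr (- k)\<close>.\<close>
    define s where "s = sqrt (2 * t)"
    have s: "s > 0" "s\<^sup>2 = 2 * t" using t by (auto simp: s_def)
    let ?g = "\<lambda>\<xi>::real^'n. exp (- (norm (s *\<^sub>R \<xi>))\<^sup>2 / 2)"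
    have gi: "integrable lborel ?g" by (rule scaled_gauss_fourier(1)[OF s(1)])
    have gv: "(\<integral>\<xi>. ?g \<xi> \<partial>lborel) = 2 powr (- k) * t powr (- k) * sqrt (2 * pi) ^ CARD('n)"
    proof -
      have "sqrt (2 * pi) ^ CARD('n) = s ^ CARD('n) * (\<integral>\<xi>. ?g \<xi> \<partial>lborel)"
        using lborel_integral_affine[of s "\<lambda>\<xi>::real^'n. exp (- (norm \<xi>)\<^sup>2 / 2)" 0] s gauss_integral[where 'a="real^'n"] by simp
      moreover have "s ^ CARD('n) = (2 * t) powr k"
        unfolding s_def using t by (simp add: powr_realpow[symmetric] powr_half_sqrt[symmetric] powr_powr k_def)
      ultimately show ?thesis using t
        by (simp add: powr_mult powr_minus field_simps)
    qed
    \<comment> \<open>Each summand is nonnegative and suffices in its own frequency range, so their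
      sum is a majorant everywhere and the integral need not be split.\<close>
    define B where "B \<xi> = 16 * N\<^sup>2 * ?g \<xi> + D * t powr (- k) * (W0 \<xi> + W1 \<xi>)" for \<xi>
    have Bi: "integrable lborel B" unfolding B_def using gi W by auto
    have "AE \<xi> in lborel. (cmod (U \<xi>))\<^sup>2 \<le> B \<xi>"
      using rep
    proof eventually_elim
      case (elim \<xi>)
      then have Ueq: "U \<xi> = propagator t \<xi> (F0 \<xi>) (F1 \<xi>)" and d: "discriminant \<xi> \<noteq> 0" by auto
      have nn: "0 \<le> 16 * N\<^sup>2 * ?g \<xi>" "0 \<le> D * t powr (- k) * (W0 \<xi> + W1 \<xi>)"
        using Wn[of \<xi>] by (auto simp: D_def)
      show ?case
      proof (cases "log_symbol \<xi> \<le> 1/16")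
        case True
        have "cmod (U \<xi>) \<le> 4 * exp (- log_symbol \<xi> * t) * N"
          unfolding Ueq using t True N[of \<xi>]
          by (intro order_trans[OF propagator_low_frequency(1)] mult_left_mono) auto
        then have "(cmod (U \<xi>))\<^sup>2 \<le> (4 * exp (- log_symbol \<xi> * t) * N)\<^sup>2" by (intro power_mono) auto
        also have "\<dots> = 16 * N\<^sup>2 * exp (- 2 * log_symbol \<xi> * t)"
          by (simp add: power_mult_distrib exp_double[symmetric] mult_ac)
        also have "exp (- 2 * log_symbol \<xi> * t) \<le> ?g \<xi>"
        proof -
          have "(norm \<xi>)\<^sup>2 * t \<le> 2 * log_symbol \<xi> * t"
            using norm_square_le_log_symbol[of \<xi>] True t by (intro mult_right_mono) auto
          then show ?thesis using s by (simp add: power_mult_distrib mult_ac)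
        qed
        finally have "(cmod (U \<xi>))\<^sup>2 \<le> 16 * N\<^sup>2 * ?g \<xi>" by (simp add: mult_left_mono)
        then show ?thesis using nn unfolding B_def by linarith
      next
        case False
        then have l: "1/16 \<le> log_symbol \<xi>" by simp
        have "(cmod (U \<xi>))\<^sup>2 \<le> 3 * exp (- (damping \<xi> * t / 68)) * ((cmod (F0 \<xi>))\<^sup>2 + (cmod (F1 \<xi>))\<^sup>2 / log_symbol \<xi>)"
          unfolding Ueq by (rule propagator_high_frequency[OF d l]) (use t in simp)
        also have "\<dots> \<le> D * t powr (- k) * (W0 \<xi> + W1 \<xi>)"
          unfolding D_def W0_def W1_def by (rule high_frequency_weight[OF l t k]) auto
        finally have "(cmod (U \<xi>))\<^sup>2 \<le> D * t powr (- k) * (W0 \<xi> + W1 \<xi>)" .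
        then show ?thesis using nn unfolding B_def by linarith
      qed
    qed
    then have "(\<integral>\<xi>. (cmod (U \<xi>))\<^sup>2 \<partial>lborel) \<le> (\<integral>\<xi>. B \<xi> \<partial>lborel)"
      by (rule integral_mono_AE[OF UL Bi])
    also have "\<dots> = 16 * N\<^sup>2 * (\<integral>\<xi>. ?g \<xi> \<partial>lborel) + D * t powr (- k) * ((\<integral>\<xi>. W0 \<xi> \<partial>lborel) + (\<integral>\<xi>. W1 \<xi> \<partial>lborel))"
      unfolding B_def using gi W by simp
    also have "\<dots> = G * t powr (- k)" unfolding gv G_def by (simp add: algebra_simps)
    finally have "L2_norm U \<le> sqrt (G * t powr (- k))" unfolding L2_norm_def by (rule real_sqrt_le_mono)
    also have "\<dots> = sqrt G * t powr (- (real CARD('n) / 4))"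
      using t by (simp add: real_sqrt_mult powr_half_sqrt[symmetric] powr_powr k_def)
    also have "\<dots> \<le> (sqrt G + 1) * t powr (- (real CARD('n) / 4))" by (intro mult_right_mono) auto
    finally show "L2_norm (u t) \<le> (sqrt G + 1) / ?c * t powr (- (real CARD('n) / 4))"
      unfolding has_fourier_norm[OF U] using c by (simp only: pos_le_divide_eq times_divide_eq_left) (simp only: mult.commute)
  qed
qed

text \<open>For large \<open>t\<close> the transform is at least the fixed number \<open>q\<close>
  on the ball of radius \<open>1 / sqrt t\<close>. The square root of the volume of this ball is a
  multiple of \<open>t powr (- n/4)\<close>.\<close>

lemma solution_lower_bound:
  fixes u0 u1 :: "real ^ 'n::finite \<Rightarrow> complex"
  assumes u0: "u0 \<in> L11" "u0 \<in> L2" and u1: "u1 \<in> L11" "u1 \<in> L2" and P: "P u0 + P u1 \<noteq> 0"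
  obtains c T where "c > 0"
    "\<And>u t. is_solution u0 u1 u \<Longrightarrow> t \<ge> T \<Longrightarrow>
      c * cmod (P u0 + P u1) * t powr (- (real CARD('n) / 4)) \<le> L2_norm (u t)"
proof -
  have u0i: "integrable lborel u0" and u1i: "integrable lborel u1" using u0 u1 by (auto simp: L11_def)
  define F0 where "F0 = fourier_L1 u0"
  define F1 where "F1 = fourier_L1 u1"
  define N where "N = (\<integral>x. cmod (u0 x) \<partial>lborel) + (\<integral>x. cmod (u1 x) \<partial>lborel)"
  have N: "cmod (F0 \<xi>) + cmod (F1 \<xi>) \<le> N" for \<xi>
    unfolding N_def F0_def F1_def by (intro add_mono fourier_L1_bound u0i u1i)
  have F0N: "cmod (F0 \<xi>) \<le> N" for \<xi> using N[of \<xi>] norm_ge_zero[of "F1 \<xi>"] by linarith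
  have N0: "N \<ge> 0" by (simp add: N_def)
  \<comment> \<open>Collects the errors of order \<open>1 / sqrt t\<close>: both deviations of the
    transforms from their values at 0, and the relative error 3 l in the slow coefficient.\<close>
  define K where "K = L11_norm u0 + L11_norm u1 + 3 * N"
  have L11n: "L11_norm u0 \<ge> 0" "L11_norm u1 \<ge> 0" by (auto simp: L11_norm_def)
  define p where "p = cmod (P u0 + P u1)"
  have p: "p > 0" using P by (simp add: p_def)
  \<comment> \<open>Half of the limiting lower bound: on the ball \<open>l * t \<le> 1\<close>, so
    the slow mode retains the factor \<open>exp (- 2)\<close>.\<close>
  define q where "q = exp (- 2) * p / 2"
  have q: "q > 0" using p by (simp add: q_def)
  define vol where "vol = unit_ball_vol (real CARD('n))"
  have vol: "vol > 0" by (simp add: vol_def)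
  let ?c = "sqrt ((2 * pi) ^ CARD('n))"
  have c: "?c > 0" by simp
  have "((\<lambda>t. exp (- 2) * (p - K / sqrt t) - 2 * exp (- t / 2) * N) \<longlongrightarrow> exp (- 2) * p) at_top"
    by real_asymp
  moreover have "q < exp (- 2) * p" using p by (simp add: q_def)
  ultimately have "\<forall>\<^sub>F t in at_top. q < exp (- 2) * (p - K / sqrt t) - 2 * exp (- t / 2) * N"
    by (rule order_tendstoD)
  \<comment> \<open>From \<open>t = 16\<close> on, the ball lies in the low-frequency region, since
    there \<open>l \<le> 1 / t\<close>.\<close>
  then have "\<forall>\<^sub>F t in at_top. q \<le> exp (- 2) * (p - K / sqrt t) - 2 * exp (- t / 2) * N \<and> t \<ge> 16"
    using eventually_ge_at_top[of 16] by eventually_elim auto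
  then obtain T where T: "\<And>t. t \<ge> T \<Longrightarrow> q \<le> exp (- 2) * (p - K / sqrt t) - 2 * exp (- t / 2) * N \<and> t \<ge> 16"
    by (auto simp: eventually_at_top_linorder)
  show thesis
  proof (rule that[of "exp (- 2) / 2 * sqrt vol / ?c" T])
    show "exp (- 2) / 2 * sqrt vol / ?c > 0" using vol c by simp
    fix u t assume sol: "is_solution u0 u1 u" and tT: "t \<ge> T"
    from T[OF tT] have t: "t \<ge> 16" and qt: "q \<le> exp (- 2) * (p - K / sqrt t) - 2 * exp (- t / 2) * N" by auto
    have st: "sqrt t \<ge> 1" using t by simp
    have pK: "p - K / sqrt t \<ge> 0"
    proof -
      have "0 \<le> 2 * exp (- t / 2) * N" using N0 by simp
      then have "0 \<le> exp (- 2) * (p - K / sqrt t)" using qt q by linarith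
      then show ?thesis by (simp add: zero_le_mult_iff)
    qed
    define \<rho> where "\<rho> = 1 / sqrt t"
    have \<rho>: "\<rho> > 0" "\<rho> \<le> 1" "\<rho>\<^sup>2 = 1 / t" using t st by (auto simp: \<rho>_def power_divide)
    obtain U where U: "has_fourier (u t) U"
      and rep: "AE \<xi> in lborel. discriminant \<xi> \<noteq> 0 \<and> U \<xi> = propagator t \<xi> (F0 \<xi>) (F1 \<xi>)"
      using solution_representation[OF sol u0i u0(2) u1i u1(2), of t] t by (auto simp: F0_def F1_def)
    have UL: "integrable lborel (\<lambda>\<xi>. (cmod (U \<xi>))\<^sup>2)" using has_fourier_L2(2)[OF U] by (simp add: L2_def)
    have "AE \<xi> in lborel. indicat_real (ball 0 \<rho>) \<xi> * q\<^sup>2 \<le> (cmod (U \<xi>))\<^sup>2"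
      using rep
    proof eventually_elim
      case (elim \<xi>)
      show ?case
      proof (cases "\<xi> \<in> ball 0 \<rho>")
        case True
        then have n: "norm \<xi> \<le> \<rho>" by simp
        then have "(norm \<xi>)\<^sup>2 \<le> \<rho>\<^sup>2" by (intro power_mono) auto
        then have l: "log_symbol \<xi> \<le> 1 / t" using log_symbol_le[of \<xi>] \<rho> by linarith
        have l16: "log_symbol \<xi> \<le> 1/16" 
        proof -
          have "1 / t \<le> 1/16" using t by (simp add: field_simps)
          with l show ?thesis by linarith
        qed
        have lt: "log_symbol \<xi> * t \<le> 1" using l t by (simp add: field_simps)
        \<comment> \<open>The symbol is even at most the square of \<open>\<rho>\<close>; the weaker
          linear bound lets it join the other errors in \<open>K / sqrt t\<close>.\<close>
        have lr: "log_symbol \<xi> \<le> \<rho>"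
          using l \<rho> mult_right_mono[of \<rho> 1 \<rho>] by (simp add: power2_eq_square)
        have "p - K / sqrt t \<le> cmod (F0 \<xi> + F1 \<xi>) - 3 * log_symbol \<xi> * cmod (F0 \<xi>)"
        proof -
          have "cmod (F0 \<xi> - P u0) \<le> \<rho> * L11_norm u0" "cmod (F1 \<xi> - P u1) \<le> \<rho> * L11_norm u1"
            using fourier_L1_near_0[OF u0(1), of \<xi>] fourier_L1_near_0[OF u1(1), of \<xi>]
              mult_right_mono[OF n L11n(1)] mult_right_mono[OF n L11n(2)] by (auto simp: F0_def F1_def)
          moreover have "p \<le> cmod (F0 \<xi> + F1 \<xi>) + cmod (F0 \<xi> - P u0) + cmod (F1 \<xi> - P u1)"
            unfolding p_def by norm
          moreover have "log_symbol \<xi> * cmod (F0 \<xi>) \<le> \<rho> * N"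
            by (intro mult_mono lr F0N) (use \<rho> in auto)
          moreover have "K / sqrt t = \<rho> * L11_norm u0 + \<rho> * L11_norm u1 + 3 * (\<rho> * N)"
            by (simp add: K_def \<rho>_def add_divide_distrib)
          ultimately show ?thesis by simp
        qed
        then have "exp (- 2) * (p - K / sqrt t) \<le> exp (- 2 * log_symbol \<xi> * t) * (cmod (F0 \<xi> + F1 \<xi>) - 3 * log_symbol \<xi> * cmod (F0 \<xi>))"
          using pK lt by (intro mult_mono) auto
        moreover have "2 * exp (- t / 2) * (cmod (F0 \<xi>) + cmod (F1 \<xi>)) \<le> 2 * exp (- t / 2) * N"
          by (intro mult_left_mono N) auto
        moreover have "exp (- 2 * log_symbol \<xi> * t) * (cmod (F0 \<xi> + F1 \<xi>) - 3 * log_symbol \<xi> * cmod (F0 \<xi>))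
            - 2 * exp (- t / 2) * (cmod (F0 \<xi>) + cmod (F1 \<xi>)) \<le> cmod (U \<xi>)"
          unfolding conjunct2[OF elim] by (rule propagator_low_frequency(2)[OF l16]) (use t in simp)
        ultimately have "q \<le> cmod (U \<xi>)" using qt by linarith
        then show ?thesis using q True by (simp add: power_mono)
      qed simp
    qed
    moreover have ib: "integrable lborel (\<lambda>\<xi>::real^'n. indicat_real (ball 0 \<rho>) \<xi> * q\<^sup>2)"
      by (intro integrable_mult_left integrable_real_indicator) (use emeasure_bounded_finite[OF bounded_ball] in auto)
    ultimately have "(\<integral>\<xi>. indicat_real (ball (0::real^'n) \<rho>) \<xi> * q\<^sup>2 \<partial>lborel) \<le> (\<integral>\<xi>. (cmod (U \<xi>))\<^sup>2 \<partial>lborel)"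
      by (intro integral_mono_AE UL) auto
    also have "(\<integral>\<xi>. indicat_real (ball (0::real^'n) \<rho>) \<xi> * q\<^sup>2 \<partial>lborel) = vol * \<rho> ^ CARD('n) * q\<^sup>2"
      using content_ball[of \<rho> "0::real^'n"] \<rho> by (simp add: vol_def)
    finally have "sqrt (vol * \<rho> ^ CARD('n) * q\<^sup>2) \<le> L2_norm U" unfolding L2_norm_def by (rule real_sqrt_le_mono)
    moreover have "sqrt (\<rho> ^ CARD('n)) = t powr (- (real CARD('n) / 4))"
    proof -
      have e: "\<rho> = t powr (- (1/2))"
        unfolding powr_minus \<rho>_def using powr_half_sqrt[of t] t by (simp add: inverse_eq_divide)
      have "\<rho> ^ CARD('n) = \<rho> powr real CARD('n)" using \<rho> by (simp add: powr_realpow)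
      also have "\<dots> = t powr (- (real CARD('n) / 2))" unfolding e powr_powr by simp
      finally have r: "\<rho> ^ CARD('n) = t powr (- (real CARD('n) / 2))" .
      have "sqrt (\<rho> ^ CARD('n)) = (t powr (- (real CARD('n) / 2))) powr (1/2)"
        unfolding r by (rule powr_half_sqrt[symmetric]) simp
      then show ?thesis unfolding powr_powr by simp
    qed
    ultimately have "sqrt vol * t powr (- (real CARD('n) / 4)) * q \<le> ?c * L2_norm (u t)"
      unfolding has_fourier_norm[OF U] using q by (simp add: real_sqrt_mult)
    then have "sqrt vol * t powr (- (real CARD('n) / 4)) * q / ?c \<le> L2_norm (u t)"
      using c by (simp only: pos_divide_le_eq) (simp only: mult.commute)
    then show "exp (- 2) / 2 * sqrt vol / ?c * cmod (P u0 + P u1) * t powr (- (real CARD('n) / 4)) \<le> L2_norm (u t)"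
      by (simp add: q_def p_def mult_ac)
  qed
qed

section \<open>Positivity of the data norm and the two-sided estimate\<close>

lemma I0_pos:
  assumes u0: "u0 \<in> L11" and u1: "u1 \<in> L11" and P: "P u0 + P u1 \<noteq> 0"
  shows "I0 l u0 u1 > 0"
proof -
  \<comment> \<open>The mean is controlled by the \<open>L11\<close> norm, so a nonzero
    \<open>P u0 + P u1\<close> excludes that both norms vanish.\<close>
  have b: "cmod (P f) \<le> L11_norm f" if "f \<in> L11" for f :: "'a fn"
  proof -
    have f: "integrable lborel f" "integrable lborel (\<lambda>x. (1 + norm x) * cmod (f x))" using that by (auto simp: L11_def)
    have "cmod (P f) \<le> (\<integral>x. cmod (f x) \<partial>lborel)" unfolding P_def by (rule integral_norm_bound)
    also have "\<dots> \<le> L11_norm f" unfolding L11_norm_def using f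
      by (intro integral_mono) (auto simp: mult_le_cancel_right1)
    finally show ?thesis .
  qed
  have n: "L11_norm u0 \<noteq> 0 \<or> L11_norm u1 \<noteq> 0"
  proof (rule ccontr)
    assume "\<not> ?thesis"
    then have "P u0 = 0" "P u1 = 0" using b[OF u0] b[OF u1] by auto
    with P show False by simp
  qed
  then have "(L11_norm u0)\<^sup>2 + (L11_norm u1)\<^sup>2 > 0" by (subst sum_power2_gt_zero_iff) blast
  then show ?thesis unfolding I0_def by (simp add: add_pos_nonneg)
qed

theorem theorem1p6:
  fixes u0 u1 :: "real ^ 'n::finite \<Rightarrow> complex" and \<epsilon> :: real
  assumes "CARD('n) \<ge> 4" and "\<epsilon> > 0"
    and "u0 \<in> L11 \<inter> Y (real CARD('n) / 2 + \<epsilon>)"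
    and "u1 \<in> L11 \<inter> Y ((real CARD('n) - 2) / 2 + \<epsilon>)"
    and "P u0 + P u1 \<noteq> 0"
  shows "\<exists>C1>0. \<exists>C2>0. \<forall>u. is_solution u0 u1 u \<longrightarrow>
    (\<forall>\<^sub>F t in at_top.
       C1 * cmod (P u0 + P u1) * t powr (- (real CARD('n) / 4)) \<le> L2_norm (u t) \<and>
       L2_norm (u t) \<le> C2 * I0 (real CARD('n) / 2 + \<epsilon> - 1) u0 u1 * t powr (- (real CARD('n) / 4)))"
proof -
  have u0: "u0 \<in> L11" "u0 \<in> Y (real CARD('n) / 2 + \<epsilon>)" "u0 \<in> L2" "integrable lborel u0"
    and u1: "u1 \<in> L11" "u1 \<in> Y ((real CARD('n) - 2) / 2 + \<epsilon>)" "u1 \<in> L2" "integrable lborel u1"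
    using assms(3,4) by (auto simp: Y_def L11_def)
  obtain c T where c: "c > 0" and lower: "\<And>u t. is_solution u0 u1 u \<Longrightarrow> t \<ge> T \<Longrightarrow>
      c * cmod (P u0 + P u1) * t powr (- (real CARD('n) / 4)) \<le> L2_norm (u t)"
    using solution_lower_bound[OF u0(1,3) u1(1,3) assms(5)] by blast
  obtain C where C: "C > 0" and upper: "\<And>u t. is_solution u0 u1 u \<Longrightarrow> t > 0 \<Longrightarrow>
      L2_norm (u t) \<le> C * t powr (- (real CARD('n) / 4))"
    using solution_upper_bound[OF u0(4,2) _ u1(4,2)] assms(2) by (auto simp: diff_divide_distrib)
  let ?I = "I0 (real CARD('n) / 2 + \<epsilon> - 1) u0 u1"
  have I: "?I > 0" by (rule I0_pos[OF u0(1) u1(1) assms(5)])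
  show ?thesis
  \<comment> \<open>The constants may depend on the data but not on \<open>t\<close>, so the upper
    constant is divided by the positive number \<open>?I\<close>. Both are fixed before the solution
    \<open>u\<close>.\<close>
  proof (rule exI[of _ c], rule conjI[OF c], rule exI[of _ "C / ?I"], intro conjI allI impI)
    fix u assume sol: "is_solution u0 u1 u"
    show "\<forall>\<^sub>F t in at_top. c * cmod (P u0 + P u1) * t powr (- (real CARD('n) / 4)) \<le> L2_norm (u t) \<and>
       L2_norm (u t) \<le> C / ?I * ?I * t powr (- (real CARD('n) / 4))"
      using eventually_ge_at_top[of T] eventually_gt_at_top[of 0]
    proof eventually_elim
      case (elim t)
      then show ?case using lower[OF sol, of t] upper[OF sol, of t] I by simp
    qed
  qed (use C I in simp)
qed

end
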